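(* Let $d\geq 2$ be an integer. The locus of curves with $d$-split Jacobian, $\mathbb{T}\mathcal{L}_d\subset M_2^{tr}$, decomposes into $\varphi(d)$ subsets $$\mathbb{T}\mathcal{L}_d=\bigcup_{1\le k<d,\ \gcd(k,d)=1}L_k ,$$ where $\varphi(d)$ denotes the Euler phi function. Each $L_k$ corresponds to a $2$-dimensional fan $\Delta_k$ obtained by subdividing the positive quadrant: (a) For each maximal cone $\tilde\sigma$ of $\Delta_k$ there exists a linear map $\phi_{\tilde\sigma}:\tilde\sigma\to M_2^{tr}$ that maps the open cone (the interior of $\tilde\sigma$) to a $2$-dimensional cone in the theta part of $M_2^{tr}$. (b) Restricting $\phi_{\tilde\sigma}$ to a ray $r$ that is a face of two maximal cones yields a linear map $\phi_{\tilde\sigma|r}\times\mathrm{id}:r\times\mathbb{R}_{\ge0}\to M_2^{tr}$ whose image in the dumbbell part of $M_2^{tr}$ is $\phi_{\tilde\sigma}(r)\times r_B$, where $r_B$ denotes the ray that corresponds to the bridge edge. (c) Moreover, the linear maps are compatible in the sense that for two neighbouring maximal cones $\tilde\sigma$ and $\tilde\sigma'$ the restrictions of $\phi_{\tilde\sigma}$ and $\phi_{\tilde\sigma'}$ to a common face agree.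
   Context: $M_2^{tr}$ is the moduli space of (stable, vertex-weighted) tropical curves of genus $2$: its points are isomorphism classes of finite metric graphs $(G,l)$ with a genus function $g:V(G)\to\mathbb{Z}_{\ge0}$, satisfying the stability condition and $b_1(G)+\sum_v g(v)=2$. It is obtained by gluing the cells $\mathbb{R}_{\ge0}^{E(G)}/\mathrm{Aut}(G,g)$, where an edge of length $0$ is contracted (contracting a loop increases the genus of its vertex by $1$). The two maximal combinatorial types are the theta graph (two vertices joined by three edges) and the dumbbell graph (two loops joined by a bridge edge). The theta part and the dumbbell part of $M_2^{tr}$ are the parts coming from the cells of these two types; in the dumbbell cell, the ray $r_B=\mathbb{R}_{\ge0}$ records the length of the bridge edge and the other two coordinates record the loop lengths. A curve consisting of two loops at one vertex is both a theta curve with one edge contracted and a dumbbell with bridge of length $0$. $A_2^{tr}$ is the moduli space of principally polarized tropical abelian varieties of dimension $2$, with points the $GL_2(\mathbb{Z})$-classes $[Q]$ of positive semidefinite real symmetric $2\times2$ matrices with rational nullspace, where $X\in GL_2(\mathbb{Z})$ acts by $Q\mapsto X^TQX$. The tropical Torelli map $t_2^{tr}:M_2^{tr}\to A_2^{tr}$ sends a curve $\Gamma$ to its Jacobian, that is, to the class of its period matrix, the Gram matrix of the form on $H_1(\Gamma,\mathbb{Z})$ induced by edge lengths (extended by zero in the presence of vertex genera). For $d\ge2$, $1\le k<d$ with $\gcd(k,d)=1$ and $l',l>0$ put $$Q_{d,k}(l',l)=\begin{pmatrix}d\,l' & -k\,l'\\ -k\,l' & \frac{k^2l'+l}{d}\end{pmatrix}.$$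 This represents the split Jacobian built from tropical elliptic curves of lengths $l',l$ and the graph of the isomorphism between their $d$-torsion groups given in coordinates $\mathbb{R}/l'\mathbb{Z}$, $\mathbb{R}/l\mathbb{Z}$ by $kl'/d\mapsto l/d$. Let $\mathcal{Q}_{d,k}=\{[Q_{d,k}(l',l)]: l',l>0\}\subset A_2^{tr}$ and $\mathcal{Q}_d=\bigcup_k\mathcal{Q}_{d,k}$, and define $L_k=(t_2^{tr})^{-1}(\mathcal{Q}_{d,k})$ and $\mathbb{T}\mathcal{L}_d=(t_2^{tr})^{-1}(\mathcal{Q}_d)$. Let $\sigma$ be the cone spanned over $\mathbb{R}_{\geq 0}$ by $\begin{pmatrix}1&0\\0&0\end{pmatrix},\begin{pmatrix}0&0\\0&1\end{pmatrix},\begin{pmatrix}1&-1\\-1&1\end{pmatrix}$. The fan $\Delta_k$ associated to $L_k$ is the collection of cones obtained by subdividing $\mathbb{R}^2_{>0}$ (coordinates $(l',l)$) along the half-rays consisting of those $(l',l)$ for which $Q_{d,k}(l',l)$ is $GL_2(\mathbb{Z})$-equivalent to a matrix in the boundary of $\sigma$, and taking Euclidean closures. A map from a cone $\tilde\sigma$ to $M_2^{tr}$ is called linear if it is the composition of a linear map to the coordinates (edge lengths) of a cell with the map from that cell's cone to $M_2^{tr}$ (edges of length $0$ contracted). In (b), the map $\phi_{\tilde\sigma|r}\times\mathrm{id}$ sends $(p,t)$ to the dumbbell curve whose loop lengths are given by the non-zero entries of $\phi_{\tilde\sigma}(p)$ and whose bridge has length $t$. In (c), the restrictions are compared as maps to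 $M_2^{tr}$, i.e. up to permutation of edges. *)

theory Defs
  imports "HOL-Analysis.Analysis" "HOL-Number_Theory.Totient"
begin

text \<open>
  A finite multigraph with loops, labelled by natural numbers; \<open>src\<close> and \<open>tgt\<close> record an
  arbitrary orientation, which isomorphisms are free to reverse. Lengths \<open>0\<close> are allowed at
  this stage, so that a point of a closed cell can be written down before contraction.
\<close>

record tgraph =
  verts :: "nat set"
  edges :: "nat set"
  src :: "nat \<Rightarrow> nat"
  tgt :: "nat \<Rightarrow> nat"
  len :: "nat \<Rightarrow> real"
  genus :: "nat \<Rightarrow> nat"

definition joined :: "tgraph \<Rightarrow> nat set \<Rightarrow> (nat \<times> nat) set" where
  "joined G S =
     ((\<lambda>e. (src G e, tgt G e)) ` S \<union> (\<lambda>e. (tgt G e, src G e)) ` S)\<^sup>*"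

text \<open>The first Betti number of a connected graph with vertex set \<open>V\<close> and edge set \<open>E\<close>; by
  connectedness the subtraction does not truncate.\<close>

definition betti :: "nat set \<Rightarrow> nat set \<Rightarrow> nat" where
  "betti V E = card E + 1 - card V"

definition valence :: "tgraph \<Rightarrow> nat \<Rightarrow> nat" where
  "valence G v = card {e \<in> edges G. src G e = v} + card {e \<in> edges G. tgt G e = v}"

definition metric_graph :: "tgraph \<Rightarrow> bool" where
  "metric_graph G \<longleftrightarrow>
     finite (verts G) \<and> verts G \<noteq> {} \<and> finite (edges G) \<and>
     (\<forall>e\<in>edges G. src G e \<in> verts G \<and> tgt G e \<in> verts G \<and> 0 < len G e) \<and>
     verts G \<times> verts G \<subseteq> joined G (edges G)"

text \<open>This is the condition \<open>2 g(v) - 2 + val(v) > 0\<close>, without truncated subtraction.\<close>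

definition stable :: "tgraph \<Rightarrow> bool" where
  "stable G \<longleftrightarrow> (\<forall>v\<in>verts G. 2 < 2 * genus G v + valence G v)"

definition total_genus :: "tgraph \<Rightarrow> nat" where
  "total_genus G = betti (verts G) (edges G) + (\<Sum>v\<in>verts G. genus G v)"

definition stable_genus2 :: "tgraph set" where
  "stable_genus2 = {G. metric_graph G \<and> stable G \<and> total_genus G = 2}"

definition graph_iso :: "tgraph \<Rightarrow> tgraph \<Rightarrow> bool" where
  "graph_iso G H \<longleftrightarrow>
     (\<exists>f h. bij_betw f (verts G) (verts H) \<and> bij_betw h (edges G) (edges H) \<and>
        (\<forall>v\<in>verts G. genus H (f v) = genus G v) \<and>
        (\<forall>e\<in>edges G. {src H (h e), tgt H (h e)} = {f (src G e), f (tgt G e)} \<and>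
                     len H (h e) = len G e))"

definition curve_rel :: "(tgraph \<times> tgraph) set" where
  "curve_rel = {(G, H). G \<in> stable_genus2 \<and> H \<in> stable_genus2 \<and> graph_iso G H}"

definition M2 :: "tgraph set set" where
  "M2 = stable_genus2 // curve_rel"

text \<open>
  Contraction of all edges of length \<open>0\<close> at once. Each connected component \<open>C\<close> of the subgraph of
  zero edges becomes one vertex (named by its least element), whose genus is the sum of the
  genera in \<open>C\<close> plus the first Betti number of \<open>C\<close>. In particular contracting a single loop
  increases the genus of its vertex by \<open>1\<close>.
\<close>

definition zero_edges :: "tgraph \<Rightarrow> nat set" where
  "zero_edges G = {e \<in> edges G. len G e = 0}"

definition component_of :: "tgraph \<Rightarrow> nat \<Rightarrow> nat" where
  "component_of G v = (LEAST w. (v, w) \<in> joined G (zero_edges G))"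

definition contract :: "tgraph \<Rightarrow> tgraph" where
  "contract G =
     \<lparr> verts = component_of G ` verts G,
       edges = edges G - zero_edges G,
       src = component_of G \<circ> src G,
       tgt = component_of G \<circ> tgt G,
       len = len G,
       genus = (\<lambda>v. let V = {w \<in> verts G. component_of G w = v};
                        E = {e \<in> zero_edges G. component_of G (src G e) = v}
                    in (\<Sum>w\<in>V. genus G w) + betti V E) \<rparr>"

definition theta_graph :: "real^3 \<Rightarrow> tgraph" where
  "theta_graph x =
     \<lparr> verts = {0, 1}, edges = {0, 1, 2}, src = (\<lambda>e. 0), tgt = (\<lambda>e. 1),
       len = (\<lambda>e. if e = 0 then x $ 1 else if e = 1 then x $ 2 else x $ 3),
       genus = (\<lambda>v. 0) \<rparr>"

text \<open>Coordinates of the dumbbell cell: first loop, second loop, bridge.\<close>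

definition dumbbell_graph :: "real^3 \<Rightarrow> tgraph" where
  "dumbbell_graph x =
     \<lparr> verts = {0, 1}, edges = {0, 1, 2},
       src = (\<lambda>e. if e = 1 then 1 else 0), tgt = (\<lambda>e. if e = 0 then 0 else 1),
       len = (\<lambda>e. if e = 0 then x $ 1 else if e = 1 then x $ 2 else x $ 3),
       genus = (\<lambda>v. 0) \<rparr>"

text \<open>The maps from the two maximal closed cells to the moduli space, meaningful for
  coordinates in the non-negative orthant.\<close>

definition theta_curve :: "real^3 \<Rightarrow> tgraph set" where
  "theta_curve x = curve_rel `` {contract (theta_graph x)}"

definition dumbbell_curve :: "real^3 \<Rightarrow> tgraph set" where
  "dumbbell_curve x = curve_rel `` {contract (dumbbell_graph x)}"

definition theta_part :: "tgraph set set" where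
  "theta_part = theta_curve ` {x. \<forall>i. 0 \<le> x $ i}"

definition dumbbell_part :: "tgraph set set" where
  "dumbbell_part = dumbbell_curve ` {x. \<forall>i. 0 \<le> x $ i}"

text \<open>\<open>R \<times> r\<^sub>B\<close> for a set \<open>R\<close> of curves consisting of two (possibly contracted) loops at one
  vertex, i.e. of dumbbells with bridge length \<open>0\<close>.\<close>

definition times_bridge :: "tgraph set set \<Rightarrow> tgraph set set" where
  "times_bridge R =
     {dumbbell_curve (vector [a, b, t]) | a b t.
        0 \<le> a \<and> 0 \<le> b \<and> 0 \<le> t \<and> dumbbell_curve (vector [a, b, 0]) \<in> R}"

text \<open>A map from a cone \<open>S\<close> to the moduli space is linear if it is a cell map (\<open>theta_curve\<close> or
  \<open>dumbbell_curve\<close>) composed with an \<open>A\<close> of the following kind.\<close>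

definition linear_to_cell :: "'a::real_vector set \<Rightarrow> ('a \<Rightarrow> real^3) \<Rightarrow> bool" where
  "linear_to_cell S A \<longleftrightarrow> linear A \<and> (\<forall>p\<in>S. \<forall>i. 0 \<le> A p $ i)"

definition gl2z :: "(real^2^2) set" where
  "gl2z = {(\<chi> i j. of_int (X $ i $ j)) | X :: int^2^2. invertible X}"

definition gl2z_equiv :: "real^2^2 \<Rightarrow> real^2^2 \<Rightarrow> bool" where
  "gl2z_equiv Q Q' \<longleftrightarrow> (\<exists>X\<in>gl2z. Q' = transpose X ** Q ** X)"

text \<open>The last conjunct says that the nullspace is rational, i.e. spanned by rational vectors.\<close>

definition psd_rational :: "(real^2^2) set" where
  "psd_rational =
     {Q. transpose Q = Q \<and> (\<forall>x. 0 \<le> x \<bullet> (Q *v x)) \<and>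
         span {x. Q *v x = 0 \<and> (\<forall>i. x $ i \<in> \<rat>)} = {x. Q *v x = 0}}"

definition ppav_rel :: "((real^2^2) \<times> (real^2^2)) set" where
  "ppav_rel = {(Q, Q'). Q \<in> psd_rational \<and> Q' \<in> psd_rational \<and> gl2z_equiv Q Q'}"

definition A2 :: "(real^2^2) set set" where
  "A2 = psd_rational // ppav_rel"

text \<open>
  The lattice \<open>H\<^sub>1(\<Gamma>,\<int>) \<oplus> \<int>\<^bsup>g\<^esup>\<close>, where \<open>g\<close> is the sum of the vertex genera. An element is an integral
  function whose values at \<open>Inl e\<close> are the coefficients of a cycle and whose values at
  \<open>Inr (v, i)\<close>, \<open>i < g(v)\<close>, are the coordinates in the second summand.
\<close>

definition jac_lattice :: "tgraph \<Rightarrow> (nat + nat \<times> nat \<Rightarrow> int) set" where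
  "jac_lattice G =
     {c. (\<forall>e. e \<notin> edges G \<longrightarrow> c (Inl e) = 0) \<and>
         (\<forall>v\<in>verts G. (\<Sum>e | e \<in> edges G \<and> tgt G e = v. c (Inl e)) =
                      (\<Sum>e | e \<in> edges G \<and> src G e = v. c (Inl e))) \<and>
         (\<forall>v i. \<not> (v \<in> verts G \<and> i < genus G v) \<longrightarrow> c (Inr (v, i)) = 0)}"

text \<open>\<open>\<int>\<close>-bases with two elements; for curves of genus \<open>2\<close> the lattice has rank \<open>2\<close>.\<close>

definition lattice_basis :: "('x \<Rightarrow> int) set \<Rightarrow> (2 \<Rightarrow> 'x \<Rightarrow> int) \<Rightarrow> bool" where
  "lattice_basis L b \<longleftrightarrow>
     (\<forall>i. b i \<in> L) \<and> (\<forall>c\<in>L. \<exists>!m :: int^2. c = (\<lambda>x. \<Sum>i\<in>UNIV. m $ i * b i x))"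

text \<open>The Gram matrix of the edge length form, extended by zero on the second summand.\<close>

definition period_matrix :: "tgraph \<Rightarrow> (2 \<Rightarrow> nat + nat \<times> nat \<Rightarrow> int) \<Rightarrow> real^2^2" where
  "period_matrix G b =
     (\<chi> i j. \<Sum>e\<in>edges G. len G e * of_int (b i (Inl e)) * of_int (b j (Inl e)))"

text \<open>The class of any period matrix of any representative of the curve.\<close>

definition torelli :: "tgraph set \<Rightarrow> (real^2^2) set" where
  "torelli \<Gamma> =
     ppav_rel `` {period_matrix G b | G b. G \<in> \<Gamma> \<and> lattice_basis (jac_lattice G) b}"

definition split_indices :: "nat \<Rightarrow> nat set" where
  "split_indices d = {k. 1 \<le> k \<and> k < d \<and> coprime k d}"

text \<open>The coordinates on the quadrant are \<open>(l', l)\<close>, in this order.\<close>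

definition split_matrix :: "nat \<Rightarrow> nat \<Rightarrow> real \<times> real \<Rightarrow> real^2^2" where
  "split_matrix d k = (\<lambda>(l', l).
     vector [vector [real d * l', - (real k * l')],
             vector [- (real k * l'), ((real k)\<^sup>2 * l' + l) / real d]])"

definition open_quadrant :: "(real \<times> real) set" where
  "open_quadrant = {0<..} \<times> {0<..}"

definition split_classes :: "nat \<Rightarrow> nat \<Rightarrow> (real^2^2) set set" where
  "split_classes d k = (\<lambda>p. ppav_rel `` {split_matrix d k p}) ` open_quadrant"

definition L_locus :: "nat \<Rightarrow> nat \<Rightarrow> tgraph set set" where
  "L_locus d k = {\<Gamma> \<in> M2. torelli \<Gamma> \<in> split_classes d k}"

definition split_locus :: "nat \<Rightarrow> tgraph set set" where
  "split_locus d = {\<Gamma> \<in> M2. torelli \<Gamma> \<in> (\<Union>k\<in>split_indices d. split_classes d k)}"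

definition sigma_cone :: "(real^2^2) set" where
  "sigma_cone = convex_cone hull
     {vector [vector [1, 0], vector [0, 0]],
      vector [vector [0, 0], vector [0, 1]],
      vector [vector [1, - 1], vector [- 1, 1]]}"

text \<open>The boundary of \<open>\<sigma>\<close> is taken in the 3-dimensional space of symmetric matrices, which is the
  affine hull of \<open>\<sigma>\<close>; hence \<open>rel_frontier\<close>.\<close>

definition walls :: "nat \<Rightarrow> nat \<Rightarrow> (real \<times> real) set" where
  "walls d k =
     {p \<in> open_quadrant. \<exists>M \<in> rel_frontier sigma_cone. gl2z_equiv (split_matrix d k p) M}"

text \<open>All non-empty faces of the closures of the chambers of the quadrant cut out by the walls:
  these closures themselves, the closed half-rays on the walls and on the two coordinate axes,
  and the origin.\<close>

definition Delta :: "nat \<Rightarrow> nat \<Rightarrow> (real \<times> real) set set" where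
  "Delta d k =
     {F. F \<noteq> {} \<and> (\<exists>C\<in>components (open_quadrant - walls d k). F face_of closure C)}"

definition fan :: "'a::euclidean_space set set \<Rightarrow> bool" where
  "fan \<F> \<longleftrightarrow>
     finite \<F> \<and>
     (\<forall>C\<in>\<F>. convex_cone C \<and> polyhedron C) \<and>
     (\<forall>C\<in>\<F>. \<forall>F. F face_of C \<and> F \<noteq> {} \<longrightarrow> F \<in> \<F>) \<and>
     (\<forall>C\<in>\<F>. \<forall>D\<in>\<F>. C \<inter> D face_of C \<and> C \<inter> D face_of D)"

definition max_cones :: "'a set set \<Rightarrow> 'a set set" where
  "max_cones \<F> = {C \<in> \<F>. \<forall>D\<in>\<F>. C \<subseteq> D \<longrightarrow> C = D}"

definition inner_rays :: "'a::euclidean_space set set \<Rightarrow> 'a set set" where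
  "inner_rays \<F> =
     {r \<in> \<F>. aff_dim r = 1 \<and>
        (\<exists>C\<in>max_cones \<F>. \<exists>D\<in>max_cones \<F>. C \<noteq> D \<and> r face_of C \<and> r face_of D)}"

end

theory Submission
  imports Defs "HOL-Library.Multiset"
begin

text \<open>
  Everything rests on reduction theory for positive definite binary forms. Such a form is
  \<open>GL\<^sub>2(\<int>)\<close>-equivalent to \<open>a x\<^sup>2 + b y\<^sup>2 + c (x - y)\<^sup>2\<close> with \<open>a, b, c \<ge> 0\<close>
  (\<open>selling_reduction\<close>), and the multiset of the three coefficients is an invariant of the class
  (\<open>gl2z_equiv_selling_lengths_eq\<close>). This form is the period matrix of the theta graph with edge
  lengths \<open>a, b, c\<close>. So the fibre of the Torelli map over the class is a single theta curve if no
  coefficient vanishes. If one of them vanishes, the form is diagonal in a suitable basis, and the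
  fibre consists of the dumbbells whose loops have the two remaining lengths; the bridge is
  arbitrary, because no cycle passes through it. No other curve occurs: positive definiteness
  excludes vertex genera, and then stability leaves only the theta graph, the dumbbell and the
  bouquet of two loops (\<open>genus2_classification\<close>, \<open>pos_def_torelli_cases\<close>).

  The walls are the \<open>(l', l)\<close> for which the form \<open>Q\<^sub>d\<^sub>,\<^sub>k(l', l)\<close> has an orthogonal lattice basis. In
  the coordinates \<open>u = d x - k y\<close>, \<open>v = y\<close> this form is \<open>(l' u\<^sup>2 + l v\<^sup>2) / d\<close> on a sublattice of
  index \<open>d\<close>. Orthogonality of a basis prescribes the ratio \<open>l : l'\<close>, and the determinant
  \<open>\<plusminus>d\<close> bounds the numerator and the denominator of this ratio (\<open>split_orth_slope\<close>). Hence
  there are finitely many walls, the chambers are the open sectors between consecutive ones, and the closed sectors with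
  their faces form a fan (\<open>fan_sector_fan\<close>).

  On a chamber a single base change reduces all forms at once: the reduced form depends linearly on
  \<open>(l', l)\<close>, it could leave the interior of \<open>\<sigma>\<close> only through the boundary, that is, on a wall, and the
  chamber is connected (\<open>chamber_reduction\<close>). The coefficients of the reduced form are the linear
  map \<open>\<phi>\<close> of the chamber. On an inner ray exactly one coefficient is \<open>0\<close>, which gives the
  additional dumbbells, and uniqueness of the reduced coefficients makes the maps of neighbouring
  chambers agree up to the order of the edges.
\<close>

section \<open>Binary quadratic forms up to integral base change\<close>

lemma mat2_eq_iff: "(A::'a^2^2) = B \<longleftrightarrow> A$1$1 = B$1$1 \<and> A$1$2 = B$1$2 \<and> A$2$1 = B$2$1 \<and> A$2$2 = B$2$2"
  by (auto simp: vec_eq_iff forall_2)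

lemma vec3_eq_iff: "(x::'a^3) = y \<longleftrightarrow> x$1 = y$1 \<and> x$2 = y$2 \<and> x$3 = y$3"
  by (auto simp: vec_eq_iff forall_3)

text \<open>
  The form \<open>x\<^sub>1 X\<^sup>2 + x\<^sub>2 Y\<^sup>2 + x\<^sub>3 (X - Y)\<^sup>2\<close>: the period matrix of the theta graph with edge
  lengths \<open>x\<close>, and the element of \<open>\<sigma>\<close> with coordinates \<open>x\<close> on the three generators.
\<close>

definition selling :: "real^3 \<Rightarrow> real^2^2" where
  "selling x = vector [vector [x$1 + x$3, - x$3], vector [- x$3, x$2 + x$3]]"

lemma selling_simps [simp]:
  "selling x $ 1 $ 1 = x$1 + x$3" "selling x $ 1 $ 2 = - x$3"
  "selling x $ 2 $ 1 = - x$3" "selling x $ 2 $ 2 = x$2 + x$3"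
  by (simp_all add: selling_def)

text \<open>
  The product \<open>X\<^sup>T Q X\<close> for \<open>X\<close> with rows \<open>(p, q)\<close> and \<open>(r, s)\<close>. The entries are written out so
  that statements about base changes become polynomial identities.
\<close>

definition base_change :: "int \<Rightarrow> int \<Rightarrow> int \<Rightarrow> int \<Rightarrow> real^2^2 \<Rightarrow> real^2^2" where
  "base_change p q r s Q = vector
     [vector [Q$1$1 * p * p + (Q$1$2 + Q$2$1) * p * r + Q$2$2 * r * r,
              Q$1$1 * p * q + Q$1$2 * p * s + Q$2$1 * r * q + Q$2$2 * r * s],
      vector [Q$1$1 * p * q + Q$2$1 * p * s + Q$1$2 * r * q + Q$2$2 * r * s,
              Q$1$1 * q * q + (Q$1$2 + Q$2$1) * q * s + Q$2$2 * s * s]]"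

lemma int_mat2_invertible_iff:
  "invertible (X :: int^2^2) \<longleftrightarrow> \<bar>X$1$1 * X$2$2 - X$1$2 * X$2$1\<bar> = 1"
proof
  assume "invertible X"
  then obtain Y where "X ** Y = mat 1" by (auto simp: invertible_def)
  then have "det X * det Y = 1" by (metis det_I det_mul)
  then have "\<bar>det X\<bar> = 1" by (metis abs_zmult_eq_1 abs_1)
  then show "\<bar>X$1$1 * X$2$2 - X$1$2 * X$2$1\<bar> = 1" by (simp add: det_2)
next
  assume a: "\<bar>X$1$1 * X$2$2 - X$1$2 * X$2$1\<bar> = 1"
  define e where "e = X$1$1 * X$2$2 - X$1$2 * X$2$1"
  define Y :: "int^2^2" where
    "Y = vector [vector [e * X$2$2, - e * X$1$2], vector [- e * X$2$1, e * X$1$1]]"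
  have ee: "e * e = 1" using a unfolding e_def[symmetric] by (auto simp: abs_if split: if_splits)
  have "X ** Y = mat 1 \<and> Y ** X = mat 1"
    unfolding mat2_eq_iff using ee
    by (simp add: Y_def matrix_matrix_mult_def sum_2 mat_def e_def algebra_simps)
  then show "invertible X" unfolding invertible_def by blast
qed

lemma gl2z_equiv_iff:
  "gl2z_equiv Q Q' \<longleftrightarrow> (\<exists>p q r s. \<bar>p * s - q * r\<bar> = 1 \<and> Q' = base_change p q r s Q)"
proof
  assume "gl2z_equiv Q Q'"
  then obtain X :: "int^2^2" where X: "invertible X"
    "Q' = transpose (\<chi> i j. real_of_int (X$i$j)) ** Q ** (\<chi> i j. real_of_int (X$i$j))"
    by (auto simp: gl2z_equiv_def gl2z_def)
  have "Q' = base_change (X$1$1) (X$1$2) (X$2$1) (X$2$2) Q"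
    unfolding X(2) mat2_eq_iff
    by (simp add: base_change_def matrix_matrix_mult_def transpose_def sum_2 algebra_simps)
  then show "\<exists>p q r s. \<bar>p * s - q * r\<bar> = 1 \<and> Q' = base_change p q r s Q"
    using X(1) int_mat2_invertible_iff by blast
next
  assume "\<exists>p q r s. \<bar>p * s - q * r\<bar> = 1 \<and> Q' = base_change p q r s Q"
  then obtain p q r s where X: "\<bar>p * s - q * r\<bar> = 1" "Q' = base_change p q r s Q" by blast
  define X :: "int^2^2" where "X = vector [vector [p, q], vector [r, s]]"
  have "invertible X" using X(1) by (simp add: int_mat2_invertible_iff X_def)
  moreover have "Q' = transpose (\<chi> i j. real_of_int (X$i$j)) ** Q ** (\<chi> i j. real_of_int (X$i$j))"
    unfolding X(2) mat2_eq_iff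
    by (simp add: base_change_def matrix_matrix_mult_def transpose_def sum_2 X_def algebra_simps)
  ultimately show "gl2z_equiv Q Q'" by (auto simp: gl2z_equiv_def gl2z_def)
qed

lemma gl2z_equiv_refl: "gl2z_equiv Q Q"
  unfolding gl2z_equiv_iff
  by (rule exI[of _ 1], rule exI[of _ 0], rule exI[of _ 0], rule exI[of _ 1])
     (simp add: base_change_def mat2_eq_iff)

text \<open>
  The adjugate of an integral matrix undoes a base change of determinant \<open>\<plusminus>1\<close>.
\<close>

lemma base_change_adjugate:
  "base_change s (- q) (- r) p (base_change p q r s Q) = (real_of_int (p * s - q * r))\<^sup>2 *\<^sub>R Q"
  unfolding mat2_eq_iff by (simp add: base_change_def power2_eq_square algebra_simps)

lemma gl2z_equiv_sym:
  assumes "gl2z_equiv Q Q'" shows "gl2z_equiv Q' Q"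
proof -
  obtain p q r s where d: "\<bar>p * s - q * r\<bar> = 1" "Q' = base_change p q r s Q"
    using assms gl2z_equiv_iff by blast
  have e: "(real_of_int (p * s - q * r))\<^sup>2 = 1"
    using d(1) by (metis of_int_1 of_int_power power2_abs power_one)
  have "Q = base_change s (- q) (- r) p Q'" unfolding d(2) base_change_adjugate e by simp
  moreover have "\<bar>s * p - (- q) * (- r)\<bar> = 1" using d(1) by (simp add: mult.commute)
  ultimately show ?thesis unfolding gl2z_equiv_iff by blast
qed

lemma gl2z_equiv_trans:
  assumes "gl2z_equiv Q Q'" "gl2z_equiv Q' Q''" shows "gl2z_equiv Q Q''"
proof -
  obtain p q r s where 1: "\<bar>p * s - q * r\<bar> = 1" "Q' = base_change p q r s Q"
    using assms(1) gl2z_equiv_iff by blast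
  obtain p' q' r' s' where 2: "\<bar>p' * s' - q' * r'\<bar> = 1" "Q'' = base_change p' q' r' s' Q'"
    using assms(2) gl2z_equiv_iff by blast
  have "(p * p' + q * r') * (r * q' + s * s') - (p * q' + q * s') * (r * p' + s * r')
     = (p * s - q * r) * (p' * s' - q' * r')" by (simp add: algebra_simps)
  then have "\<bar>(p * p' + q * r') * (r * q' + s * s') - (p * q' + q * s') * (r * p' + s * r')\<bar> = 1"
    using 1(1) 2(1) by (simp add: abs_mult)
  moreover have "Q'' = base_change (p * p' + q * r') (p * q' + q * s') (r * p' + s * r') (r * q' + s * s') Q"
    unfolding 1 2 mat2_eq_iff by (simp add: base_change_def algebra_simps)
  ultimately show ?thesis unfolding gl2z_equiv_iff by blast
qed

text \<open>
  Sylvester's criterion, so that invariance under base change is the multiplicativity of the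
  determinant.
\<close>

definition pos_def :: "real^2^2 \<Rightarrow> bool" where
  "pos_def Q \<longleftrightarrow> Q$1$2 = Q$2$1 \<and> 0 < Q$1$1 \<and> 0 < Q$1$1 * Q$2$2 - Q$1$2 * Q$2$1"

lemma pos_def_imp_pos:
  assumes "pos_def Q" "x \<noteq> 0 \<or> y \<noteq> 0"
  shows "0 < Q$1$1 * x * x + 2 * Q$1$2 * x * y + Q$2$2 * y * y"
proof -
  define a b c where "a = Q$1$1" "b = Q$1$2" "c = Q$2$2"
  have h: "0 < a" "0 < a * c - b * b" using assms by (auto simp: pos_def_def a_b_c_def)
  have "a * (a * x * x + 2 * b * x * y + c * y * y) = (a * x + b * y)\<^sup>2 + (a * c - b * b) * y\<^sup>2"
    by (simp add: power2_eq_square algebra_simps)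
  also have "0 < \<dots>"
  proof (cases "y = 0")
    case True then show ?thesis using assms(2) h by simp
  next
    case False
    then have "0 < (a * c - b * b) * y\<^sup>2" using h by simp
    then show ?thesis by (meson add_nonneg_pos zero_le_power2)
  qed
  finally show ?thesis using h(1) unfolding a_b_c_def by (simp add: zero_less_mult_iff)
qed

lemma quad_form_expand:
  fixes Q :: "real^2^2"
  shows "x \<bullet> (Q *v x) = Q$1$1 * x$1 * x$1 + (Q$1$2 + Q$2$1) * x$1 * x$2 + Q$2$2 * x$2 * x$2"
  by (simp add: inner_vec_def matrix_vector_mult_def sum_2 algebra_simps)

lemma pos_def_psd_rational:
  assumes "pos_def Q" shows "Q \<in> psd_rational"
proof -
  have sym: "Q$1$2 = Q$2$1" using assms by (simp add: pos_def_def)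
  have pos: "0 < x \<bullet> (Q *v x)" if "x \<noteq> 0" for x
  proof -
    have "x$1 \<noteq> 0 \<or> x$2 \<noteq> 0" using that by (auto simp: vec_eq_iff forall_2)
    from pos_def_imp_pos[OF assms this] show ?thesis
      unfolding quad_form_expand using sym by (simp add: algebra_simps)
  qed
  then have zero: "Q *v x = 0 \<longleftrightarrow> x = 0" for x
    by (metis inner_zero_right less_irrefl matrix_vector_mult_0_right)
  have "{x. Q *v x = 0} = {0}" by (simp add: zero)
  moreover have "{x. Q *v x = 0 \<and> (\<forall>i. x $ i \<in> \<rat>)} = {0}"
    unfolding zero by auto
  moreover have "0 \<le> x \<bullet> (Q *v x)" for x using pos[of x] by (cases "x = 0") auto
  ultimately show ?thesis unfolding psd_rational_def
    using sym by (simp add: mat2_eq_iff transpose_def)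
qed

lemma gl2z_equiv_pos_def:
  assumes "gl2z_equiv Q Q'" "pos_def Q" shows "pos_def Q'"
proof -
  obtain p q r s where 1: "\<bar>p * s - q * r\<bar> = 1" "Q' = base_change p q r s Q"
    using assms(1) gl2z_equiv_iff by blast
  have sym: "Q$1$2 = Q$2$1" using assms by (simp add: pos_def_def)
  have "p \<noteq> 0 \<or> r \<noteq> 0" using 1(1) by auto
  then have "0 < Q'$1$1"
    using pos_def_imp_pos[OF assms(2), of p r] sym by (simp add: 1 base_change_def)
  moreover have "Q'$1$2 = Q'$2$1" using sym by (simp add: 1 base_change_def)
  moreover have "Q'$1$1 * Q'$2$2 - Q'$1$2 * Q'$2$1 = (real_of_int (p * s - q * r))\<^sup>2 * (Q$1$1 * Q$2$2 - Q$1$2 * Q$2$1)"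
    by (simp add: 1 base_change_def sym power2_eq_square algebra_simps)
  moreover have "(real_of_int (p * s - q * r))\<^sup>2 = 1"
    using 1(1) by (metis of_int_1 of_int_power power2_abs power_one)
  ultimately show ?thesis using assms(2) sym unfolding pos_def_def by simp
qed

text \<open>
  A positive definite form has null space \<open>0\<close> and hence lies in the domain of \<open>ppav_rel\<close>, as does
  every form equivalent to it.
\<close>

lemma ppav_class_eqI:
  assumes "pos_def Q" "gl2z_equiv Q Q'"
  shows "ppav_rel `` {Q} = ppav_rel `` {Q'}"
  using assms pos_def_psd_rational gl2z_equiv_pos_def gl2z_equiv_trans gl2z_equiv_sym
  unfolding ppav_rel_def by blast

text \<open>
  The determinant of \<open>selling x\<close> is \<open>x\<^sub>1 x\<^sub>2 + x\<^sub>1 x\<^sub>3 + x\<^sub>2 x\<^sub>3\<close>, so that at most one of the three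
  edge lengths may vanish.
\<close>

lemma pos_def_selling_iff:
  assumes "\<forall>i. 0 \<le> x $ i"
  shows "pos_def (selling x) \<longleftrightarrow> (0 < x$1 \<and> 0 < x$2) \<or> (0 < x$1 \<and> 0 < x$3) \<or> (0 < x$2 \<and> 0 < x$3)"
proof -
  have x: "0 \<le> x$1" "0 \<le> x$2" "0 \<le> x$3" using assms by auto
  have e: "(x$1 + x$3) * (x$2 + x$3) - x$3 * x$3 = x$1 * x$2 + x$1 * x$3 + x$2 * x$3"
    by (simp add: algebra_simps)
  have "0 \<le> x$1 * x$2" "0 \<le> x$1 * x$3" "0 \<le> x$2 * x$3" using x by simp_all
  then have "0 < x$1 * x$2 + x$1 * x$3 + x$2 * x$3 \<longleftrightarrow> 0 < x$1 * x$2 \<or> 0 < x$1 * x$3 \<or> 0 < x$2 * x$3"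
    by linarith
  also have "\<dots> \<longleftrightarrow> (0 < x$1 \<and> 0 < x$2) \<or> (0 < x$1 \<and> 0 < x$3) \<or> (0 < x$2 \<and> 0 < x$3)"
    using x by (auto simp: zero_less_mult_iff)
  finally show ?thesis unfolding pos_def_def selling_simps using x e by auto
qed

section \<open>Selling reduction and its uniqueness\<close>

text \<open>
  Completing the square in one variable leaves the determinant times the square of the other
  variable. So a bound on the form bounds both variables.
\<close>

lemma finite_bounded_quad_form:
  assumes "pos_def Q"
  shows "finite {(m::int, n::int). Q$1$1 * m * m + 2 * Q$1$2 * m * n + Q$2$2 * n * n \<le> R}"
proof -
  define a b c where "a = Q$1$1" "b = Q$1$2" "c = Q$2$2"
  define D where "D = a * c - b * b"
  have h: "0 < a" "0 < D" using assms by (auto simp: pos_def_def a_b_c_def D_def)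
  have c: "0 < c" using pos_def_imp_pos[OF assms, of 0 1] by (simp add: a_b_c_def)
  have bd: "D * (real_of_int m)\<^sup>2 \<le> c * R \<and> D * (real_of_int n)\<^sup>2 \<le> a * R" if "a * m * m + 2 * b * m * n + c * n * n \<le> R" for m n :: int
  proof -
    have "a * (a * m * m + 2 * b * m * n + c * n * n) = (a * m + b * n)\<^sup>2 + D * (real_of_int n)\<^sup>2"
      by (simp add: power2_eq_square algebra_simps D_def)
    moreover have "c * (a * m * m + 2 * b * m * n + c * n * n) = (c * n + b * m)\<^sup>2 + D * (real_of_int m)\<^sup>2"
      by (simp add: power2_eq_square algebra_simps D_def)
    moreover have "a * (a * m * m + 2 * b * m * n + c * n * n) \<le> a * R" "c * (a * m * m + 2 * b * m * n + c * n * n) \<le> c * R"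
      using that h c by (auto intro: mult_left_mono)
    ultimately show ?thesis
      by (smt (verit) zero_le_power2)
  qed
  have sq: "m \<in> {-\<lceil>(\<bar>c * R\<bar> + \<bar>a * R\<bar>) / D\<rceil>..\<lceil>(\<bar>c * R\<bar> + \<bar>a * R\<bar>) / D\<rceil>}" if "D * (real_of_int m)\<^sup>2 \<le> c * R \<or> D * (real_of_int m)\<^sup>2 \<le> a * R" for m :: int
  proof -
    have "\<bar>m\<bar> \<le> \<bar>m\<bar>\<^sup>2" 
    proof (cases "m = 0")
      case False
      then show ?thesis by (intro self_le_power) auto
    qed simp
    then have "\<bar>m\<bar> \<le> m\<^sup>2" by simp
    then have "real_of_int \<bar>m\<bar> \<le> (real_of_int m)\<^sup>2" by (metis of_int_le_iff of_int_power)
    also have "\<dots> \<le> (\<bar>c * R\<bar> + \<bar>a * R\<bar>) / D" using that h by (auto simp: field_simps)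
    finally have "\<bar>m\<bar> \<le> \<lceil>(\<bar>c * R\<bar> + \<bar>a * R\<bar>) / D\<rceil>" by linarith
    then show ?thesis by auto
  qed
  let ?I = "{-\<lceil>(\<bar>c * R\<bar> + \<bar>a * R\<bar>) / D\<rceil>..\<lceil>(\<bar>c * R\<bar> + \<bar>a * R\<bar>) / D\<rceil>}"
  have "{(m::int, n::int). a * m * m + 2 * b * m * n + c * n * n \<le> R} \<subseteq> ?I \<times> ?I"
    using bd sq by blast
  then show ?thesis unfolding a_b_c_def by (rule finite_subset) simp
qed

text \<open>
  Among all bases \<open>e\<^sub>1, e\<^sub>2\<close> choose one for which the sum of the values of the form at \<open>e\<^sub>1\<close>, \<open>e\<^sub>2\<close>
  and \<open>e\<^sub>1 + e\<^sub>2\<close> is minimal; it exists because only finitely many vectors have bounded value. If a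
  pair of the vectors \<open>e\<^sub>1, e\<^sub>2, -(e\<^sub>1 + e\<^sub>2)\<close> had positive inner product, then changing the sign of
  one vector of this pair would give a smaller sum.
\<close>

lemma selling_reduction:
  assumes "pos_def Q"
  obtains y where "\<forall>i. 0 \<le> y $ i" "gl2z_equiv Q (selling y)"
proof -
  define S where "S = (\<lambda>(p::int,q::int,r::int,s::int). let M = base_change p q r s Q in M$1$1 + M$2$2 + (M$1$1 + M$1$2 + M$2$1 + M$2$2))"
  define B where "B = {(p::int,q::int,r::int,s::int). \<bar>p * s - q * r\<bar> = 1}"
  have sym: "Q$1$2 = Q$2$1" using assms by (simp add: pos_def_def)
  let ?q = "\<lambda>m n. Q$1$1 * m * m + 2 * Q$1$2 * m * n + Q$2$2 * n * n"
  have S_eq: "S (p, q, r, s) = ?q p r + ?q q s + ?q (p + q) (r + s)" for p q r s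
    by (simp add: S_def base_change_def Let_def sym algebra_simps)
  have nonneg: "0 \<le> ?q x y" for x y using pos_def_imp_pos[OF assms, of x y] by (cases "x = 0 \<and> y = 0") auto
  define F where "F = {w \<in> B. S w \<le> S (1, 0, 0, 1)}"
  have "finite F"
  proof -
    let ?P = "{(m::int, n::int). ?q m n \<le> S (1, 0, 0, 1)}"
    have "F \<subseteq> (\<lambda>((p, r), (q, s)). (p, q, r, s)) ` (?P \<times> ?P)"
    proof
      fix w assume w: "w \<in> F"
      obtain p q r s where pq: "w = (p, q, r, s)" by (cases w)
      have "?q p r + ?q q s + ?q (p + q) (r + s) \<le> S (1, 0, 0, 1)" using w unfolding F_def pq by (simp add: S_eq)
      then have "?q p r \<le> S (1,0,0,1)" "?q q s \<le> S (1,0,0,1)"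
        using nonneg[of p r] nonneg[of q s] nonneg[of "p + q" "r + s"] by linarith+
      then show "w \<in> (\<lambda>((p, r), (q, s)). (p, q, r, s)) ` (?P \<times> ?P)"
        unfolding pq by (intro image_eqI[where x = "((p, r), (q, s))"]) auto
    qed
    then show ?thesis using finite_bounded_quad_form[OF assms] finite_subset by blast
  qed
  moreover have "(1, 0, 0, 1) \<in> F" by (simp add: F_def B_def)
  ultimately obtain w where w: "w \<in> F" and wmin: "\<And>v. v \<in> F \<Longrightarrow> S w \<le> S v"
    by (metis arg_min_if_finite(1) arg_min_least empty_iff)
  have min: "S w \<le> S v" if "v \<in> B" for v using wmin[of v] w that unfolding F_def
    by (cases "S v \<le> S (1, 0, 0, 1)") auto
  obtain p q r s where pq: "w = (p, q, r, s)" by (cases w)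
  define M where "M = base_change p q r s Q"
  have d: "\<bar>p * s - q * r\<bar> = 1" using w by (simp add: F_def B_def pq)
  have M: "M$1$1 = ?q p r" "M$2$2 = ?q q s" "M$1$2 = M$2$1"
     "M$1$2 = Q$1$1 * p * q + Q$1$2 * (p * s + r * q) + Q$2$2 * r * s"
    by (simp_all add: M_def base_change_def sym algebra_simps)
  \<comment> \<open>The sign changes used here and below alter the sum by \<open>-4 M\<^sub>1\<^sub>2\<close>, \<open>4 (M\<^sub>2\<^sub>2 + M\<^sub>1\<^sub>2)\<close> and \<open>4 (M\<^sub>1\<^sub>1 + M\<^sub>1\<^sub>2)\<close>.\<close>
  have "(-p, q, -r, s) \<in> B" using d by (simp add: B_def abs_if split: if_splits)
  from min[OF this] have 1: "M$1$2 \<le> 0" unfolding pq S_eq M(4) by (simp add: algebra_simps)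
  have "(p + 2 * q, -q, r + 2 * s, -s) \<in> B" "(q + 2 * p, -p, s + 2 * r, -r) \<in> B"
    using d by (auto simp: B_def algebra_simps abs_if split: if_splits)
  from this[THEN min] have 2: "0 \<le> M$2$2 + M$1$2" "0 \<le> M$1$1 + M$1$2" unfolding pq S_eq M(1,2,4) by (simp_all add: algebra_simps)
  let ?y = "vector [M$1$1 + M$1$2, M$2$2 + M$1$2, - M$1$2] :: real^3"
  have "selling ?y = M" unfolding mat2_eq_iff using M(3) by simp
  moreover have "gl2z_equiv Q M" unfolding gl2z_equiv_iff M_def using d by blast
  moreover have "\<forall>i. 0 \<le> ?y $ i" using 1 2 by (simp add: forall_3)
  ultimately show thesis using that by metis
qed

definition lengths :: "real^3 \<Rightarrow> real multiset" where
  "lengths x = {#x$1, x$2, x$3#}"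

text \<open>
  For the linear form \<open>f\<close> with \<open>f(e\<^sub>1) = m\<close> and \<open>f(e\<^sub>2) = n\<close> this is the sum of \<open>f\<^sup>2\<close> over the
  superbase \<open>e\<^sub>1, e\<^sub>2, -(e\<^sub>1 + e\<^sub>2)\<close>.
\<close>

definition superbase_norm :: "int \<Rightarrow> int \<Rightarrow> int" where
  "superbase_norm m n = m\<^sup>2 + n\<^sup>2 + (m + n)\<^sup>2"

lemma superbase_norm_ge_2:
  assumes "m \<noteq> 0 \<or> n \<noteq> 0" shows "2 \<le> superbase_norm m n"
proof -
  have "\<exists>t. superbase_norm m n = 2 * t"
    by (rule exI[of _ "m\<^sup>2 + m * n + n\<^sup>2"]) (simp add: superbase_norm_def power2_eq_square algebra_simps)
  have "0 < m\<^sup>2 \<or> 0 < n\<^sup>2" using assms by auto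
  then have "0 < superbase_norm m n"
    unfolding superbase_norm_def by (smt (verit) zero_le_power2)
  then show ?thesis using \<open>\<exists>t. superbase_norm m n = 2 * t\<close> by presburger
qed

text \<open>
  Up to sign, the minimum is attained only by the three forms \<open>X\<close>, \<open>Y\<close> and \<open>X - Y\<close>. The cases give
  the squares and the product of the coefficients because the sign of a linear form does not affect
  its square.
\<close>

lemma superbase_norm_eq_2:
  assumes "superbase_norm m n = 2"
  obtains "m\<^sup>2 = 1" "n\<^sup>2 = 0" "m * n = 0" | "m\<^sup>2 = 0" "n\<^sup>2 = 1" "m * n = 0" | "m\<^sup>2 = 1" "n\<^sup>2 = 1" "m * n = -1"
proof -
  have e: "m\<^sup>2 + m * n + n\<^sup>2 = 1" using assms
    by (simp add: superbase_norm_def power2_eq_square algebra_simps)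
  have s: "m\<^sup>2 + n\<^sup>2 \<le> 2" using assms unfolding superbase_norm_def by (smt (verit) zero_le_power2)
  have z: "k = -1 \<or> k = 0 \<or> k = 1" if "k\<^sup>2 \<le> 2" for k :: int
  proof -
    have "\<bar>k\<bar> < 2" by (rule power2_less_imp_less) (use that in auto)
    then show ?thesis by auto
  qed
  have "m\<^sup>2 \<le> 2" "n\<^sup>2 \<le> 2" using s zero_le_power2[of m] zero_le_power2[of n] by linarith+
  with z have "m = -1 \<or> m = 0 \<or> m = 1" "n = -1 \<or> n = 0 \<or> n = 1" by blast+
  then show thesis using e that by auto
qed

text \<open>
  Two linear forms with the same square are proportional.
\<close>

lemma same_class_det_0:
  fixes m n m' n' :: int
  assumes "m\<^sup>2 = m'\<^sup>2" "n\<^sup>2 = n'\<^sup>2" "m * n = m' * n'"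
  shows "m * n' - m' * n = 0"
proof -
  have "(m * n' - m' * n)\<^sup>2 = m\<^sup>2 * n'\<^sup>2 + m'\<^sup>2 * n\<^sup>2 - 2 * (m * n) * (m' * n')"
    by (simp add: power2_eq_square algebra_simps)
  also have "\<dots> = 2 * (m\<^sup>2 * n\<^sup>2) - 2 * (m * n) * (m * n)" using assms by simp
  also have "\<dots> = 0" by (simp add: power2_eq_square)
  finally show ?thesis by simp
qed

text \<open>
  Twice the sum of the coefficients of a reduced form is the sum of its values on the standard
  superbase. After the base change, \<open>selling x\<close> is a combination of the squares of three non-zero
  linear forms with coefficients \<open>x\<close>, and each square contributes at least \<open>2\<close>.
\<close>

lemma gl2z_equiv_selling_sum_le:
  assumes "\<forall>i. 0 \<le> x $ i" "\<bar>p * s - q * r\<bar> = 1" "selling y = base_change p q r s (selling x)"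
  shows "2 * (y$1 + y$2 + y$3) = x$1 * superbase_norm p q + x$2 * superbase_norm r s + x$3 * superbase_norm (p - r) (q - s)"
    and "x$1 + x$2 + x$3 \<le> y$1 + y$2 + y$3"
proof -
  have y: "y$1 + y$3 = base_change p q r s (selling x) $ 1 $ 1"
    "- y$3 = base_change p q r s (selling x) $ 1 $ 2"
    "y$2 + y$3 = base_change p q r s (selling x) $ 2 $ 2"
    unfolding assms(3)[symmetric] by simp_all
  have "2 * (y$1 + y$2 + y$3) = 2 * ((y$1 + y$3) + (y$2 + y$3) + - y$3)" by simp
  also have "\<dots> = x$1 * superbase_norm p q + x$2 * superbase_norm r s + x$3 * superbase_norm (p - r) (q - s)"
    unfolding y by (simp add: base_change_def superbase_norm_def power2_eq_square algebra_simps)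
  finally show e: "2 * (y$1 + y$2 + y$3) = x$1 * superbase_norm p q + x$2 * superbase_norm r s + x$3 * superbase_norm (p - r) (q - s)" .
  have "p \<noteq> 0 \<or> q \<noteq> 0" "r \<noteq> 0 \<or> s \<noteq> 0" using assms(2) by auto
  moreover have "p - r \<noteq> 0 \<or> q - s \<noteq> 0" using assms(2) by auto
  ultimately have "2 \<le> real_of_int (superbase_norm p q)" "2 \<le> real_of_int (superbase_norm r s)"
     "2 \<le> real_of_int (superbase_norm (p - r) (q - s))"
    using superbase_norm_ge_2 by force+
  then have "x$1 * 2 \<le> x$1 * superbase_norm p q" "x$2 * 2 \<le> x$2 * superbase_norm r s"
     "x$3 * 2 \<le> x$3 * superbase_norm (p - r) (q - s)" using assms(1) by (auto intro: mult_left_mono)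
  then have "x$1 * 2 + x$2 * 2 + x$3 * 2 \<le> 2 * (y$1 + y$2 + y$3)" unfolding e
    by (intro add_mono)
  then show "x$1 + x$2 + x$3 \<le> y$1 + y$2 + y$3" by simp
qed

text \<open>
  By the preceding inequality in both directions the coefficient sums agree. So every linear form
  with positive coefficient attains the minimal norm, hence is \<open>X\<close>, \<open>Y\<close> or \<open>X - Y\<close> up to sign. No
  two of them coincide, because the base change is invertible. Thus the base change permutes
  the positive coefficients.
\<close>

lemma gl2z_equiv_selling_lengths_eq:
  assumes x: "\<forall>i. 0 \<le> x $ i" and y: "\<forall>i. 0 \<le> y $ i" and "gl2z_equiv (selling x) (selling y)"
    and pd: "pos_def (selling x)"
  shows "lengths x = lengths y"
proof -
  obtain p q r s where d: "\<bar>p * s - q * r\<bar> = 1" "selling y = base_change p q r s (selling x)"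
    using assms(3) gl2z_equiv_iff by blast
  obtain p' q' r' s' where d': "\<bar>p' * s' - q' * r'\<bar> = 1" "selling x = base_change p' q' r' s' (selling y)"
    using gl2z_equiv_sym[OF assms(3)] gl2z_equiv_iff by blast
  have sum: "x$1 + x$2 + x$3 = y$1 + y$2 + y$3"
    using gl2z_equiv_selling_sum_le(2)[OF x d] gl2z_equiv_selling_sum_le(2)[OF y d'] by linarith
  \<comment> \<open>The transforms of \<open>X\<close>, \<open>Y\<close> and \<open>X - Y\<close> have coefficients \<open>(p, q)\<close>, \<open>(r, s)\<close> and \<open>(t, u)\<close>.\<close>
  define t u where "t = p - r" "u = q - s"
  note tu = t_u_def
  have nz: "p \<noteq> 0 \<or> q \<noteq> 0" "r \<noteq> 0 \<or> s \<noteq> 0" "t \<noteq> 0 \<or> u \<noteq> 0" using d(1) unfolding tu by auto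
  have ge: "2 \<le> superbase_norm p q" "2 \<le> superbase_norm r s" "2 \<le> superbase_norm t u"
    using nz superbase_norm_ge_2 by blast+
  have e: "x$1 * (superbase_norm p q - 2) + x$2 * (superbase_norm r s - 2) + x$3 * (superbase_norm t u - 2) = 0"
    using gl2z_equiv_selling_sum_le(1)[OF x d] sum unfolding tu by (simp add: algebra_simps)
  have "0 \<le> x$1 * (superbase_norm p q - 2)" "0 \<le> x$2 * (superbase_norm r s - 2)" "0 \<le> x$3 * (superbase_norm t u - 2)"
    using ge x by auto
  with e have "x$1 * (superbase_norm p q - 2) = 0" "x$2 * (superbase_norm r s - 2) = 0" "x$3 * (superbase_norm t u - 2) = 0"
    by linarith+
  then have c: "x$1 = 0 \<or> superbase_norm p q = 2" "x$2 = 0 \<or> superbase_norm r s = 2" "x$3 = 0 \<or> superbase_norm t u = 2"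
    by auto
  have det: "p * s - r * q \<noteq> 0" "p * u - t * q \<noteq> 0" "r * u - t * s \<noteq> 0"
    using d(1) unfolding tu by (auto simp: algebra_simps)
  have dist: "\<not> (p\<^sup>2 = r\<^sup>2 \<and> q\<^sup>2 = s\<^sup>2 \<and> p * q = r * s)" "\<not> (p\<^sup>2 = t\<^sup>2 \<and> q\<^sup>2 = u\<^sup>2 \<and> p * q = t * u)"
     "\<not> (r\<^sup>2 = t\<^sup>2 \<and> s\<^sup>2 = u\<^sup>2 \<and> r * s = t * u)"
    using same_class_det_0 det by blast+
  have ym: "y$1 + y$3 = base_change p q r s (selling x) $ 1 $ 1"
    "- y$3 = base_change p q r s (selling x) $ 1 $ 2"
    "y$2 + y$3 = base_change p q r s (selling x) $ 2 $ 2"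
    unfolding d(2)[symmetric] by simp_all
  have 3: "y$3 = - (x$1 * real_of_int (p * q) + x$2 * real_of_int (r * s) + x$3 * real_of_int (t * u))"
    using ym(2) unfolding tu by (simp add: base_change_def algebra_simps)
  have 1: "y$1 = x$1 * real_of_int (p\<^sup>2) + x$2 * real_of_int (r\<^sup>2) + x$3 * real_of_int (t\<^sup>2) - y$3"
    using ym(1) unfolding tu by (simp add: base_change_def power2_eq_square algebra_simps)
  have 2: "y$2 = x$1 * real_of_int (q\<^sup>2) + x$2 * real_of_int (s\<^sup>2) + x$3 * real_of_int (u\<^sup>2) - y$3"
    using ym(3) unfolding tu by (simp add: base_change_def power2_eq_square algebra_simps)
  define c1 where "c1 \<longleftrightarrow> (p\<^sup>2 = 1 \<and> q\<^sup>2 = 0 \<and> p * q = 0) \<or> (p\<^sup>2 = 0 \<and> q\<^sup>2 = 1 \<and> p * q = 0) \<or> (p\<^sup>2 = 1 \<and> q\<^sup>2 = 1 \<and> p * q = -1)"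
  define c2 where "c2 \<longleftrightarrow> (r\<^sup>2 = 1 \<and> s\<^sup>2 = 0 \<and> r * s = 0) \<or> (r\<^sup>2 = 0 \<and> s\<^sup>2 = 1 \<and> r * s = 0) \<or> (r\<^sup>2 = 1 \<and> s\<^sup>2 = 1 \<and> r * s = -1)"
  define c3 where "c3 \<longleftrightarrow> (t\<^sup>2 = 1 \<and> u\<^sup>2 = 0 \<and> t * u = 0) \<or> (t\<^sup>2 = 0 \<and> u\<^sup>2 = 1 \<and> t * u = 0) \<or> (t\<^sup>2 = 1 \<and> u\<^sup>2 = 1 \<and> t * u = -1)"
  have cc: "x$1 = 0 \<or> c1" "x$2 = 0 \<or> c2" "x$3 = 0 \<or> c3"
    using c superbase_norm_eq_2 unfolding c1_def c2_def c3_def by metis+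
  have "(c1 \<and> c2 \<and> c3) \<or> (x$1 = 0 \<and> c2 \<and> c3) \<or> (x$2 = 0 \<and> c1 \<and> c3) \<or> (x$3 = 0 \<and> c1 \<and> c2)"
    using cc pd[unfolded pos_def_selling_iff[OF x]] by auto
  then show ?thesis
  proof (elim disjE conjE)
    assume "c1" "c2" "c3"
    then show ?thesis using dist unfolding c1_def c2_def c3_def lengths_def
      by (elim disjE conjE) (simp_all add: 1 2 3 add_mset_commute)
  next
    assume "x$1 = 0" "c2" "c3"
    then show ?thesis using dist unfolding c1_def c2_def c3_def lengths_def
      by (elim disjE conjE) (simp_all add: 1 2 3 add_mset_commute)
  next
    assume "x$2 = 0" "c1" "c3"
    then show ?thesis using dist unfolding c1_def c2_def c3_def lengths_def
      by (elim disjE conjE) (simp_all add: 1 2 3 add_mset_commute)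
  next
    assume "x$3 = 0" "c1" "c2"
    then show ?thesis using dist unfolding c1_def c2_def c3_def lengths_def
      by (elim disjE conjE) (simp_all add: 1 2 3 add_mset_commute)
  qed
qed

section \<open>The boundary of the reduction cone\<close>

lemma linear_selling: "linear selling"
  by (rule linearI) (simp_all add: mat2_eq_iff algebra_simps)

lemma inj_selling: "inj selling"
  by (rule injI) (auto simp: mat2_eq_iff vec3_eq_iff)

lemma orthant_convex_cone: "convex_cone {x::real^'n. \<forall>i. 0 \<le> x $ i}"
  by (auto simp: convex_cone_iff)

text \<open>
  The map \<open>selling\<close> identifies \<open>\<sigma>\<close> with the orthant, which reduces its relative boundary to the
  boundary of the orthant.
\<close>

lemma sigma_cone_eq: "sigma_cone = selling ` {x. \<forall>i. 0 \<le> x $ i}"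
proof
  let ?A = "vector [vector [1, 0], vector [0, 0]] :: real^2^2"
  let ?B = "vector [vector [0, 0], vector [0, 1]] :: real^2^2"
  let ?C = "vector [vector [1, - 1], vector [- 1, 1]] :: real^2^2"
  have gens: "?A = selling (vector [1,0,0])" "?B = selling (vector [0,1,0])" "?C = selling (vector [0,0,1])"
    unfolding mat2_eq_iff by simp_all
  have "convex_cone (selling ` {x. \<forall>i. 0 \<le> x $ i})"
    by (intro convex_cone_linear_image conjI linear_selling orthant_convex_cone)
  moreover have "{?A, ?B, ?C} \<subseteq> selling ` {x. \<forall>i. 0 \<le> x $ i}"
    unfolding gens by (auto simp: forall_3 intro!: imageI)
  ultimately show "sigma_cone \<subseteq> selling ` {x. \<forall>i. 0 \<le> x $ i}"
    unfolding sigma_cone_def by (intro hull_minimal)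
  show "selling ` {x. \<forall>i. 0 \<le> x $ i} \<subseteq> sigma_cone"
  proof
    fix M assume "M \<in> selling ` {x. \<forall>i. 0 \<le> x $ i}"
    then obtain x where x: "\<forall>i. 0 \<le> x $ i" "M = selling x" by auto
    have "M = x$1 *\<^sub>R ?A + x$2 *\<^sub>R ?B + x$3 *\<^sub>R ?C"
      unfolding x mat2_eq_iff by simp
    also have "\<dots> \<in> sigma_cone" unfolding sigma_cone_def
      by (intro convex_cone_hull_add convex_cone_hull_mul hull_inc) (use x in auto)
    finally show "M \<in> sigma_cone" .
  qed
qed

lemma interior_orthant_3: "interior {x::real^3. \<forall>i. 0 \<le> x $ i} = {x. \<forall>i. 0 < x $ i}"
proof -
  have "{x::real^3. \<forall>i. 0 \<le> x $ i} = {x. x $ 1 \<ge> 0} \<inter> ({x. x $ 2 \<ge> 0} \<inter> {x. x $ 3 \<ge> 0})"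
    by (auto simp: forall_3)
  then have "interior {x::real^3. \<forall>i. 0 \<le> x $ i} = {x. x $ 1 > 0} \<inter> ({x. x $ 2 > 0} \<inter> {x. x $ 3 > 0})"
    by (simp only: interior_Int interior_halfspace_component_ge)
  also have "\<dots> = {x. \<forall>i. 0 < x $ i}" by (auto simp: forall_3)
  finally show ?thesis .
qed

lemma closed_orthant: "closed {x::real^'n. \<forall>i. 0 \<le> x $ i}"
proof -
  have "{x::real^'n. \<forall>i. 0 \<le> x $ i} = (\<Inter>i. {x. x $ i \<ge> 0})" by auto
  then show ?thesis by (auto intro!: closed_INT closed_halfspace_component_ge_cart)
qed

lemma rel_frontier_sigma_cone:
  "rel_frontier sigma_cone = selling ` {x. (\<forall>i. 0 \<le> x $ i) \<and> (\<exists>i. x $ i = 0)}"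
proof -
  let ?O = "{x::real^3. \<forall>i. 0 \<le> x $ i}"
  have "(\<chi> i. 1) \<in> interior ?O" unfolding interior_orthant_3 by simp
  then have ri: "rel_interior ?O = {x. \<forall>i. 0 < x $ i}"
    using rel_interior_nonempty_interior[of ?O] unfolding interior_orthant_3 by fastforce
  have "rel_frontier sigma_cone = selling ` ?O - selling ` {x. \<forall>i. 0 < x $ i}"
    unfolding rel_frontier_def sigma_cone_eq
    using rel_interior_injective_linear_image[OF linear_conv_bounded_linear[THEN iffD1, OF linear_selling] inj_selling, of ?O]
      closure_injective_linear_image[OF linear_selling inj_selling, of ?O] ri
      closure_closed[OF closed_orthant, where 'n1=3]
    by simp
  also have "\<dots> = selling ` (?O - {x. \<forall>i. 0 < x $ i})"
    by (rule image_set_diff[OF inj_selling, symmetric])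
  also have "?O - {x. \<forall>i. 0 < x $ i} = {x. (\<forall>i. 0 \<le> x $ i) \<and> (\<exists>i. x $ i = 0)}"
    by (auto simp: order_le_less) (metis order_less_irrefl)
  finally show ?thesis .
qed

section \<open>Fans of sectors in the quadrant\<close>

text \<open>
  The homogeneous coordinate which is \<open>0\<close> on the first axis and \<open>1\<close> on the second. Unlike the
  quotient of the coordinates it treats both axes alike.
\<close>

definition slope :: "real \<times> real \<Rightarrow> real" where
  "slope = (\<lambda>(x, y). y / (x + y))"

definition ray :: "real \<Rightarrow> (real \<times> real) set" where
  "ray t = {c *\<^sub>R (1 - t, t) | c. 0 \<le> c}"

text \<open>
  The points whose slope lies between \<open>a\<close> and \<open>b\<close>. As an intersection of two half-planes through
  the origin the set is visibly a polyhedral cone with known interior; for \<open>a < b\<close> the half-planes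
  force \<open>x + y \<ge> 0\<close>.
\<close>

definition sector :: "real \<Rightarrow> real \<Rightarrow> (real \<times> real) set" where
  "sector a b = {p. (a, a - 1) \<bullet> p \<le> 0} \<inter> {p. (- b, 1 - b) \<bullet> p \<le> 0}"

definition open_sector :: "real \<Rightarrow> real \<Rightarrow> (real \<times> real) set" where
  "open_sector a b = {p. (a, a - 1) \<bullet> p < 0} \<inter> {p. (- b, 1 - b) \<bullet> p < 0}"

lemma mem_sector: "(x, y) \<in> sector a b \<longleftrightarrow> a * (x + y) \<le> y \<and> y \<le> b * (x + y)"
  by (auto simp: sector_def inner_prod_def algebra_simps)

lemma mem_open_sector: "(x, y) \<in> open_sector a b \<longleftrightarrow> a * (x + y) < y \<and> y < b * (x + y)"
  by (auto simp: open_sector_def inner_prod_def algebra_simps)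

lemma mem_ray: "(x, y) \<in> ray t \<longleftrightarrow> y = t * (x + y) \<and> 0 \<le> x + y"
proof
  assume "(x, y) \<in> ray t"
  then obtain c where c: "x = c - c * t" "y = c * t" "0 \<le> c" by (auto simp: ray_def algebra_simps)
  then have "x + y = c" by simp
  then show "y = t * (x + y) \<and> 0 \<le> x + y" using c by (simp add: mult.commute)
next
  assume a: "y = t * (x + y) \<and> 0 \<le> x + y"
  then have "(x, y) = (x + y) *\<^sub>R (1 - t, t)" by (simp add: algebra_simps)
  then show "(x, y) \<in> ray t" using a unfolding ray_def by blast
qed

lemma sector_nonneg:
  assumes "a < b" "(x, y) \<in> sector a b" shows "0 \<le> x + y"
proof -
  have "0 \<le> (b - a) * (x + y)" using assms(2) by (simp add: mem_sector algebra_simps)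
  then show ?thesis using assms(1) by (simp add: zero_le_mult_iff)
qed

lemma sector_sum_zero:
  assumes "a < b" "(x, y) \<in> sector a b" "x + y = 0" shows "(x, y) = 0"
  using assms by (simp add: mem_sector zero_prod_def)

lemma open_sector_pos:
  assumes "a < b" "(x, y) \<in> open_sector a b" shows "0 < x + y"
proof -
  have "0 < (b - a) * (x + y)" using assms(2) by (simp add: mem_open_sector algebra_simps)
  then show ?thesis using assms(1) by (simp add: zero_less_mult_iff)
qed

lemma mem_open_sector_slope:
  assumes "a < b"
  shows "(x, y) \<in> open_sector a b \<longleftrightarrow> 0 < x + y \<and> a < slope (x, y) \<and> slope (x, y) < b"
  using open_sector_pos[OF assms] by (auto simp: mem_open_sector slope_def field_simps)

lemma open_open_sector: "open (open_sector a b)"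
  unfolding open_sector_def by (intro open_Int open_halfspace_lt)

lemma convex_open_sector: "convex (open_sector a b)"
  unfolding open_sector_def by (intro convex_Int convex_halfspace_lt)

lemma convex_cone_sector: "convex_cone (sector a b)"
  by (auto simp: convex_cone_iff sector_def inner_add_right mult_nonneg_nonpos zero_prod_def[symmetric] simp del: inner_Pair)

lemma convex_sector: "convex (sector a b)"
  using convex_cone_sector by (simp add: convex_cone_def)

lemma polyhedron_sector: "polyhedron (sector a b)"
  unfolding sector_def by (intro polyhedron_Int polyhedron_halfspace_le)

lemma closed_sector: "closed (sector a b)"
  by (simp add: polyhedron_imp_closed polyhedron_sector)

lemma interior_sector: "interior (sector a b) = open_sector a b"
proof -
  have "(a, a - 1) \<noteq> (0::real \<times> real)" "(- b, 1 - b) \<noteq> (0::real \<times> real)" by (auto simp: zero_prod_def)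
  then show ?thesis unfolding sector_def open_sector_def by (simp only: interior_Int interior_halfspace_le not_False_eq_True)
qed

lemma open_sector_nonempty: "a < b \<Longrightarrow> (1 - (a + b) / 2, (a + b) / 2) \<in> open_sector a b"
  by (simp add: mem_open_sector)

lemma closure_open_sector:
  assumes "a < b" shows "closure (open_sector a b) = sector a b"
  using convex_closure_interior[OF convex_sector, of a b] open_sector_nonempty[OF assms] closure_closed[OF closed_sector]
  unfolding interior_sector by blast

lemma ray_subset_sector: "a \<le> t \<Longrightarrow> t \<le> b \<Longrightarrow> ray t \<subseteq> sector a b"
  by (auto simp: mem_ray mem_sector intro: mult_right_mono) (metis mult_right_mono)+

lemma sector_boundary:
  assumes "a < b"
  shows "sector a b \<inter> {p. (a, a - 1) \<bullet> p = 0} = ray a" "sector a b \<inter> {p. (- b, 1 - b) \<bullet> p = 0} = ray b"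
proof -
  show "sector a b \<inter> {p. (a, a - 1) \<bullet> p = 0} = ray a"
    using sector_nonneg[OF assms] ray_subset_sector[of a a b] assms
    by (auto simp: mem_ray inner_prod_def algebra_simps)
  show "sector a b \<inter> {p. (- b, 1 - b) \<bullet> p = 0} = ray b"
    using sector_nonneg[OF assms] ray_subset_sector[of a b b] assms
    by (auto simp: mem_ray inner_prod_def algebra_simps)
qed

lemma ray_face:
  assumes "a < b" shows "ray a face_of sector a b" "ray b face_of sector a b"
proof -
  show "ray a face_of sector a b"
    unfolding sector_boundary(1)[OF assms, symmetric]
    by (rule face_of_Int_supporting_hyperplane_le[OF convex_sector]) (auto simp: sector_def)
  show "ray b face_of sector a b"
    unfolding sector_boundary(2)[OF assms, symmetric]
    by (rule face_of_Int_supporting_hyperplane_le[OF convex_sector]) (auto simp: sector_def)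
qed

lemma zero_in_ray: "0 \<in> ray t"
  by (auto simp: zero_prod_def mem_ray)

lemma ray_Int: 
  assumes "a \<noteq> b" shows "ray a \<inter> ray b = {0}"
proof -
  have "p = 0" if "p \<in> ray a" "p \<in> ray b" for p
  proof (cases p)
    case (Pair x y)
    have "(a - b) * (x + y) = 0" using that by (simp add: Pair mem_ray algebra_simps)
    then have "x + y = 0" using assms by simp
    then show ?thesis using that by (simp add: Pair mem_ray zero_prod_def)
  qed
  then show ?thesis using zero_in_ray by blast
qed

lemma zero_face_sector: "a < b \<Longrightarrow> {0} face_of sector a b"
  using face_of_Int[OF ray_face(1,2)] ray_Int[of a b] by (metis less_irrefl)

lemma conic_face_of_sector: "F face_of sector a b \<Longrightarrow> conic F"
  using convex_cone_sector face_of_conic by (auto simp: convex_cone_def)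

text \<open>
  A face which is not the whole sector avoids the interior and so lies on the two boundary rays. It
  cannot contain non-zero points of both, since a segment between the two rays runs through the interior. As
  a cone, it is then one of the rays or the origin.
\<close>

lemma faces_of_sector:
  assumes "a < b"
  shows "F face_of sector a b \<and> F \<noteq> {} \<longleftrightarrow> F \<in> {sector a b, ray a, ray b, {0}}"
proof
  assume "F \<in> {sector a b, ray a, ray b, {0}}"
  then show "F face_of sector a b \<and> F \<noteq> {}"
    using ray_face[OF assms] zero_face_sector[OF assms] face_of_refl[OF convex_sector] zero_in_ray
    by (metis convex_cone_sector convex_cone_nonempty empty_iff insertE insert_not_empty)
next
  assume F: "F face_of sector a b \<and> F \<noteq> {}"
  then have conv: "convex F" and sub: "F \<subseteq> sector a b" by (auto dest: face_of_imp_convex face_of_imp_subset)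
  have scale: "c *\<^sub>R v \<in> F" if "v \<in> F" "0 \<le> c" for c v
    using conic_mul[OF conic_face_of_sector] F that by blast
  then have 0: "0 \<in> F" using F by (metis ex_in_conv order_refl scale_zero_left)
  have ray_sub: "ray t \<subseteq> F" if v: "v \<in> F" "v \<in> ray t" "v \<noteq> 0" for t v
  proof -
    obtain c where c: "0 \<le> c" "v = c *\<^sub>R (1 - t, t)" using v by (auto simp: ray_def)
    with v have "0 < c" by (cases "c = 0") (auto simp: zero_prod_def)
    show ?thesis
    proof
      fix w assume "w \<in> ray t"
      then obtain e where "0 \<le> e" "w = e *\<^sub>R (1 - t, t)" unfolding ray_def by blast
      then have "w = (e / c) *\<^sub>R v" "0 \<le> e / c" using \<open>0 < c\<close> c by simp_all
      then show "w \<in> F" using scale[OF v(1)] by simp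
    qed
  qed
  show "F \<in> {sector a b, ray a, ray b, {0}}"
  proof (cases "F = sector a b")
    case False
    then have dis: "F \<inter> open_sector a b = {}"
      using F face_of_disjoint_interior interior_sector by metis
    have "F \<subseteq> ray a \<union> ray b"
    proof
      fix p assume p: "p \<in> F"
      then have "p \<in> sector a b" "p \<notin> open_sector a b" using sub dis by auto
      then have "(a, a - 1) \<bullet> p = 0 \<or> (- b, 1 - b) \<bullet> p = 0"
        unfolding sector_def open_sector_def by force
      then show "p \<in> ray a \<union> ray b" using \<open>p \<in> sector a b\<close> sector_boundary[OF assms] by blast
    qed
    moreover have "\<not> (v \<in> F \<and> v \<in> ray a \<and> v \<noteq> 0 \<and> w \<in> F \<and> w \<in> ray b \<and> w \<noteq> 0)" for v w
    proof
      assume vw: "v \<in> F \<and> v \<in> ray a \<and> v \<noteq> 0 \<and> w \<in> F \<and> w \<in> ray b \<and> w \<noteq> 0"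
      then have "ray a \<subseteq> F" "ray b \<subseteq> F" using ray_sub by blast+
      moreover have "1 *\<^sub>R (1 - a, a) \<in> ray a" "1 *\<^sub>R (1 - b, b) \<in> ray b" unfolding ray_def by fastforce+
      ultimately have "(1/2) *\<^sub>R (1 - a, a) + (1/2) *\<^sub>R (1 - b, b) \<in> F"
        by (intro convexD[OF conv]) auto
      also have "(1/2) *\<^sub>R (1 - a, a) + (1/2) *\<^sub>R (1 - b, b) = (1 - (a + b) / 2, (a + b) / 2)"
        by (simp add: field_simps)
      finally show False using dis open_sector_nonempty[OF assms] by blast
    qed
    ultimately have "F \<subseteq> ray a \<or> F \<subseteq> ray b" using zero_in_ray by blast
    then have "F = ray a \<or> F = ray b \<or> F = {0}" using ray_sub 0 by blast
    then show ?thesis by blast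
  qed simp
qed

lemma sector_Int:
  assumes "a < b" "b \<le> c" "c < d"
  shows "sector a b \<inter> sector c d = (if b = c then ray b else {0})"
proof -
  have "p \<in> ray b \<and> (b \<noteq> c \<longrightarrow> p = 0)" if p: "p \<in> sector a b" "p \<in> sector c d" for p
  proof (cases p)
    case (Pair x y)
    have nn: "0 \<le> x + y" using sector_nonneg[OF assms(1)] p Pair by simp
    have le: "y \<le> b * (x + y)" "c * (x + y) \<le> y" using p by (auto simp: Pair mem_sector)
    have "b * (x + y) \<le> c * (x + y)" using nn assms(2) by (rule mult_right_mono[rotated])
    then have e: "y = b * (x + y)" "(c - b) * (x + y) = 0" using le by (auto simp: algebra_simps)
    then show ?thesis using nn sector_sum_zero[OF assms(1)] p(1) by (auto simp: Pair mem_ray)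
  qed
  moreover have "ray b \<subseteq> sector a b" "ray c \<subseteq> sector c d" using assms ray_subset_sector by auto
  ultimately show ?thesis using zero_in_ray by (auto split: if_splits)
qed

lemma aff_dim_sector: "a < b \<Longrightarrow> aff_dim (sector a b) = 2"
  using aff_dim_nonempty_interior[of "sector a b"] open_sector_nonempty interior_sector by fastforce

text \<open>
  A ray is a proper face of a two-dimensional sector and not a single point.
\<close>

lemma aff_dim_ray: "aff_dim (ray t) = 1"
proof -
  let ?m = "(1 - (t + (t + 1)) / 2, (t + (t + 1)) / 2)"
  have m: "?m \<in> open_sector t (t + 1)" by (rule open_sector_nonempty) simp
  have "?m \<in> sector t (t + 1)" using m interior_subset interior_sector by blast
  moreover have "?m \<notin> ray t" by (simp add: mem_ray)
  ultimately have "ray t \<noteq> sector t (t + 1)" by blast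
  then have "aff_dim (ray t) < aff_dim (sector t (t + 1))"
    by (intro face_of_aff_dim_lt convex_sector ray_face) auto
  moreover have "aff_dim (ray t) \<noteq> 0"
  proof
    assume "aff_dim (ray t) = 0"
    then obtain v where "ray t = {v}" using aff_dim_eq_0 by blast
    moreover have "(1 - t, t) \<in> ray t" by (simp add: mem_ray)
    ultimately have "(1 - t, t) = 0" using zero_in_ray[of t] by (metis singletonD)
    then show False by (auto simp: zero_prod_def)
  qed
  moreover have "aff_dim (ray t) \<noteq> -1" using zero_in_ray[of t] aff_dim_empty by blast
  ultimately show ?thesis using aff_dim_geq[of "ray t"] aff_dim_sector[of t "t + 1"] by simp
qed

text \<open>
  The pairs of consecutive elements of \<open>{0} \<union> T \<union> {1}\<close>, for \<open>T\<close> inside the unit interval.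
\<close>

definition gaps :: "real set \<Rightarrow> (real \<times> real) set" where
  "gaps T = {(a, b). a \<in> insert 0 T \<and> b \<in> insert 1 T \<and> a < b \<and> (\<forall>t\<in>T. t \<le> a \<or> b \<le> t)}"

definition wall_rays :: "real set \<Rightarrow> (real \<times> real) set" where
  "wall_rays T = {p \<in> open_quadrant. slope p \<in> T}"

definition sector_fan :: "real set \<Rightarrow> (real \<times> real) set set" where
  "sector_fan T = {F. F \<noteq> {} \<and> (\<exists>C\<in>components (open_quadrant - wall_rays T). F face_of closure C)}"

context
  fixes T :: "real set"
  assumes fin: "finite T" and T01: "T \<subseteq> {0<..<1}"
begin

lemma gapsD: 
  assumes "(a, b) \<in> gaps T"
  shows "a < b" "0 \<le> a" "b \<le> 1" "a = 0 \<or> a \<in> T" "b = 1 \<or> b \<in> T" "t \<in> T \<Longrightarrow> t \<le> a \<or> b \<le> t"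
  using assms T01 by (auto simp: gaps_def)

lemma gaps_separated:
  assumes "(a, b) \<in> gaps T" "(c, d) \<in> gaps T" "(a, b) \<noteq> (c, d)"
  shows "b \<le> c \<or> d \<le> a"
proof (rule ccontr)
  assume "\<not> (b \<le> c \<or> d \<le> a)"
  then have l: "c < b" "a < d" by auto
  note A = gapsD[OF assms(1)] and C = gapsD[OF assms(2)]
  have "a = c" using A(2,4) C(2,4) A(6)[of c] C(6)[of a] l by force
  moreover have "b = d" using A(3,5) C(3,5) A(6)[of d] C(6)[of b] l by force
  ultimately show False using assms(3) by simp
qed

lemma gap_below:
  assumes "0 < \<theta>" 
  obtains a where "a \<in> insert 0 T" "a < \<theta>" "\<And>t. t \<in> T \<Longrightarrow> t \<le> a \<or> \<theta> \<le> t"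
proof -
  define a where "a = Max {t \<in> insert 0 T. t < \<theta>}"
  have f: "finite {t \<in> insert 0 T. t < \<theta>}" "{t \<in> insert 0 T. t < \<theta>} \<noteq> {}" using fin assms by auto
  have "a \<in> {t \<in> insert 0 T. t < \<theta>}" unfolding a_def using f by (rule Max_in)
  moreover have "t \<le> a \<or> \<theta> \<le> t" if "t \<in> T" for t unfolding a_def using Max_ge[OF f(1), of t] that by force
  ultimately show thesis using that by auto
qed

lemma gap_above:
  assumes "\<theta> < 1" 
  obtains b where "b \<in> insert 1 T" "\<theta> < b" "\<And>t. t \<in> T \<Longrightarrow> t \<le> \<theta> \<or> b \<le> t"
proof -
  define b where "b = Min {t \<in> insert 1 T. \<theta> < t}"
  have f: "finite {t \<in> insert 1 T. \<theta> < t}" "{t \<in> insert 1 T. \<theta> < t} \<noteq> {}" using fin assms by auto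
  have "b \<in> {t \<in> insert 1 T. \<theta> < t}" unfolding b_def using f by (rule Min_in)
  moreover have "t \<le> \<theta> \<or> b \<le> t" if "t \<in> T" for t unfolding b_def using Min_le[OF f(1), of t] that by force
  ultimately show thesis using that by auto
qed

lemma gaps_at_wall:
  assumes "\<theta> \<in> T"
  obtains a b where "(a, \<theta>) \<in> gaps T" "(\<theta>, b) \<in> gaps T"
proof -
  have "0 < \<theta>" "\<theta> < 1" using assms T01 by auto
  obtain a where "a \<in> insert 0 T" "a < \<theta>" "\<And>t. t \<in> T \<Longrightarrow> t \<le> a \<or> \<theta> \<le> t" using gap_below[OF \<open>0 < \<theta>\<close>] by metis
  moreover obtain b where "b \<in> insert 1 T" "\<theta> < b" "\<And>t. t \<in> T \<Longrightarrow> t \<le> \<theta> \<or> b \<le> t" using gap_above[OF \<open>\<theta> < 1\<close>] by metis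
  ultimately show thesis using that[of a b] assms by (auto simp: gaps_def)
qed

lemma gaps_off_wall:
  assumes "\<theta> \<notin> T" "0 < \<theta>" "\<theta> < 1"
  obtains a b where "(a, b) \<in> gaps T" "a < \<theta>" "\<theta> < b"
proof -
  obtain a where a: "a \<in> insert 0 T" "a < \<theta>" "\<And>t. t \<in> T \<Longrightarrow> t \<le> a \<or> \<theta> \<le> t" using gap_below[OF assms(2)] by metis
  obtain b where b: "b \<in> insert 1 T" "\<theta> < b" "\<And>t. t \<in> T \<Longrightarrow> t \<le> \<theta> \<or> b \<le> t" using gap_above[OF assms(3)] by metis
  have "t \<le> a \<or> b \<le> t" if "t \<in> T" for t using a(3)[OF that] b(3)[OF that] assms(1) that by (metis antisym)
  then show thesis using a b that[of a b] by (auto simp: gaps_def)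
qed

lemma finite_gaps: "finite (gaps T)"
proof (rule finite_subset)
  show "gaps T \<subseteq> insert 0 T \<times> insert 1 T" by (auto simp: gaps_def)
qed (use fin in simp)

lemma mem_open_quadrant_slope:
  "(x, y) \<in> open_quadrant \<longleftrightarrow> 0 < x + y \<and> 0 < slope (x, y) \<and> slope (x, y) < 1"
proof
  assume "0 < x + y \<and> 0 < slope (x, y) \<and> slope (x, y) < 1"
  then show "(x, y) \<in> open_quadrant" 
    unfolding open_quadrant_def slope_def by (auto simp: zero_less_divide_iff)
qed (auto simp: open_quadrant_def slope_def)

lemma open_sector_chamber:
  assumes "(a, b) \<in> gaps T"
  shows "open_sector a b \<subseteq> open_quadrant - wall_rays T"
proof
  fix p assume p: "p \<in> open_sector a b"
  obtain x y where xy: "p = (x, y)" by (cases p)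
  note g = gapsD[OF assms]
  have "0 < x + y" "a < slope p" "slope p < b" using p mem_open_sector_slope[OF g(1)] by (auto simp: xy)
  then show "p \<in> open_quadrant - wall_rays T" using g(2,3) g(6)[of "slope p"]
    by (auto simp: wall_rays_def xy mem_open_quadrant_slope)
qed

lemma components_chambers:
  "components (open_quadrant - wall_rays T) = {open_sector a b | a b. (a, b) \<in> gaps T}"
proof (rule components_open_unique)
  show "pairwise disjnt ({open_sector a b | a b. (a, b) \<in> gaps T})"
  proof (clarsimp simp: pairwise_def)
    fix a b c d assume g: "(a, b) \<in> gaps T" "(c, d) \<in> gaps T" "open_sector a b \<noteq> open_sector c d"
    then have "b \<le> c \<or> d \<le> a" using gaps_separated by fastforce
    then show "disjnt (open_sector a b) (open_sector c d)"
      using mem_open_sector_slope[OF gapsD(1)[OF g(1)]] mem_open_sector_slope[OF gapsD(1)[OF g(2)]]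
      unfolding disjnt_iff by fastforce
  qed
  show "\<Union> ({open_sector a b | a b. (a, b) \<in> gaps T}) = open_quadrant - wall_rays T"
  proof
    show "\<Union> ({open_sector a b | a b. (a, b) \<in> gaps T}) \<subseteq> open_quadrant - wall_rays T"
      using open_sector_chamber by fastforce
    show "open_quadrant - wall_rays T \<subseteq> \<Union> ({open_sector a b | a b. (a, b) \<in> gaps T})"
    proof
      fix p assume p: "p \<in> open_quadrant - wall_rays T"
      obtain x y where xy: "p = (x, y)" by (cases p)
      have h: "slope p \<notin> T" "0 < slope p" "slope p < 1" "0 < x + y"
        using p mem_open_quadrant_slope[of x y] by (auto simp: xy wall_rays_def)
      obtain a b where "(a, b) \<in> gaps T" "a < slope p" "slope p < b" using gaps_off_wall[OF h(1-3)] by metis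
      moreover from this have "p \<in> open_sector a b" using h(4) mem_open_sector_slope gapsD(1) xy by blast
      ultimately show "p \<in> \<Union> ({open_sector a b | a b. (a, b) \<in> gaps T})" by blast
    qed
  qed
  fix X assume "X \<in> {open_sector a b | a b. (a, b) \<in> gaps T}"
  then obtain a b where ab: "(a, b) \<in> gaps T" "X = open_sector a b" by auto
  then have "X \<noteq> {}" using open_sector_nonempty[OF gapsD(1)] by blast
  then show "open X \<and> connected X \<and> X \<noteq> {}"
    unfolding ab(2) by (simp add: open_open_sector convex_connected convex_open_sector)
qed

lemma mem_sector_fan:
  "F \<in> sector_fan T \<longleftrightarrow> F \<noteq> {} \<and> (\<exists>a b. (a, b) \<in> gaps T \<and> F face_of sector a b)"
proof -
  have "F \<in> sector_fan T \<longleftrightarrow> F \<noteq> {} \<and> (\<exists>a b. (a, b) \<in> gaps T \<and> F face_of closure (open_sector a b))"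
    unfolding sector_fan_def components_chambers by auto
  then show ?thesis using closure_open_sector[OF gapsD(1)] by metis
qed

lemma mem_sector_fan':
  "F \<in> sector_fan T \<longleftrightarrow> (\<exists>a b. (a, b) \<in> gaps T \<and> F \<in> {sector a b, ray a, ray b, {0}})"
  unfolding mem_sector_fan using faces_of_sector[OF gapsD(1)] by metis

lemma sector_in_fan: "(a, b) \<in> gaps T \<Longrightarrow> sector a b \<in> sector_fan T"
  unfolding mem_sector_fan' by blast

lemma sector_Int_face:
  assumes "(a, b) \<in> gaps T" "(c, d) \<in> gaps T"
  shows "sector a b \<inter> sector c d face_of sector a b"
proof (cases "(a, b) = (c, d)")
  case True then show ?thesis by (simp add: face_of_refl convex_sector)
next
  case False
  note l = gapsD(1)[OF assms(1)] gapsD(1)[OF assms(2)]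
  from gaps_separated[OF assms False] show ?thesis
    using sector_Int[OF l(1) _ l(2)] sector_Int[OF l(2) _ l(1)] ray_face[OF l(1)] zero_face_sector[OF l(1)]
    by (auto simp: Int_commute)
qed

text \<open>
  The only condition that involves more than one sector is that cones meet in common faces. It holds
  for the closed chambers, which meet in a ray, in the origin or are equal, and passes from
  them to their faces.
\<close>

lemma fan_sector_fan: "fan (sector_fan T)"
  unfolding fan_def
proof (intro conjI ballI allI impI)
  have "sector_fan T \<subseteq> (\<Union>(a, b)\<in>gaps T. {sector a b, ray a, ray b, {0}})"
    unfolding subset_iff mem_sector_fan' by auto
  moreover have "finite (\<Union>(a, b)\<in>gaps T. {sector a b, ray a, ray b, {0}})" using finite_gaps by auto
  ultimately show "finite (sector_fan T)" using finite_subset by blast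
next
  fix C assume "C \<in> sector_fan T"
  then obtain a b where ab: "(a, b) \<in> gaps T" "C face_of sector a b" "C \<noteq> {}" unfolding mem_sector_fan by auto
  show "polyhedron C" using ab(2) face_of_polyhedron_polyhedron polyhedron_sector by blast
  have "convex C" using ab(2) face_of_imp_convex by blast
  moreover have "conic C" using conic_face_of_sector[OF ab(2)] .
  ultimately show "convex_cone C" using ab(3) by (simp add: convex_cone_def)
next
  fix C F assume "C \<in> sector_fan T" "F face_of C \<and> F \<noteq> {}"
  then show "F \<in> sector_fan T" unfolding mem_sector_fan using face_of_trans by blast
next
  fix C D assume "C \<in> sector_fan T" "D \<in> sector_fan T"
  then obtain a b c d where g: "(a, b) \<in> gaps T" "C face_of sector a b" "(c, d) \<in> gaps T" "D face_of sector c d"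
    unfolding mem_sector_fan by auto
  have s: "sector a b \<inter> sector c d face_of sector a b" "sector a b \<inter> sector c d face_of sector c d"
    using sector_Int_face[OF g(1,3)] sector_Int_face[OF g(3,1)] by (auto simp: Int_commute)
  have f: "C \<inter> D face_of sector a b" "C \<inter> D face_of sector c d"
    using face_of_Int_subface[OF s g(2,4)]
     face_of_trans[OF _ g(2)] face_of_trans[OF _ g(4)] by auto
  show "C \<inter> D face_of C" "C \<inter> D face_of D" using face_of_Int_subface[OF s g(2,4)] by auto
qed

lemma sector_in_quadrant: 
  assumes "(a, b) \<in> gaps T" shows "sector a b \<subseteq> {0..} \<times> {0..}"
proof -
  note g = gapsD[OF assms]
  have "0 \<le> x \<and> 0 \<le> y" if "(x, y) \<in> sector a b" for x y
  proof -
    have nn: "0 \<le> x + y" using sector_nonneg[OF g(1) that] .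
    have le: "a * (x + y) \<le> y" "y \<le> b * (x + y)" using that by (auto simp: mem_sector)
    have "b * (x + y) \<le> 1 * (x + y)" using g(3) nn by (rule mult_right_mono)
    from order_trans[OF le(2) this] have "0 \<le> x" by simp
    moreover have "0 \<le> a * (x + y)" using g(2) nn by simp
    from order_trans[OF this le(1)] have "0 \<le> y" .
    ultimately show ?thesis by simp
  qed
  then show ?thesis by auto
qed

lemma open_quadrant_in_sectors:
  assumes "p \<in> open_quadrant" shows "\<exists>a b. (a, b) \<in> gaps T \<and> p \<in> sector a b"
proof -
  obtain x y where xy: "p = (x, y)" by (cases p)
  have h: "0 < slope p" "slope p < 1" "0 < x + y"
    using assms mem_open_quadrant_slope[of x y] by (auto simp: xy)
  obtain a b where "(a, b) \<in> gaps T" "a \<le> slope p" "slope p \<le> b"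
    using gaps_off_wall[OF _ h(1,2)] gaps_at_wall[of "slope p"] by (metis less_imp_le order_refl gapsD(1))
  moreover from this have "p \<in> sector a b" using h(3) by (auto simp: xy mem_sector slope_def field_simps)
  ultimately show ?thesis by blast
qed

lemma Union_sector_fan: "\<Union>(sector_fan T) = {0..} \<times> {0..}"
proof
  show "\<Union>(sector_fan T) \<subseteq> {0..} \<times> {0..}"
  proof
    fix p assume "p \<in> \<Union>(sector_fan T)"
    then obtain a b F where "(a, b) \<in> gaps T" "F face_of sector a b" "p \<in> F"
      unfolding Union_iff Bex_def mem_sector_fan by blast
    then show "p \<in> {0..} \<times> {0..}" using face_of_imp_subset sector_in_quadrant by blast
  qed
  have cl: "closed (\<Union>(a, b)\<in>gaps T. sector a b)"
    using finite_gaps closed_sector by (auto intro!: closed_UN)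
  have "open_quadrant \<subseteq> (\<Union>(a, b)\<in>gaps T. sector a b)" using open_quadrant_in_sectors by fastforce
  then have "closure open_quadrant \<subseteq> (\<Union>(a, b)\<in>gaps T. sector a b)" using cl by (simp add: closure_minimal)
  also have "\<dots> \<subseteq> \<Union>(sector_fan T)" using sector_in_fan by auto
  finally show "{0..} \<times> {0..} \<subseteq> \<Union>(sector_fan T)" by (simp add: open_quadrant_def closure_Times)
qed

lemma max_cones_sector_fan: "max_cones (sector_fan T) = {sector a b | a b. (a, b) \<in> gaps T}"
proof
  show "max_cones (sector_fan T) \<subseteq> {sector a b | a b. (a, b) \<in> gaps T}"
  proof
    fix C assume C: "C \<in> max_cones (sector_fan T)"
    then obtain a b where ab: "(a, b) \<in> gaps T" "C face_of sector a b" unfolding max_cones_def mem_sector_fan by auto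
    have "C \<subseteq> sector a b" using face_of_imp_subset[OF ab(2)] .
    then have "C = sector a b" using C sector_in_fan[OF ab(1)] unfolding max_cones_def by simp
    then show "C \<in> {sector a b | a b. (a, b) \<in> gaps T}" using ab by auto
  qed
  show "{sector a b | a b. (a, b) \<in> gaps T} \<subseteq> max_cones (sector_fan T)"
  proof clarify
    fix a b assume ab: "(a, b) \<in> gaps T"
    have "sector a b = D" if D: "D \<in> sector_fan T" "sector a b \<subseteq> D" for D
    proof -
      obtain c d where cd: "(c, d) \<in> gaps T" "D face_of sector c d" using D unfolding mem_sector_fan by auto
      have sub: "sector a b \<subseteq> sector c d" using D cd face_of_imp_subset by blast
      then have "open_sector a b \<subseteq> open_sector c d" using interior_mono interior_sector by metis
      moreover obtain x y where xy: "(x, y) \<in> open_sector a b" using open_sector_nonempty[OF gapsD(1)[OF ab]] by metis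
      ultimately have "(x, y) \<in> open_sector c d" by blast
      then have "a < slope (x, y)" "slope (x, y) < b" "c < slope (x, y)" "slope (x, y) < d"
        using xy mem_open_sector_slope[OF gapsD(1)[OF ab]] mem_open_sector_slope[OF gapsD(1)[OF cd(1)]] by auto
      then have "\<not> (b \<le> c \<or> d \<le> a)" by linarith
      then have "(a, b) = (c, d)" using gaps_separated[OF ab cd(1)] by blast
      then show ?thesis using D(2) face_of_imp_subset[OF cd(2)] by auto
    qed
    then show "sector a b \<in> max_cones (sector_fan T)" using sector_in_fan[OF ab] unfolding max_cones_def by blast
  qed
qed

text \<open>
  Two different sectors share a ray only if an endpoint of one gap is an endpoint of the next, and
  such an endpoint is neither \<open>0\<close> nor \<open>1\<close>. So the two coordinate axes are no inner rays.
\<close>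

lemma inner_rays_sector_fan: "inner_rays (sector_fan T) = ray ` T"
proof
  show "inner_rays (sector_fan T) \<subseteq> ray ` T"
  proof
    fix r assume "r \<in> inner_rays (sector_fan T)"
    then obtain a b c d where r: "aff_dim r = 1" "(a, b) \<in> gaps T" "(c, d) \<in> gaps T" "sector a b \<noteq> sector c d"
       "r face_of sector a b" "r face_of sector c d"
      unfolding inner_rays_def max_cones_sector_fan by blast
    note l = gapsD(1)[OF r(2)] gapsD(1)[OF r(3)]
    have ne: "r \<noteq> {}" using r(1) by auto
    have n: "r \<noteq> {0}" "r \<noteq> sector a b" "r \<noteq> sector c d" using r(1) aff_dim_sector l by auto
    have 1: "r = ray a \<or> r = ray b" using faces_of_sector[OF l(1), of r] r(5) ne n by blast
    have 2: "r = ray c \<or> r = ray d" using faces_of_sector[OF l(2), of r] r(6) ne n by blast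
    have inj: "ray s = ray t \<Longrightarrow> s = t" for s t using ray_Int[of s t] aff_dim_ray[of s] by force
    have "b \<le> c \<or> d \<le> a" using gaps_separated r by blast
    then have "r = ray b \<and> b = c \<or> r = ray a \<and> a = d"
    proof
      assume "b \<le> c"
      then have "a \<noteq> c" "a \<noteq> d" "b \<noteq> d" using l by auto
      then show ?thesis using 1 2 inj by metis
    next
      assume "d \<le> a"
      then have "a \<noteq> c" "b \<noteq> c" "b \<noteq> d" using l by auto
      then show ?thesis using 1 2 inj by metis
    qed
    then show "r \<in> ray ` T" using gapsD[OF r(2)] gapsD[OF r(3)] by fastforce
  qed
  show "ray ` T \<subseteq> inner_rays (sector_fan T)"
  proof clarify
    fix t assume "t \<in> T"
    then obtain a b where ab: "(a, t) \<in> gaps T" "(t, b) \<in> gaps T" using gaps_at_wall by metis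
    note l = gapsD(1)[OF ab(1)] gapsD(1)[OF ab(2)]
    have "sector a t \<noteq> sector t b"
    proof
      assume "sector a t = sector t b"
      then have "sector a t = ray t" using sector_Int[OF l(1) order_refl l(2)] by simp
      then show False using aff_dim_ray[of t] aff_dim_sector[OF l(1)] by simp
    qed
    moreover have "sector a t \<in> max_cones (sector_fan T)" "sector t b \<in> max_cones (sector_fan T)"
      unfolding max_cones_sector_fan using ab by auto
    moreover have "ray t \<in> sector_fan T" using ab unfolding mem_sector_fan' by blast
    ultimately show "ray t \<in> inner_rays (sector_fan T)"
      unfolding inner_rays_def using aff_dim_ray ray_face(2)[OF l(1)] ray_face(1)[OF l(2)] by blast
  qed
qed

end

section \<open>The walls are finitely many rays\<close>

lemma split_matrix_simps [simp]:
  "split_matrix d k (l', l) $ 1 $ 1 = real d * l'"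
  "split_matrix d k (l', l) $ 1 $ 2 = - (real k * l')"
  "split_matrix d k (l', l) $ 2 $ 1 = - (real k * l')"
  "split_matrix d k (l', l) $ 2 $ 2 = ((real k)\<^sup>2 * l' + l) / real d"
  by (simp_all add: split_matrix_def)

lemma pos_def_split_matrix:
  assumes "p \<in> open_quadrant" "0 < d" shows "pos_def (split_matrix d k p)"
proof (cases p)
  case (Pair l' l)
  have "real d * l' * (((real k)\<^sup>2 * l' + l) / real d) - (real k * l') * (real k * l') = l' * l"
    using assms(2) by (simp add: power2_eq_square field_simps)
  moreover have "0 < l'" "0 < l" using assms Pair by (auto simp: open_quadrant_def)
  ultimately show ?thesis using assms by (simp add: pos_def_def Pair)
qed

lemma wall_iff_boundary:
  "p \<in> walls d k \<longleftrightarrow> p \<in> open_quadrant \<and> (\<exists>y. (\<forall>i. 0 \<le> y $ i) \<and> (\<exists>i. y $ i = 0) \<and> gl2z_equiv (split_matrix d k p) (selling y))"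
  unfolding walls_def rel_frontier_sigma_cone by auto

text \<open>
  The coefficients of a reduced form are the negative inner products of the pairs of vectors in the
  superbase. If one of them vanishes, then the corresponding pair is an orthogonal basis.
\<close>

lemma boundary_orth_basis:
  assumes "\<exists>i. y $ i = 0" "gl2z_equiv Q (selling y)" "Q$1$2 = Q$2$1"
  shows "\<exists>p q r s. \<bar>p * s - q * r\<bar> = 1 \<and> base_change p q r s Q $ 1 $ 2 = 0"
proof -
  obtain p q r s where d: "\<bar>p * s - q * r\<bar> = 1" "selling y = base_change p q r s Q"
    using assms(2) gl2z_equiv_iff by blast
  let ?M = "base_change p q r s Q"
  have M: "y$1 = ?M $ 1 $ 1 + ?M $ 1 $ 2" "y$2 = ?M $ 2 $ 2 + ?M $ 1 $ 2" "y$3 = - ?M $ 1 $ 2"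
    unfolding d(2)[symmetric] by simp_all
  consider "y$1 = 0" | "y$2 = 0" | "y$3 = 0" using assms(1) exhaust_3 by metis
  then show ?thesis
  proof cases
    case 1
    then have "base_change p (p + q) r (r + s) Q $ 1 $ 2 = 0"
      using assms(3) unfolding M by (simp add: base_change_def algebra_simps)
    moreover have "\<bar>p * (r + s) - (p + q) * r\<bar> = 1" using d(1) by (simp add: algebra_simps)
    ultimately show ?thesis by blast
  next
    case 2
    then have "base_change (p + q) q (r + s) s Q $ 1 $ 2 = 0"
      using assms(3) unfolding M by (simp add: base_change_def algebra_simps)
    moreover have "\<bar>(p + q) * s - q * (r + s)\<bar> = 1" using d(1) by (simp add: algebra_simps)
    ultimately show ?thesis by blast
  next
    case 3
    then show ?thesis using d(1) unfolding M by auto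
  qed
qed

text \<open>
  Let \<open>u\<^sub>i = d x\<^sub>i - k y\<^sub>i\<close> and \<open>v\<^sub>i = y\<^sub>i\<close> for the two basis vectors, so that
  \<open>l' u\<^sub>1 u\<^sub>2 + l v\<^sub>1 v\<^sub>2 = 0\<close> and \<open>u\<^sub>1 v\<^sub>2 - u\<^sub>2 v\<^sub>1 = \<plusminus>d\<close>. Coprimality rules out vanishing products, so
  \<open>u\<^sub>1 u\<^sub>2\<close> and \<open>v\<^sub>1 v\<^sub>2\<close> have opposite signs. Then also \<open>u\<^sub>1 v\<^sub>2\<close> and \<open>u\<^sub>2 v\<^sub>1\<close> have opposite signs,
  whence \<open>|u\<^sub>1 v\<^sub>2| + |u\<^sub>2 v\<^sub>1| = d\<close>. This bounds all the products.
\<close>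

lemma split_orth_slope:
  fixes p q r s :: int
  assumes "2 \<le> d" "coprime k d" "0 < l'" "0 < l"
    and det: "\<bar>p * s - q * r\<bar> = 1" and orth: "base_change p q r s (split_matrix d k (l', l)) $ 1 $ 2 = 0"
  shows "\<exists>A\<in>{- int d * int d..int d * int d}. \<exists>B\<in>{- int d * int d..int d * int d}. slope (l', l) = A / (A - B)"
proof -
  define u1 v1 u2 v2 where "u1 = int d * p - int k * r" "v1 = r" "u2 = int d * q - int k * s" "v2 = s"
  note uv = u1_v1_u2_v2_def
  define A B where "A = u1 * u2" "B = v1 * v2"
  have "0 = d * base_change p q r s (split_matrix d k (l', l)) $ 1 $ 2" using orth by simp
  also have "\<dots> = l' * A + l * B"
    using \<open>2 \<le> d\<close> unfolding A_B_def uv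
    by (simp add: base_change_def field_simps power2_eq_square)
  finally have lin: "l' * A + l * B = 0" by simp
  have dt: "u1 * v2 - u2 * v1 = int d * (p * s - q * r)" by (simp add: uv algebra_simps)
  have dt': "\<bar>u1 * v2 - u2 * v1\<bar> = int d" unfolding dt using det by (simp add: abs_mult)
  \<comment> \<open>If the products vanish, then either a basis vector is \<open>0\<close>, or each lies on an axis and \<open>d\<close> divides \<open>k\<close>.\<close>
  have A0: "A \<noteq> 0"
  proof
    assume "A = 0"
    then have "B = 0" using lin \<open>0 < l\<close> by simp
    have nd: "\<not> int d dvd int k"
      using assms(1,2) by (auto simp: coprime_absorb_right)
    have *: False if "int d * a - int k * b = 0" "\<bar>b * c\<bar> = 1" for a b c
    proof -
      have "b = 1 \<or> b = -1" using that(2) by (metis abs_zmult_eq_1 abs_eq_iff abs_1)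
      then have "int k = int d * a \<or> int k = int d * (-a)" using that(1) by auto
      then show False using nd by (metis dvd_triv_left)
    qed
    from \<open>A = 0\<close> \<open>B = 0\<close> consider "u1 = 0" "v1 = 0" | "u1 = 0" "v2 = 0" | "u2 = 0" "v1 = 0" | "u2 = 0" "v2 = 0"
      unfolding A_B_def by auto
    then show False
    proof cases
      case 2
      then show ?thesis using *[of p r q] det unfolding uv by (simp add: mult.commute)
    next
      case 3
      then show ?thesis using *[of q s p] det unfolding uv by (simp add: mult.commute)
    qed (use dt' \<open>2 \<le> d\<close> in auto)
  qed
  have "real_of_int A = - (l / l') * B" using lin \<open>0 < l'\<close> by (simp add: field_simps)
  then have AB: "real_of_int A * B = - (l / l') * (B * B)" by simp
  have "B \<noteq> 0" using lin A0 \<open>0 < l'\<close> by auto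
  then have "0 < real_of_int B * B" by (simp add: zero_less_mult_iff) linarith
  then have "real_of_int A * B < 0" unfolding AB using assms(3,4) by simp
  then have neg: "A * B < 0" by (metis of_int_less_0_iff of_int_mult)
  have "(u1 * v2) * (u2 * v1) < 0" using neg by (simp add: A_B_def algebra_simps)
  have abs_sum: "\<bar>a\<bar> + \<bar>b\<bar> = \<bar>a - b\<bar>" if "a * b < 0" for a b :: int
    using that by (auto simp: mult_less_0_iff)
  have "\<bar>u1 * v2\<bar> + \<bar>u2 * v1\<bar> = int d"
    unfolding abs_sum[OF \<open>(u1 * v2) * (u2 * v1) < 0\<close>] by (rule dt')
  moreover have "u1 * v2 \<noteq> 0" "u2 * v1 \<noteq> 0" using \<open>(u1 * v2) * (u2 * v1) < 0\<close> by auto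
  ultimately have le: "\<bar>u1 * v2\<bar> \<le> int d" "\<bar>u2 * v1\<bar> \<le> int d" and nz: "u1 \<noteq> 0" "v1 \<noteq> 0" "u2 \<noteq> 0" "v2 \<noteq> 0" by auto
  have AB_abs: "\<bar>A * B\<bar> \<le> int d * int d"
  proof -
    have "\<bar>A * B\<bar> = \<bar>u1 * v2\<bar> * \<bar>u2 * v1\<bar>" by (simp add: A_B_def abs_mult)
    then show ?thesis using le by (simp add: mult_mono')
  qed
  have "\<bar>A\<bar> * 1 \<le> \<bar>A\<bar> * \<bar>B\<bar>" using \<open>B \<noteq> 0\<close> by (intro mult_left_mono) auto
  then have "\<bar>A\<bar> \<le> int d * int d" using AB_abs by (simp add: abs_mult)
  moreover have "\<bar>B\<bar> * 1 \<le> \<bar>B\<bar> * \<bar>A\<bar>" using A0 by (intro mult_left_mono) auto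
  then have "\<bar>B\<bar> \<le> int d * int d" using AB_abs by (simp add: abs_mult mult.commute)
  moreover have "slope (l', l) = A / (A - B)"
  proof -
    have "A - B \<noteq> 0" using neg by (auto simp: mult_less_0_iff)
    then have "real_of_int A - real_of_int B \<noteq> 0" by linarith
    moreover have "l' + l \<noteq> 0" using assms by simp
    ultimately show ?thesis using lin unfolding slope_def by (simp add: field_simps)
  qed
  ultimately show ?thesis by (intro bexI[of _ A] bexI[of _ B]) auto
qed

lemma base_change_scaleR: "base_change p q r s (c *\<^sub>R Q) = c *\<^sub>R base_change p q r s Q"
  by (simp add: mat2_eq_iff base_change_def algebra_simps)

lemma split_matrix_linear: "linear (split_matrix d k)"
  by (rule linearI) (auto simp: mat2_eq_iff add_divide_distrib algebra_simps)

lemma wall_scale: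
  assumes "p \<in> walls d k" "0 < c" shows "c *\<^sub>R p \<in> walls d k"
proof -
  obtain y where y: "\<forall>i. 0 \<le> y $ i" "\<exists>i. y $ i = 0" "gl2z_equiv (split_matrix d k p) (selling y)"
     and p: "p \<in> open_quadrant"
    using assms wall_iff_boundary by blast
  have "gl2z_equiv (split_matrix d k (c *\<^sub>R p)) (selling (c *\<^sub>R y))"
    using y(3) unfolding gl2z_equiv_iff linear_cmul[OF split_matrix_linear] linear_cmul[OF linear_selling] base_change_scaleR
    by auto
  moreover have "\<forall>i. 0 \<le> (c *\<^sub>R y) $ i" "\<exists>i. (c *\<^sub>R y) $ i = 0" using y assms by auto
  moreover have "c *\<^sub>R p \<in> open_quadrant" using p assms by (auto simp: open_quadrant_def)
  ultimately show ?thesis unfolding wall_iff_boundary by blast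
qed

text \<open>
  The form scales with \<open>(l', l)\<close> and \<open>\<sigma>\<close> is a cone. So a wall contains with a point the whole open
  half-ray through it, and the finitely many slopes determine the walls.
\<close>

lemma walls_slopes:
  assumes "2 \<le> d" "coprime k d"
  shows "finite (slope ` walls d k)" "slope ` walls d k \<subseteq> {0<..<1}"
    "walls d k = {p \<in> open_quadrant. slope p \<in> slope ` walls d k}"
proof -
  let ?I = "{- int d * int d..int d * int d}"
  have "slope ` walls d k \<subseteq> (\<lambda>(A, B). real_of_int A / (A - B)) ` (?I \<times> ?I)"
  proof (clarify)
    fix l' l assume w: "(l', l) \<in> walls d k"
    then have pos: "0 < l'" "0 < l" by (auto simp: wall_iff_boundary open_quadrant_def)
    obtain y where y: "\<exists>i. y $ i = 0" "gl2z_equiv (split_matrix d k (l', l)) (selling y)"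
      using w wall_iff_boundary by blast
    have sym: "split_matrix d k (l', l) $ 1 $ 2 = split_matrix d k (l', l) $ 2 $ 1" by simp
    from boundary_orth_basis[OF y sym] obtain p q r s
      where "\<bar>p * s - q * r\<bar> = 1" "base_change p q r s (split_matrix d k (l', l)) $ 1 $ 2 = 0"
      by blast
    from split_orth_slope[OF assms pos this]
    obtain A B where "A \<in> ?I" "B \<in> ?I" "slope (l', l) = A / (A - B)" by blast
    then show "slope (l', l) \<in> (\<lambda>(A, B). real_of_int A / (A - B)) ` (?I \<times> ?I)"
      by (intro image_eqI[where x = "(A, B)"]) auto
  qed
  then show "finite (slope ` walls d k)" by (rule finite_subset) simp
  show "slope ` walls d k \<subseteq> {0<..<1}"
    by (auto simp: wall_iff_boundary open_quadrant_def slope_def)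
  show "walls d k = {p \<in> open_quadrant. slope p \<in> slope ` walls d k}"
  proof (intro equalityI subsetI)
    fix p assume "p \<in> {p \<in> open_quadrant. slope p \<in> slope ` walls d k}"
    then obtain p' where p: "p \<in> open_quadrant" and p': "p' \<in> walls d k" "slope p = slope p'" by blast
    obtain x y x' y' where xy: "p = (x, y)" "p' = (x', y')" by (cases p, cases p')
    have pos: "0 < x" "0 < y" "0 < x'" "0 < y'" using p p' by (auto simp: xy wall_iff_boundary open_quadrant_def)
    have e: "y * (x' + y') = y' * (x + y)" using p'(2) pos by (simp add: xy slope_def field_simps)
    \<comment> \<open>Two points of equal slope differ by this factor.\<close>
    define c where "c = (x + y) / (x' + y')"
    have y: "y = c * y'" unfolding c_def using e pos by (simp add: field_simps)
    have "x + y = c * (x' + y')" using pos by (simp add: c_def)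
    then have x: "x = c * x'" using y by (simp add: algebra_simps)
    have "p = c *\<^sub>R p'" by (simp add: xy x[symmetric] y[symmetric])
    moreover have "0 < c" unfolding c_def using pos by simp
    ultimately show "p \<in> walls d k" using wall_scale[OF p'(1)] by simp
  qed (auto simp: wall_iff_boundary)
qed

section \<open>Isomorphism of metric graphs\<close>

lemma graph_iso_refl: "graph_iso G G"
  unfolding graph_iso_def by (rule exI[of _ id], rule exI[of _ id]) auto

lemma graph_iso_trans:
  assumes G: "metric_graph G" and "graph_iso G H" "graph_iso H K" shows "graph_iso G K"
proof -
  obtain f h where 1: "bij_betw f (verts G) (verts H)" "bij_betw h (edges G) (edges H)"
    "\<forall>v\<in>verts G. genus H (f v) = genus G v"
    "\<forall>e\<in>edges G. {src H (h e), tgt H (h e)} = {f (src G e), f (tgt G e)} \<and> len H (h e) = len G e"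
    using assms(2) unfolding graph_iso_def by blast
  obtain f' h' where 2: "bij_betw f' (verts H) (verts K)" "bij_betw h' (edges H) (edges K)"
    "\<forall>v\<in>verts H. genus K (f' v) = genus H v"
    "\<forall>e\<in>edges H. {src K (h' e), tgt K (h' e)} = {f' (src H e), f' (tgt H e)} \<and> len K (h' e) = len H e"
    using assms(3) unfolding graph_iso_def by blast
  have f: "f v \<in> verts H" if "v \<in> verts G" for v using 1(1) that by (auto dest: bij_betwE)
  have h: "h e \<in> edges H" if "e \<in> edges G" for e using 1(2) that by (auto dest: bij_betwE)
  have "{src K (h' (h e)), tgt K (h' (h e))} = {f' (f (src G e)), f' (f (tgt G e))} \<and> len K (h' (h e)) = len G e"
    if e: "e \<in> edges G" for e
  proof -
    have "{src K (h' (h e)), tgt K (h' (h e))} = f' ` {src H (h e), tgt H (h e)}" using 2(4) h[OF e] by auto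
    also have "\<dots> = f' ` {f (src G e), f (tgt G e)}" using 1(4) e by simp
    finally show ?thesis using 1(4) 2(4) h[OF e] e by auto
  qed
  then show ?thesis unfolding graph_iso_def
    using bij_betw_trans[OF 1(1) 2(1)] bij_betw_trans[OF 1(2) 2(2)] 1(3) 2(3) f
    by (intro exI[of _ "f' \<circ> f"] exI[of _ "h' \<circ> h"]) auto
qed

lemma graph_iso_sym:
  assumes G: "metric_graph G" and "graph_iso G H" shows "graph_iso H G"
proof -
  obtain f h where 1: "bij_betw f (verts G) (verts H)" "bij_betw h (edges G) (edges H)"
    "\<forall>v\<in>verts G. genus H (f v) = genus G v"
    "\<forall>e\<in>edges G. {src H (h e), tgt H (h e)} = {f (src G e), f (tgt G e)} \<and> len H (h e) = len G e"
    using assms(2) unfolding graph_iso_def by blast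
  let ?f = "inv_into (verts G) f" and ?h = "inv_into (edges G) h"
  have f: "bij_betw ?f (verts H) (verts G)" and h: "bij_betw ?h (edges H) (edges G)"
    using 1 bij_betw_inv_into by blast+
  have ff: "?f (f v) = v" if "v \<in> verts G" for v using bij_betw_inv_into_left[OF 1(1) that] .
  have "genus G (?f w) = genus H w" if "w \<in> verts H" for w
    using 1(3) bij_betw_inv_into_right[OF 1(1) that] bij_betwE[OF f] that by metis
  moreover have "{src G (?h e), tgt G (?h e)} = {?f (src H e), ?f (tgt H e)} \<and> len G (?h e) = len H e"
    if e: "e \<in> edges H" for e
  proof -
    define e' where "e' = ?h e"
    have e': "e' \<in> edges G" "h e' = e" unfolding e'_def
      using bij_betwE[OF h] bij_betw_inv_into_right[OF 1(2)] e by auto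
    have v: "src G e' \<in> verts G" "tgt G e' \<in> verts G" using G e' by (auto simp: metric_graph_def)
    have "?f ` {src H e, tgt H e} = ?f ` {f (src G e'), f (tgt G e')}" using 1(4) e' by metis
    then show ?thesis unfolding e'_def[symmetric] using ff v 1(4) e' by auto
  qed
  ultimately show ?thesis unfolding graph_iso_def using f h by blast
qed

text \<open>
  A loop counts twice, and the count is insensitive to the orientation of the edge, which
  isomorphisms may reverse.
\<close>

definition incidence :: "tgraph \<Rightarrow> nat \<Rightarrow> nat \<Rightarrow> nat" where
  "incidence G v e = of_bool (src G e = v) + of_bool (tgt G e = v)"

lemma valence_eq: "finite (edges G) \<Longrightarrow> valence G v = (\<Sum>e\<in>edges G. incidence G v e)"
  by (simp add: valence_def incidence_def sum.distrib Int_def)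

lemma incidence_cong:
  assumes "{src H e', tgt H e'} = {f (src G e), f (tgt G e)}" "inj_on f V"
    "src G e \<in> V" "tgt G e \<in> V" "v \<in> V"
  shows "incidence H (f v) e' = incidence G v e"
  using assms inj_on_eq_iff[OF assms(2)] unfolding incidence_def doubleton_eq_iff by auto

lemma graph_iso_stable_genus2:
  assumes G: "G \<in> stable_genus2" and "graph_iso G H"
  shows "H \<in> stable_genus2"
proof -
  have mG: "metric_graph G" and sG: "stable G" and gG: "total_genus G = 2"
    using G by (auto simp: stable_genus2_def)
  obtain f h where 1: "bij_betw f (verts G) (verts H)" "bij_betw h (edges G) (edges H)"
    "\<And>v. v\<in>verts G \<Longrightarrow> genus H (f v) = genus G v"
    "\<And>e. e\<in>edges G \<Longrightarrow> {src H (h e), tgt H (h e)} = {f (src G e), f (tgt G e)}"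
    "\<And>e. e\<in>edges G \<Longrightarrow> len H (h e) = len G e"
    using assms(2) unfolding graph_iso_def by blast
  have fV: "verts H = f ` verts G" and hE: "edges H = h ` edges G" using 1 by (auto simp: bij_betw_def)
  have inj: "inj_on f (verts G)" "inj_on h (edges G)" using 1 by (auto simp: bij_betw_def)
  have ends: "src G e \<in> verts G" "tgt G e \<in> verts G" "0 < len G e" if "e \<in> edges G" for e
    using mG that by (auto simp: metric_graph_def)
  have fin: "finite (verts G)" "finite (edges G)" "verts G \<noteq> {}" using mG by (auto simp: metric_graph_def)
  have 2: "{src H e, tgt H e} \<subseteq> verts H \<and> 0 < len H e" if "e \<in> edges H" for e
    using that 1(4,5) ends unfolding hE fV by fastforce
  have step: "(f a, f b) \<in> joined H (edges H)" if "(a, b) \<in> joined G (edges G)" for a b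
    using that unfolding joined_def
  proof (induction rule: rtrancl_induct)
    case (step b c)
    then obtain e where e: "e \<in> edges G" "{src G e, tgt G e} = {b, c}" "(src G e, tgt G e) = (b, c) \<or> (src G e, tgt G e) = (c, b)" by auto
    then have "{src H (h e), tgt H (h e)} = {f b, f c}" using 1(4)[OF e(1)] by auto
    then have "(src H (h e), tgt H (h e)) = (f b, f c) \<or> (tgt H (h e), src H (h e)) = (f b, f c)"
      by (auto simp: doubleton_eq_iff)
    moreover have "h e \<in> edges H" using e(1) hE by blast
    ultimately have "(f b, f c) \<in> ((\<lambda>e. (src H e, tgt H e)) ` edges H \<union> (\<lambda>e. (tgt H e, src H e)) ` edges H)"
      by (metis (no_types, lifting) UnI1 UnI2 imageI)
    with step.IH show ?case by (rule rtrancl_into_rtrancl)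
  qed simp
  have "verts H \<times> verts H \<subseteq> joined H (edges H)"
  proof clarify
    fix v w assume "v \<in> verts H" "w \<in> verts H"
    then obtain v' w' where "v' \<in> verts G" "w' \<in> verts G" "v = f v'" "w = f w'" unfolding fV by blast
    then show "(v, w) \<in> joined H (edges H)" using step[of v' w'] mG unfolding metric_graph_def by blast
  qed
  then have mH: "metric_graph H" unfolding metric_graph_def using fin 2 by (simp add: fV hE)
  have val: "valence H (f v) = valence G v" if v: "v \<in> verts G" for v
  proof -
    have "valence H (f v) = (\<Sum>e\<in>edges G. incidence H (f v) (h e))"
      using fin by (simp add: valence_eq hE sum.reindex[OF inj(2)])
    also have "\<dots> = (\<Sum>e\<in>edges G. incidence G v e)"
    proof (rule sum.cong)
      fix e assume "e \<in> edges G"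
      then show "incidence H (f v) (h e) = incidence G v e"
        using incidence_cong[OF 1(4) inj(1)] ends v by blast
    qed simp
    finally show ?thesis using fin by (simp add: valence_eq)
  qed
  have sH: "stable H" unfolding stable_def fV using sG val 1(3) by (simp add: stable_def)
  have "betti (verts H) (edges H) = betti (verts G) (edges G)"
    unfolding betti_def fV hE card_image[OF inj(1)] card_image[OF inj(2)] ..
  moreover have "(\<Sum>v\<in>verts H. genus H v) = (\<Sum>v\<in>verts G. genus G v)"
    unfolding fV using inj(1) 1(3) by (simp add: sum.reindex)
  ultimately have "total_genus H = 2" using gG by (simp add: total_genus_def)
  then show ?thesis using mH sH by (simp add: stable_genus2_def)
qed

lemma equiv_curve_rel: "equiv stable_genus2 curve_rel"
proof (rule equivI)
  show "curve_rel \<subseteq> stable_genus2 \<times> stable_genus2" by (auto simp: curve_rel_def)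
  show "refl_on stable_genus2 curve_rel" by (auto simp: refl_on_def curve_rel_def graph_iso_refl)
  show "sym curve_rel" using graph_iso_sym by (auto simp: sym_def curve_rel_def stable_genus2_def)
  show "trans curve_rel" using graph_iso_trans unfolding trans_def curve_rel_def stable_genus2_def by blast
qed

lemma curve_class_eqI:
  assumes "G \<in> stable_genus2" "graph_iso G H"
  shows "curve_rel `` {G} = curve_rel `` {H}"
  using equiv_class_eq[OF equiv_curve_rel] assms graph_iso_stable_genus2 unfolding curve_rel_def by blast

lemma curve_class_in_M2: "G \<in> stable_genus2 \<Longrightarrow> curve_rel `` {G} \<in> M2"
  unfolding M2_def by (rule quotientI)

definition edge_lengths :: "tgraph \<Rightarrow> real multiset" where
  "edge_lengths G = image_mset (len G) (mset_set (edges G))"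

lemma graph_iso_edge_lengths:
  assumes "graph_iso G H" shows "edge_lengths H = edge_lengths G"
proof -
  obtain h where h: "bij_betw h (edges G) (edges H)" "\<forall>e\<in>edges G. len H (h e) = len G e"
    using assms unfolding graph_iso_def by blast
  show ?thesis
  proof (cases "finite (edges G)")
    case True
    have "mset_set (edges H) = image_mset h (mset_set (edges G))"
      using h(1) by (simp add: bij_betw_def image_mset_mset_set)
    then show ?thesis using h(2) True by (auto simp: edge_lengths_def multiset.map_comp intro!: image_mset_cong)
  next
    case False
    then show ?thesis using bij_betw_finite[OF h(1)] by (simp add: edge_lengths_def)
  qed
qed

lemma edge_lengths_contract:
  "finite (edges G) \<Longrightarrow> edge_lengths (contract G) = filter_mset (\<lambda>l. l \<noteq> 0) (edge_lengths G)"
proof -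
  assume f: "finite (edges G)"
  have filter_image: "image_mset g (filter_mset (\<lambda>e. g e \<noteq> 0) M) = filter_mset (\<lambda>l. l \<noteq> 0) (image_mset g M)"
    for g :: "nat \<Rightarrow> real" and M by (induction M) auto
  have "edges G - zero_edges G = {e \<in> edges G. len G e \<noteq> 0}" by (auto simp: zero_edges_def)
  then have "edge_lengths (contract G) = image_mset (len G) (filter_mset (\<lambda>e. len G e \<noteq> 0) (mset_set (edges G)))"
    using f by (simp add: edge_lengths_def contract_def filter_mset_mset_set)
  also have "\<dots> = filter_mset (\<lambda>l. l \<noteq> 0) (edge_lengths G)"
    unfolding edge_lengths_def by (rule filter_image)
  finally show ?thesis .
qed

section \<open>Contraction in the theta and dumbbell cells\<close>

text \<open>
  Such a curve lies in both maximal cells: it is a theta graph with one edge contracted, and a dumbbell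
  with contracted bridge.
\<close>

definition bouquet_graph :: "real \<Rightarrow> real \<Rightarrow> tgraph" where
  "bouquet_graph a b = \<lparr> verts = {0}, edges = {0, 1}, src = (\<lambda>e. 0), tgt = (\<lambda>e. 0),
     len = (\<lambda>e. if e = 0 then a else b), genus = (\<lambda>v. 0) \<rparr>"

lemma theta_sel:
  "verts (theta_graph x) = {0, 1}" "edges (theta_graph x) = {0, 1, 2}" "src (theta_graph x) e = 0"
  "tgt (theta_graph x) e = 1" "genus (theta_graph x) v = 0"
  by (simp_all add: theta_graph_def)

lemma dumbbell_sel:
  "verts (dumbbell_graph x) = {0, 1}" "edges (dumbbell_graph x) = {0, 1, 2}" "genus (dumbbell_graph x) v = 0"
  by (simp_all add: dumbbell_graph_def)

lemma bouquet_sel: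
  "verts (bouquet_graph a b) = {0}" "edges (bouquet_graph a b) = {0, 1}" "src (bouquet_graph a b) e = 0"
  "tgt (bouquet_graph a b) e = 0" "genus (bouquet_graph a b) v = 0"
  by (simp_all add: bouquet_graph_def)

lemma joined_refl: "(v, v) \<in> joined G S"
  by (simp add: joined_def)

lemma joined_edge: 
  assumes "e \<in> S" shows "(src G e, tgt G e) \<in> joined G S" "(tgt G e, src G e) \<in> joined G S"
  using assms unfolding joined_def by (auto intro!: r_into_rtrancl)

lemma bouquet_stable: 
  assumes "0 < a" "0 < b" shows "bouquet_graph a b \<in> stable_genus2"
proof -
  have m: "metric_graph (bouquet_graph a b)"
    unfolding metric_graph_def using assms joined_refl by (auto simp: bouquet_graph_def)
  have "valence (bouquet_graph a b) 0 = 4"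
    by (subst valence_eq) (simp_all add: bouquet_graph_def incidence_def)
  then have "stable (bouquet_graph a b)" by (simp add: stable_def bouquet_graph_def)
  then show ?thesis using m by (simp add: stable_genus2_def total_genus_def betti_def bouquet_graph_def)
qed

lemma theta_stable: 
  assumes "\<forall>i. 0 < x $ i" shows "theta_graph x \<in> stable_genus2"
proof -
  have "(0, 1) \<in> joined (theta_graph x) {0,1,2}" "(1, 0) \<in> joined (theta_graph x) {0,1,2}"
    using joined_edge[of 0 "{0,1,2}" "theta_graph x"] by (auto simp: theta_graph_def)
  then have m: "metric_graph (theta_graph x)"
    unfolding metric_graph_def using assms joined_refl by (auto simp: theta_graph_def)
  have "valence (theta_graph x) 0 = 3" "valence (theta_graph x) 1 = 3"
    by (subst valence_eq; simp add: theta_graph_def incidence_def)+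
  then have "stable (theta_graph x)" by (simp add: stable_def theta_graph_def)
  then show ?thesis using m by (simp add: stable_genus2_def total_genus_def betti_def theta_graph_def)
qed

lemma dumbbell_stable: 
  assumes "\<forall>i. 0 < x $ i" shows "dumbbell_graph x \<in> stable_genus2"
proof -
  have "(0, 1) \<in> joined (dumbbell_graph x) {0,1,2}" "(1, 0) \<in> joined (dumbbell_graph x) {0,1,2}"
    using joined_edge[of 2 "{0,1,2}" "dumbbell_graph x"] by (auto simp: dumbbell_graph_def)
  then have m: "metric_graph (dumbbell_graph x)"
    unfolding metric_graph_def using assms joined_refl by (auto simp: dumbbell_graph_def)
  have "valence (dumbbell_graph x) 0 = 3" "valence (dumbbell_graph x) 1 = 3"
    by (subst valence_eq; simp add: dumbbell_graph_def incidence_def)+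
  then have "stable (dumbbell_graph x)" by (simp add: stable_def dumbbell_graph_def)
  then show ?thesis using m by (simp add: stable_genus2_def total_genus_def betti_def dumbbell_graph_def)
qed

lemma component_of_no_zero: "zero_edges G = {} \<Longrightarrow> component_of G v = v"
  by (simp add: component_of_def joined_def Least_equality)

lemma contract_iso_self:
  assumes "zero_edges G = {}"
  shows "graph_iso G (contract G)"
proof -
  have c: "component_of G = id" using component_of_no_zero[OF assms] by auto
  have "{w \<in> verts G. w = v} = {v}" if "v \<in> verts G" for v using that by auto
  then show ?thesis unfolding graph_iso_def contract_def c assms
    by (intro exI[of _ id]) (simp add: betti_def Let_def)
qed

lemma component_of_joined_01:
  assumes "(0, 1) \<in> joined G (zero_edges G)" "(1, 0) \<in> joined G (zero_edges G)"
  shows "component_of G 0 = 0" "component_of G 1 = 0"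
  unfolding component_of_def using assms joined_refl by (auto intro!: Least_equality)

text \<open>
  The contracted edge joins the two vertices, so the component has Betti number \<open>0\<close> and the other two
  edges become loops at a vertex of genus \<open>0\<close>.
\<close>

lemma theta_contract_bouquet:
  assumes "i \<noteq> j" "i \<noteq> m" "j \<noteq> m" "x $ i \<noteq> 0" "x $ j \<noteq> 0" "x $ m = 0"
  shows "graph_iso (bouquet_graph (x $ i) (x $ j)) (contract (theta_graph x))"
proof -
  define n :: "3 \<Rightarrow> nat" where "n = (\<lambda>i. if i = 1 then 0 else if i = 2 then 1 else 2)"
  have lenn: "len (theta_graph x) (n i) = x $ i" for i
    using exhaust_3[of i] by (auto simp: n_def theta_graph_def)
  have nE: "{0, 1, 2} = {n i, n j, n m}" "n i \<noteq> n j" "n i \<noteq> n m" "n j \<noteq> n m"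
    using exhaust_3[of i] exhaust_3[of j] exhaust_3[of m] assms(1-3) by (auto simp: n_def)
  have E: "edges (theta_graph x) = {n i, n j, n m}" unfolding nE(1)[symmetric] by (simp add: theta_graph_def)
  have Z: "zero_edges (theta_graph x) = {n m}"
    unfolding zero_edges_def E using lenn assms by auto
  have "(0, 1) \<in> joined (theta_graph x) (zero_edges (theta_graph x))" "(1, 0) \<in> joined (theta_graph x) (zero_edges (theta_graph x))"
    using joined_edge[of "n m" "zero_edges (theta_graph x)" "theta_graph x"] unfolding Z by (auto simp: theta_graph_def)
  note c = component_of_joined_01[OF this]
  have V: "verts (contract (theta_graph x)) = {0}" using c by (simp add: contract_def theta_graph_def)
  have E': "edges (contract (theta_graph x)) = {n i, n j}" using E Z nE by (auto simp: contract_def)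
  have st: "src (contract (theta_graph x)) e = 0" "tgt (contract (theta_graph x)) e = 0" for e
    using c by (simp_all add: contract_def theta_graph_def)
  have l: "len (contract (theta_graph x)) = len (theta_graph x)" by (simp add: contract_def)
  have "{w \<in> verts (theta_graph x). component_of (theta_graph x) w = 0} = {0, 1}" using c by (auto simp: theta_graph_def)
  moreover have "{e \<in> zero_edges (theta_graph x). component_of (theta_graph x) (src (theta_graph x) e) = 0} = {n m}"
    unfolding Z using c by (auto simp: theta_graph_def)
  ultimately have g: "genus (contract (theta_graph x)) 0 = 0"
    by (simp add: contract_def Let_def betti_def) (simp add: theta_graph_def)
  define h where "h = (\<lambda>e::nat. if e = 0 then n i else n j)"
  have "bij_betw h {0, 1} {n i, n j}" using nE by (auto simp: bij_betw_def h_def)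
  moreover have "bij_betw (\<lambda>v::nat. 0::nat) {0} {0}" by (simp add: bij_betw_def)
  moreover have "len (theta_graph x) (h e) = len (bouquet_graph (x $ i) (x $ j)) e" for e
    using lenn by (simp add: h_def bouquet_graph_def)
  moreover have B: "verts (bouquet_graph (x $ i) (x $ j)) = {0}" "edges (bouquet_graph (x $ i) (x $ j)) = {0, 1}"
    "genus (bouquet_graph (x $ i) (x $ j)) 0 = 0" by (simp_all add: bouquet_graph_def)
  ultimately show ?thesis unfolding graph_iso_def V E' st l B using g
    by (intro exI[of _ "\<lambda>v. 0"] exI[of _ h]) (simp add: B(3))
qed

lemma dumbbell_contract_bouquet:
  assumes "x $ 1 \<noteq> 0" "x $ 2 \<noteq> 0" "x $ 3 = 0"
  shows "graph_iso (bouquet_graph (x $ 1) (x $ 2)) (contract (dumbbell_graph x))"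
proof -
  let ?G = "dumbbell_graph x"
  have Z: "zero_edges ?G = {2}"
    unfolding zero_edges_def using assms by (auto simp: dumbbell_graph_def)
  have "(0, 1) \<in> joined ?G (zero_edges ?G)" "(1, 0) \<in> joined ?G (zero_edges ?G)"
    using joined_edge[of 2 "zero_edges ?G" ?G] unfolding Z by (auto simp: dumbbell_graph_def)
  note c = component_of_joined_01[OF this]
  have V: "verts (contract ?G) = {0}" using c by (simp add: contract_def dumbbell_graph_def)
  have E': "edges (contract ?G) = {0, 1}" using Z by (auto simp: contract_def dumbbell_graph_def)
  have st: "src (contract ?G) e = 0" "tgt (contract ?G) e = 0" for e
    using c by (simp_all add: contract_def dumbbell_graph_def)
  have l: "len (contract ?G) = len ?G" by (simp add: contract_def)
  have "{w \<in> verts ?G. component_of ?G w = 0} = {0, 1}" using c by (auto simp: dumbbell_graph_def)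
  moreover have "{e \<in> zero_edges ?G. component_of ?G (src ?G e) = 0} = {2}"
    unfolding Z using c by (auto simp: dumbbell_graph_def)
  ultimately have g: "genus (contract ?G) 0 = 0"
    by (simp add: contract_def Let_def betti_def) (simp add: dumbbell_graph_def)
  show ?thesis unfolding graph_iso_def V E' st l using g
    by (intro exI[of _ id]) (auto simp: bouquet_graph_def dumbbell_graph_def)
qed

lemma theta_curve_pos:
  assumes "\<forall>i. 0 < x $ i" shows "theta_curve x = curve_rel `` {theta_graph x}"
proof -
  have "zero_edges (theta_graph x) = {}" 
    using assms[unfolded forall_3] by (auto simp: zero_edges_def theta_graph_def)
  then show ?thesis unfolding theta_curve_def
    using curve_class_eqI[OF theta_stable[OF assms] contract_iso_self] by simp
qed

lemma dumbbell_curve_pos: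
  assumes "\<forall>i. 0 < x $ i" shows "dumbbell_curve x = curve_rel `` {dumbbell_graph x}"
proof -
  have "zero_edges (dumbbell_graph x) = {}" 
    using assms[unfolded forall_3] by (auto simp: zero_edges_def dumbbell_graph_def)
  then show ?thesis unfolding dumbbell_curve_def
    using curve_class_eqI[OF dumbbell_stable[OF assms] contract_iso_self] by simp
qed

lemma theta_curve_bouquet:
  assumes "i \<noteq> j" "i \<noteq> m" "j \<noteq> m" "0 < x $ i" "0 < x $ j" "x $ m = 0"
  shows "theta_curve x = curve_rel `` {bouquet_graph (x $ i) (x $ j)}"
  unfolding theta_curve_def
  by (rule curve_class_eqI[OF bouquet_stable theta_contract_bouquet, symmetric]) (use assms in auto)

lemma dumbbell_curve_bouquet:
  assumes "0 < a" "0 < b"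
  shows "dumbbell_curve (vector [a, b, 0]) = curve_rel `` {bouquet_graph a b}"
proof -
  have "graph_iso (bouquet_graph a b) (contract (dumbbell_graph (vector [a, b, 0])))"
    using dumbbell_contract_bouquet[of "vector [a, b, 0]"] assms by simp
  then show ?thesis unfolding dumbbell_curve_def
    by (rule curve_class_eqI[OF bouquet_stable[OF assms], symmetric])
qed

lemma single_vertex_stable:
  assumes "verts G = {0}" "edges G = {}" "genus G 0 = 2"
  shows "G \<in> stable_genus2"
  using assms by (simp add: stable_genus2_def metric_graph_def stable_def total_genus_def betti_def joined_refl)

lemma single_vertex_iso:
  assumes "verts G = {0}" "edges G = {}" "verts H = {0}" "edges H = {}" "genus G 0 = genus H 0"
  shows "graph_iso G H"
  unfolding graph_iso_def using assms by (intro exI[of _ id]) simp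

lemma contract_all_zero:
  assumes G: "verts G = {0, 1}" "edges G = {0, 1, 2}" "\<And>e. len G e = 0" "\<And>v. genus G v = 0"
    "\<And>e. src G e \<in> {0, 1}" "src G 2 = 0" "tgt G 2 = 1"
  shows "verts (contract G) = {0}" "edges (contract G) = {}" "genus (contract G) 0 = 2"
proof -
  have Z: "zero_edges G = {0, 1, 2}" unfolding zero_edges_def by (auto simp: G)
  have "(0, 1) \<in> joined G (zero_edges G)" "(1, 0) \<in> joined G (zero_edges G)"
    using joined_edge[of 2 "zero_edges G" G] unfolding Z G by auto
  note c = component_of_joined_01[OF this]
  show "verts (contract G) = {0}" using c by (simp add: contract_def G)
  show "edges (contract G) = {}" using Z by (simp add: contract_def G)
  have "{w \<in> verts G. component_of G w = 0} = {0, 1}" using c by (auto simp: G)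
  moreover have "component_of G (src G e) = 0" for e using G(5)[of e] c by auto
  then have "{e \<in> zero_edges G. component_of G (src G e) = 0} = {0, 1, 2}" unfolding Z by auto
  ultimately show "genus (contract G) 0 = 2" by (simp add: contract_def Let_def betti_def G)
qed

lemma theta_contract_zero:
  "verts (contract (theta_graph 0)) = {0}" "edges (contract (theta_graph 0)) = {}" "genus (contract (theta_graph 0)) 0 = 2"
  by (rule contract_all_zero; simp add: theta_graph_def)+

lemma dumbbell_contract_zero:
  "verts (contract (dumbbell_graph 0)) = {0}" "edges (contract (dumbbell_graph 0)) = {}" "genus (contract (dumbbell_graph 0)) 0 = 2"
  by (rule contract_all_zero; simp add: dumbbell_graph_def)+

text \<open>
  At the origin of either cell everything contracts to a single vertex of genus \<open>2\<close>.
\<close>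

lemma theta_curve_zero: "theta_curve 0 = dumbbell_curve 0"
  unfolding theta_curve_def dumbbell_curve_def
  by (intro curve_class_eqI single_vertex_stable single_vertex_iso theta_contract_zero dumbbell_contract_zero)
    (simp add: theta_contract_zero dumbbell_contract_zero)

text \<open>
  The multiset of edge lengths is a well-defined invariant of a curve; it recovers loop lengths from
  an equality of points of the moduli space. The representative \<open>H\<close> has to be stable, since
  otherwise its class is empty.
\<close>

lemma curve_eq_edge_lengths:
  assumes "curve_rel `` {G} = curve_rel `` {H}" "H \<in> stable_genus2"
  shows "edge_lengths G = edge_lengths H"
proof -
  have "H \<in> curve_rel `` {H}" using assms(2) graph_iso_refl by (simp add: curve_rel_def)
  then have "graph_iso G H" using assms(1) unfolding curve_rel_def by blast
  then show ?thesis using graph_iso_edge_lengths by simp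
qed

lemma edge_lengths_theta: "edge_lengths (theta_graph x) = {#x$1, x$2, x$3#}"
  by (simp add: edge_lengths_def theta_graph_def)

lemma edge_lengths_dumbbell: "edge_lengths (dumbbell_graph x) = {#x$1, x$2, x$3#}"
  by (simp add: edge_lengths_def dumbbell_graph_def)

section \<open>Period matrices\<close>

text \<open>
  Two bases of the same lattice express each other by integral matrices, which are inverse to each
  other by uniqueness of coordinates. Hence the period matrices differ by a base change in
  \<open>GL\<^sub>2(\<int>)\<close>.
\<close>

lemma lattice_basis_equiv:
  assumes "lattice_basis (jac_lattice G) b" "lattice_basis (jac_lattice G) b'"
  shows "gl2z_equiv (period_matrix G b) (period_matrix G b')"
proof -
  let ?L = "jac_lattice G"
  have ex: "\<forall>i. \<exists>m::int^2. b' i = (\<lambda>x. \<Sum>j\<in>UNIV. m $ j * b j x)"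
    "\<forall>i. \<exists>m::int^2. b i = (\<lambda>x. \<Sum>j\<in>UNIV. m $ j * b' j x)"
    using assms unfolding lattice_basis_def by blast+
  obtain A :: "2 \<Rightarrow> int^2" where A: "\<And>i. b' i = (\<lambda>x. \<Sum>j\<in>UNIV. A i $ j * b j x)"
    using choice[OF ex(1)] by blast
  obtain B :: "2 \<Rightarrow> int^2" where B: "\<And>i. b i = (\<lambda>x. \<Sum>j\<in>UNIV. B i $ j * b' j x)"
    using choice[OF ex(2)] by blast
  have Bx: "b j x = (\<Sum>k\<in>UNIV. B j $ k * b' k x)" for j x using fun_cong[OF B[of j], of x] .
  define AB where "AB = (\<chi> i. A i) ** (\<chi> i. B i)"
  have "AB = mat 1"
  proof (rule vec_eq_iff[THEN iffD2, rule_format])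
    fix i
    have "b' i = (\<lambda>x. \<Sum>k\<in>UNIV. (AB $ i) $ k * b' k x)"
    proof
      fix x
      have "b' i x = (\<Sum>j\<in>UNIV. A i $ j * (\<Sum>k\<in>UNIV. B j $ k * b' k x))"
        by (simp only: A[of i] Bx)
      also have "\<dots> = (\<Sum>k\<in>UNIV. (AB $ i) $ k * b' k x)"
        by (simp add: AB_def matrix_matrix_mult_def sum_2 algebra_simps)
      finally show "b' i x = (\<Sum>k\<in>UNIV. (AB $ i) $ k * b' k x)" .
    qed
    moreover have "b' i = (\<lambda>x. \<Sum>k\<in>UNIV. (mat 1 $ i) $ k * b' k x)"
      using exhaust_2[of i] by (auto simp: mat_def sum_2)
    moreover have "\<exists>!m :: int^2. b' i = (\<lambda>x. \<Sum>k\<in>UNIV. m $ k * b' k x)"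
      using assms(2) unfolding lattice_basis_def by blast
    ultimately show "AB $ i = mat 1 $ i" by blast
  qed
  then have "det (\<chi> i. A i) * det (\<chi> i. B i) = 1" unfolding AB_def by (metis det_I det_mul)
  then have "\<bar>det (\<chi> i. A i)\<bar> = 1" by (metis abs_zmult_eq_1 abs_1)
  then have "\<bar>A 1 $ 1 * A 2 $ 2 - A 2 $ 1 * A 1 $ 2\<bar> = 1" by (simp add: det_2 mult.commute)
  moreover have "period_matrix G b' = base_change (A 1 $ 1) (A 2 $ 1) (A 1 $ 2) (A 2 $ 2) (period_matrix G b)"
    unfolding mat2_eq_iff
    by (simp add: period_matrix_def base_change_def A sum_2 sum_distrib_left sum_distrib_right sum.distrib algebra_simps)
  ultimately show ?thesis unfolding gl2z_equiv_iff by blast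
qed

text \<open>
  Two elements form a basis if they generate and two of their positions \<open>x\<close> and \<open>y\<close> read off the
  coordinates up to the signs \<open>s\<close> and \<open>t\<close>.
\<close>

lemma lattice_basisI:
  fixes L :: "('x \<Rightarrow> int) set"
  assumes "g1 \<in> L" "g2 \<in> L" and x: "g1 x = s" "s * s = 1" "g2 x = 0" and y: "g1 y = 0" "g2 y = t" "t * t = 1"
    and gen: "\<And>c. c \<in> L \<Longrightarrow> c = (\<lambda>z. s * c x * g1 z + t * c y * g2 z)"
  shows "lattice_basis L (\<lambda>i. if i = 1 then g1 else g2)"
  unfolding lattice_basis_def
proof (intro conjI allI ballI)
  fix c assume "c \<in> L"
  show "\<exists>!m::int^2. c = (\<lambda>z. \<Sum>i\<in>UNIV. m $ i * (if i = 1 then g1 else g2) z)"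
  proof (rule ex1I)
    show "c = (\<lambda>z. \<Sum>i\<in>UNIV. (vector [s * c x, t * c y] :: int^2) $ i * (if i = 1 then g1 else g2) z)"
      using gen[OF \<open>c \<in> L\<close>] by (simp add: sum_2)
  next
    fix m :: "int^2" assume "c = (\<lambda>z. \<Sum>i\<in>UNIV. m $ i * (if i = 1 then g1 else g2) z)"
    then have "c x = m $ 1 * s" "c y = m $ 2 * t" using x y by (simp_all add: sum_2)
    then have "m $ 1 = s * c x" "m $ 2 = t * c y" using x y by (simp_all add: algebra_simps)
    then show "m = vector [s * c x, t * c y]" by (simp add: vec_eq_iff forall_2)
  qed
qed (use assms in simp)

text \<open>
  The coefficient of the vertex in the boundary of the edge; it is \<open>0\<close> for a loop.
\<close>

definition boundary :: "tgraph \<Rightarrow> nat \<Rightarrow> nat \<Rightarrow> int" where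
  "boundary G v e = of_bool (tgt G e = v) - of_bool (src G e = v)"

lemma mem_jac_lattice:
  assumes "finite (edges G)" "\<forall>v\<in>verts G. genus G v = 0"
  shows "c \<in> jac_lattice G \<longleftrightarrow> (\<forall>e. e \<notin> edges G \<longrightarrow> c (Inl e) = 0) \<and> (\<forall>z. c (Inr z) = 0) \<and>
    (\<forall>v\<in>verts G. (\<Sum>e\<in>edges G. boundary G v e * c (Inl e)) = 0)"
proof -
  have "(\<Sum>e\<in>edges G. boundary G v e * c (Inl e)) =
    (\<Sum>e | e \<in> edges G \<and> tgt G e = v. c (Inl e)) - (\<Sum>e | e \<in> edges G \<and> src G e = v. c (Inl e))" for v
  proof -
    have "(\<Sum>e\<in>edges G. boundary G v e * c (Inl e)) = (\<Sum>e\<in>edges G. (if tgt G e = v then c (Inl e) else 0) - (if src G e = v then c (Inl e) else 0))"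
      by (intro sum.cong) (auto simp: boundary_def)
    then show ?thesis using assms(1) by (simp add: sum_subtractf sum.inter_filter)
  qed
  then show ?thesis unfolding jac_lattice_def using assms(2) by auto
qed

text \<open>
  With \<open>s e = \<plusminus>1\<close> recording whether \<open>e\<close> points to the vertex \<open>u\<close>, the lattice consists of the \<open>c\<close> with
  \<open>s\<^sub>0 c\<^sub>0 + s\<^sub>1 c\<^sub>1 + s\<^sub>2 c\<^sub>2 = 0\<close>. The basis runs along edge \<open>0\<close> and back along edge \<open>2\<close>, respectively
  along edge \<open>2\<close> and back along edge \<open>1\<close>.
\<close>

lemma theta_period:
  assumes "graph_iso (theta_graph x) G"
  shows "\<exists>b. lattice_basis (jac_lattice G) b \<and> period_matrix G b = selling x"
proof -
  obtain f h :: "nat \<Rightarrow> nat" where fh: "bij_betw f {0, 1} (verts G)" "bij_betw h {0, 1, 2} (edges G)"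
    "\<forall>v\<in>{0, 1}. genus G (f v) = 0"
    "\<forall>e\<in>{0, 1, 2}. {src G (h e), tgt G (h e)} = {f 0, f 1} \<and> len G (h e) = len (theta_graph x) e"
    using assms unfolding graph_iso_def theta_sel by blast
  define u v e0 e1 e2 where "u = f 0" "v = f 1" "e0 = h 0" "e1 = h 1" "e2 = h 2"
  note defs = u_v_e0_e1_e2_def
  have V: "verts G = {u, v}" "u \<noteq> v" using fh(1) by (auto simp: defs bij_betw_def)
  have E: "edges G = {e0, e1, e2}" "e0 \<noteq> e1" "e0 \<noteq> e2" "e1 \<noteq> e2" using fh(2) by (auto simp: defs bij_betw_def)
  have g: "\<forall>w\<in>verts G. genus G w = 0" using fh(3) by (simp add: V defs)
  have l: "len G e0 = x$1" "len G e1 = x$2" "len G e2 = x$3" using fh(4) by (simp_all add: defs theta_graph_def)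
  define s where "s = boundary G u"
  have st: "boundary G v e = - s e" "s e * s e = 1" if "e \<in> {e0, e1, e2}" for e
  proof -
    have "{src G e, tgt G e} = {u, v}" using that fh(4) by (auto simp: defs)
    then show "boundary G v e = - s e" "s e * s e = 1" using V(2) by (auto simp: s_def boundary_def doubleton_eq_iff)
  qed
  have mem: "c \<in> jac_lattice G \<longleftrightarrow> (\<forall>e. e \<notin> {e0, e1, e2} \<longrightarrow> c (Inl e) = 0) \<and> (\<forall>z. c (Inr z) = 0) \<and>
     s e0 * c (Inl e0) + s e1 * c (Inl e1) + s e2 * c (Inl e2) = 0" for c
  proof -
    have "finite (edges G)" by (simp add: E)
    have u: "(\<Sum>e\<in>edges G. boundary G u e * c (Inl e)) = s e0 * c (Inl e0) + s e1 * c (Inl e1) + s e2 * c (Inl e2)"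
      unfolding s_def[symmetric] E(1) using E(2-4) by simp
    have "(\<Sum>e\<in>edges G. boundary G v e * c (Inl e)) = - (\<Sum>e\<in>edges G. boundary G u e * c (Inl e))"
      unfolding sum_negf[symmetric] E(1) s_def[symmetric] by (rule sum.cong) (simp_all add: st(1))
    then show ?thesis unfolding mem_jac_lattice[OF \<open>finite (edges G)\<close> g] V(1) E(1)[symmetric] using u by auto
  qed
  define g1 g2 :: "nat + nat \<times> nat \<Rightarrow> int" where
    "g1 = (\<lambda>z. if z = Inl e0 then s e0 else if z = Inl e2 then - s e2 else 0)" and
    "g2 = (\<lambda>z. if z = Inl e1 then - s e1 else if z = Inl e2 then s e2 else 0)"
  have "lattice_basis (jac_lattice G) (\<lambda>i. if i = 1 then g1 else g2)"
  proof (rule lattice_basisI)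
    show "g1 \<in> jac_lattice G" "g2 \<in> jac_lattice G" unfolding mem using E st by (auto simp: g1_def g2_def)
    show "g1 (Inl e0) = s e0" "s e0 * s e0 = 1" "g2 (Inl e0) = 0" "g1 (Inl e1) = 0" "g2 (Inl e1) = - s e1" "(- s e1) * (- s e1) = 1"
      using E st by (auto simp: g1_def g2_def)
    fix c assume c: "c \<in> jac_lattice G"
    show "c = (\<lambda>z. s e0 * c (Inl e0) * g1 z + - s e1 * c (Inl e1) * g2 z)"
    proof
      fix z :: "nat + nat \<times> nat"
      have s2: "s e2 * (s e0 * c (Inl e0) + s e1 * c (Inl e1)) = - c (Inl e2)"
      proof -
        have "s e0 * c (Inl e0) + s e1 * c (Inl e1) = - (s e2 * c (Inl e2))" using c mem by simp
        then have "s e2 * (s e0 * c (Inl e0) + s e1 * c (Inl e1)) = - ((s e2 * s e2) * c (Inl e2))" by simp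
        then show ?thesis using st by simp
      qed
      have ss: "s e * (s e * k) = k" "s e * (k * s e) = k" if "e \<in> {e0, e1, e2}" for e k
        using st(2)[OF that] by (metis mult.assoc mult_1, metis mult.assoc mult.commute mult_1)
      consider "z = Inl e0" | "z = Inl e1" | "z = Inl e2" | "z \<notin> {Inl e0, Inl e1, Inl e2}" by blast
      then show "c z = s e0 * c (Inl e0) * g1 z + - s e1 * c (Inl e1) * g2 z"
      proof cases
        case 1 then show ?thesis using E ss by (simp add: g1_def g2_def algebra_simps)
      next
        case 2 then show ?thesis using E ss by (simp add: g1_def g2_def algebra_simps)
      next
        case 3 then show ?thesis using E s2 by (simp add: g1_def g2_def algebra_simps)
      next
        case 4
        then have "c z = 0" using c unfolding mem by (cases z) auto
        then show ?thesis using 4 by (simp add: g1_def g2_def)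
      qed
    qed
  qed
  moreover have "period_matrix G (\<lambda>i. if i = 1 then g1 else g2) = selling x"
  proof -
    have ss: "real_of_int (s e) * real_of_int (s e) = 1" if "e \<in> {e0, e1, e2}" for e
      using st(2)[OF that] by (metis of_int_1 of_int_mult)
    show ?thesis unfolding mat2_eq_iff
      using E ss by (simp add: period_matrix_def l g1_def g2_def mult.assoc)
  qed
  ultimately show ?thesis by blast
qed

text \<open>
  If no cycle passes through the edges in \<open>B\<close>, then the two loops are an orthogonal basis. The set \<open>B\<close>
  is empty for the bouquet and contains the bridge for the dumbbell.
\<close>

lemma loops_period:
  assumes E: "edges G = insert e0 (insert e1 B)" "finite B" "e0 \<noteq> e1" "e0 \<notin> B" "e1 \<notin> B" and g: "\<forall>w\<in>verts G. genus G w = 0"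
    and loop: "src G e0 = tgt G e0" "src G e1 = tgt G e1" and B: "\<And>c e. c \<in> jac_lattice G \<Longrightarrow> e \<in> B \<Longrightarrow> c (Inl e) = 0"
  shows "\<exists>b. lattice_basis (jac_lattice G) b \<and> period_matrix G b = selling (vector [len G e0, len G e1, 0])"
proof -
  have fin: "finite (edges G)" by (simp add: E)
  note mem = mem_jac_lattice[OF fin g]
  define g1 g2 :: "nat + nat \<times> nat \<Rightarrow> int" where
    "g1 = (\<lambda>z. if z = Inl e0 then 1 else 0)" and "g2 = (\<lambda>z. if z = Inl e1 then 1 else 0)"
  have "lattice_basis (jac_lattice G) (\<lambda>i. if i = 1 then g1 else g2)"
  proof (rule lattice_basisI)
    show "g1 \<in> jac_lattice G" "g2 \<in> jac_lattice G" unfolding mem using E loop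
      by (auto simp: g1_def g2_def boundary_def intro!: sum.neutral)
    show "g1 (Inl e0) = 1" "1 * 1 = (1::int)" "g2 (Inl e0) = 0" "g1 (Inl e1) = 0" "g2 (Inl e1) = 1" "1 * 1 = (1::int)"
      using E by (auto simp: g1_def g2_def)
    fix c assume c: "c \<in> jac_lattice G"
    have "c z = 0" if "z \<noteq> Inl e0" "z \<noteq> Inl e1" for z
    proof (cases z)
      case (Inl e)
      then show ?thesis using B[OF c, of e] c that unfolding mem by (cases "e \<in> B") (auto simp: E)
    qed (use c mem in auto)
    then show "c = (\<lambda>z. 1 * c (Inl e0) * g1 z + 1 * c (Inl e1) * g2 z)" using E(3) by (auto simp: g1_def g2_def)
  qed
  moreover have "period_matrix G (\<lambda>i. if i = 1 then g1 else g2) = selling (vector [len G e0, len G e1, 0])"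
  proof -
    have z: "g1 (Inl e) = 0" "g2 (Inl e) = 0" if "e \<in> B" for e using E that by (auto simp: g1_def g2_def)
    have k: "g1 (Inl e0) = 1" "g2 (Inl e0) = 0" "g1 (Inl e1) = 0" "g2 (Inl e1) = 1" using E by (auto simp: g1_def g2_def)
    show ?thesis unfolding mat2_eq_iff
      using E z k by (simp add: period_matrix_def sum.neutral)
  qed
  ultimately show ?thesis by blast
qed

lemma bouquet_period:
  assumes "graph_iso (bouquet_graph a b) G"
  shows "\<exists>b'. lattice_basis (jac_lattice G) b' \<and> period_matrix G b' = selling (vector [a, b, 0])"
proof -
  obtain f h :: "nat \<Rightarrow> nat" where fh: "bij_betw f {0} (verts G)" "bij_betw h {0, 1} (edges G)"
    "\<forall>v\<in>{0}. genus G (f v) = 0"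
    "\<forall>e\<in>{0, 1}. {src G (h e), tgt G (h e)} = {f 0, f 0} \<and> len G (h e) = len (bouquet_graph a b) e"
    using assms unfolding graph_iso_def bouquet_sel by blast
  have "edges G = insert (h 0) (insert (h 1) {})" "h 0 \<noteq> h 1" using fh(2) by (auto simp: bij_betw_def)
  moreover have "verts G = {f 0}" using fh(1) by (auto simp: bij_betw_def)
  then have "\<forall>w\<in>verts G. genus G w = 0" using fh(3) by simp
  moreover have "src G (h 0) = tgt G (h 0)" "src G (h 1) = tgt G (h 1)" "len G (h 0) = a" "len G (h 1) = b"
    using fh(4) by (auto simp: bouquet_graph_def doubleton_eq_iff)
  ultimately show ?thesis using loops_period[of G "h 0" "h 1" "{}"] by auto
qed

lemma dumbbell_period:
  assumes "graph_iso (dumbbell_graph x) G"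
  shows "\<exists>b'. lattice_basis (jac_lattice G) b' \<and> period_matrix G b' = selling (vector [x$1, x$2, 0])"
proof -
  obtain f h :: "nat \<Rightarrow> nat" where fh: "bij_betw f {0, 1} (verts G)" "bij_betw h {0, 1, 2} (edges G)"
    "\<forall>v\<in>{0, 1}. genus G (f v) = 0"
    "\<forall>e\<in>{0, 1, 2}. {src G (h e), tgt G (h e)} = {f (src (dumbbell_graph x) e), f (tgt (dumbbell_graph x) e)} \<and> len G (h e) = len (dumbbell_graph x) e"
    using assms unfolding graph_iso_def dumbbell_sel by blast
  have E: "edges G = insert (h 0) (insert (h 1) {h 2})" "h 0 \<noteq> h 1" "h 0 \<noteq> h 2" "h 1 \<noteq> h 2"
    using fh(2) by (auto simp: bij_betw_def)
  have V: "verts G = {f 0, f 1}" "f 0 \<noteq> f 1" using fh(1) by (auto simp: bij_betw_def)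
  have g: "\<forall>w\<in>verts G. genus G w = 0" using fh(3) by (simp add: V)
  have st: "{src G (h 0), tgt G (h 0)} = {f 0}" "{src G (h 1), tgt G (h 1)} = {f 1}" "{src G (h 2), tgt G (h 2)} = {f 0, f 1}"
     and len: "len G (h 0) = x$1" "len G (h 1) = x$2" "len G (h 2) = x$3"
    using fh(4) by (simp_all add: dumbbell_graph_def)
  have loop: "src G (h 0) = tgt G (h 0)" "src G (h 1) = tgt G (h 1)" using st(1,2) by (auto simp: doubleton_eq_iff)
  have "c (Inl (h 2)) = 0" if c: "c \<in> jac_lattice G" for c
  proof -
    have fin: "finite (edges G)" by (simp add: E)
    have "(\<Sum>e\<in>edges G. boundary G (f 0) e * c (Inl e)) = 0"
      using c unfolding mem_jac_lattice[OF fin g] by (simp add: V)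
    then have "boundary G (f 0) (h 2) * c (Inl (h 2)) = 0" using E loop by (simp add: boundary_def)
    moreover have "boundary G (f 0) (h 2) \<noteq> 0" using st(3) V(2) by (auto simp: boundary_def doubleton_eq_iff)
    ultimately show ?thesis by simp
  qed
  then show ?thesis unfolding len(1,2)[symmetric]
    by (intro loops_period[of G "h 0" "h 1" "{h 2}"]) (use E g loop in auto)
qed

text \<open>
  The definition of the Torelli map takes all period matrices of all representatives together. They
  are equivalent as soon as every representative has one period matrix equal to \<open>M\<close>, because any two
  bases of the lattice of that representative give equivalent matrices.
\<close>

lemma torelli_class:
  assumes G: "G \<in> stable_genus2" and pd: "pos_def M"
    and per: "\<And>H. graph_iso G H \<Longrightarrow> \<exists>b. lattice_basis (jac_lattice H) b \<and> period_matrix H b = M"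
  shows "torelli (curve_rel `` {G}) = ppav_rel `` {M}"
proof -
  let ?P = "{period_matrix H b | H b. H \<in> curve_rel `` {G} \<and> lattice_basis (jac_lattice H) b}"
  have "ppav_rel `` {P} = ppav_rel `` {M}" if P: "P \<in> ?P" for P
  proof -
    obtain H b where H: "P = period_matrix H b" "H \<in> curve_rel `` {G}" "lattice_basis (jac_lattice H) b"
      using P by blast
    then have iso: "graph_iso G H" by (simp add: curve_rel_def)
    obtain b' where "lattice_basis (jac_lattice H) b'" "period_matrix H b' = M" using per[OF iso] by blast
    then have "gl2z_equiv M P" using lattice_basis_equiv H by metis
    then show ?thesis using ppav_class_eqI[OF pd] by simp
  qed
  moreover have "?P \<noteq> {}"
  proof -
    have "G \<in> curve_rel `` {G}" using G graph_iso_refl by (simp add: curve_rel_def)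
    then show ?thesis using per[OF graph_iso_refl] by blast
  qed
  ultimately show ?thesis unfolding torelli_def by blast
qed

section \<open>Stable graphs of genus two without vertex genus\<close>

lemma handshake:
  assumes "metric_graph G" shows "(\<Sum>v\<in>verts G. valence G v) = 2 * card (edges G)"
proof -
  have fin: "finite (edges G)" "finite (verts G)" and ends: "\<And>e. e \<in> edges G \<Longrightarrow> src G e \<in> verts G \<and> tgt G e \<in> verts G"
    using assms by (auto simp: metric_graph_def)
  have "(\<Sum>v\<in>verts G. valence G v) = (\<Sum>e\<in>edges G. \<Sum>v\<in>verts G. incidence G v e)"
    unfolding valence_eq[OF fin(1)] by (rule sum.swap)
  also have "\<dots> = (\<Sum>e\<in>edges G. 2)"
  proof (rule sum.cong)
    fix e assume "e \<in> edges G"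
    then show "(\<Sum>v\<in>verts G. incidence G v e) = 2"
      using ends[of e] fin by (simp add: incidence_def sum.distrib of_bool_def sum.delta)
  qed simp
  finally show ?thesis by simp
qed

lemma bouquet_isoI:
  assumes "verts G = {u}" "edges G = {e0, e1}" "e0 \<noteq> e1" "metric_graph G" "genus G u = 0"
  shows "graph_iso (bouquet_graph (len G e0) (len G e1)) G"
  unfolding graph_iso_def
proof (intro exI conjI)
  show "bij_betw (\<lambda>v. u) (verts (bouquet_graph (len G e0) (len G e1))) (verts G)"
    using assms by (simp add: bouquet_graph_def bij_betw_def)
  show "bij_betw (\<lambda>e. if e = 0 then e0 else e1) (edges (bouquet_graph (len G e0) (len G e1))) (edges G)"
    using assms by (auto simp: bouquet_graph_def bij_betw_def)
qed (use assms in \<open>auto simp: bouquet_graph_def metric_graph_def\<close>)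

lemma theta_isoI:
  assumes "verts G = {u, v}" "u \<noteq> v" "edges G = {e0, e1, e2}" "distinct [e0, e1, e2]"
    "{src G e0, tgt G e0} = {u, v}" "{src G e1, tgt G e1} = {u, v}" "{src G e2, tgt G e2} = {u, v}"
    "genus G u = 0" "genus G v = 0"
  shows "graph_iso (theta_graph (vector [len G e0, len G e1, len G e2])) G"
  unfolding graph_iso_def
proof (intro exI conjI)
  let ?T = "theta_graph (vector [len G e0, len G e1, len G e2])"
  show "bij_betw (\<lambda>w. if w = 0 then u else v) (verts ?T) (verts G)"
    using assms by (auto simp: theta_graph_def bij_betw_def)
  show "bij_betw (\<lambda>e. if e = 0 then e0 else if e = 1 then e1 else e2) (edges ?T) (edges G)"
    using assms by (auto simp: theta_graph_def bij_betw_def)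
qed (use assms in \<open>auto simp: theta_graph_def\<close>)

lemma dumbbell_isoI:
  assumes "verts G = {u, v}" "u \<noteq> v" "edges G = {e0, e1, e2}" "distinct [e0, e1, e2]"
    "{src G e0, tgt G e0} = {u}" "{src G e1, tgt G e1} = {v}" "{src G e2, tgt G e2} = {u, v}"
    "genus G u = 0" "genus G v = 0"
  shows "graph_iso (dumbbell_graph (vector [len G e0, len G e1, len G e2])) G"
  unfolding graph_iso_def
proof (intro exI conjI)
  let ?T = "dumbbell_graph (vector [len G e0, len G e1, len G e2])"
  show "bij_betw (\<lambda>w. if w = 0 then u else v) (verts ?T) (verts G)"
    using assms by (auto simp: dumbbell_graph_def bij_betw_def)
  show "bij_betw (\<lambda>e. if e = 0 then e0 else if e = 1 then e1 else e2) (edges ?T) (edges G)"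
    using assms by (auto simp: dumbbell_graph_def bij_betw_def)
qed (use assms in \<open>auto simp: dumbbell_graph_def\<close>)

text \<open>
  The Betti number \<open>2\<close> gives one more edge than vertices, and stability gives valence at least \<open>3\<close>
  everywhere. Counting half-edges leaves at most two vertices. One vertex means two loops; two
  vertices have valence \<open>3\<close> each, and the three edges are distributed according to their
  number of endpoints at one of the vertices.
\<close>

lemma genus2_classification:
  assumes G: "G \<in> stable_genus2" and g: "\<forall>v\<in>verts G. genus G v = 0"
  shows "(\<exists>x. (\<forall>i. 0 < x $ i) \<and> graph_iso (theta_graph x) G) \<or>
    (\<exists>x. (\<forall>i. 0 < x $ i) \<and> graph_iso (dumbbell_graph x) G) \<or>
    (\<exists>a b. 0 < a \<and> 0 < b \<and> graph_iso (bouquet_graph a b) G)"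
proof -
  have mG: "metric_graph G" and sG: "stable G" and gG: "total_genus G = 2"
    using G by (auto simp: stable_genus2_def)
  have fin: "finite (edges G)" "finite (verts G)" "verts G \<noteq> {}"
    and ends: "\<And>e. e \<in> edges G \<Longrightarrow> src G e \<in> verts G \<and> tgt G e \<in> verts G \<and> 0 < len G e"
    using mG by (auto simp: metric_graph_def)
  have "betti (verts G) (edges G) = 2" using gG g by (simp add: total_genus_def)
  then have card: "card (edges G) = card (verts G) + 1" by (simp add: betti_def)
  have val: "3 \<le> valence G v" if "v \<in> verts G" for v using sG g that by (force simp: stable_def)
  have "card (verts G) * 3 \<le> (\<Sum>v\<in>verts G. valence G v)" using sum_bounded_below[of "verts G" 3 "valence G"] val by simp
  then have "card (verts G) \<le> 2" unfolding handshake[OF mG] card by simp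
  moreover have "card (verts G) \<noteq> 0" using fin by simp
  ultimately consider "card (verts G) = 1" | "card (verts G) = 2" by linarith
  then show ?thesis
  proof cases
    case 1
    then obtain u where u: "verts G = {u}" using card_1_singletonE by blast
    obtain e0 e1 where e: "edges G = {e0, e1}" "e0 \<noteq> e1" using 1 card by (metis card_2_iff one_add_one)
    have "graph_iso (bouquet_graph (len G e0) (len G e1)) G" using bouquet_isoI[OF u e mG] g u by simp
    moreover have "0 < len G e0" "0 < len G e1" using ends e by auto
    ultimately show ?thesis by blast
  next
    case 2
    then obtain u v where V: "verts G = {u, v}" "u \<noteq> v" by (metis card_2_iff)
    have "card (edges G) = 3" using 2 card by simp
    then obtain e0 e1 e2 where E: "edges G = {e0, e1, e2}" "distinct [e0, e1, e2]" 
      using card_3_iff[of "edges G"] by auto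
    have pos: "0 < len G e0" "0 < len G e1" "0 < len G e2" using ends E by auto
    have g0: "genus G u = 0" "genus G v = 0" using g V by auto
    have "valence G u + valence G v = 6" using handshake[OF mG] \<open>card (edges G) = 3\<close> V by simp
    moreover have "3 \<le> valence G u" "3 \<le> valence G v" using val V by auto
    ultimately have "valence G u = 3" by linarith
    then have sum: "incidence G u e0 + incidence G u e1 + incidence G u e2 = 3"
      unfolding valence_eq[OF fin(1)] using E by simp
    have etype: "(incidence G u e = 0 \<and> {src G e, tgt G e} = {v}) \<or> (incidence G u e = 1 \<and> {src G e, tgt G e} = {u, v})
       \<or> (incidence G u e = 2 \<and> {src G e, tgt G e} = {u})" if "e \<in> {e0, e1, e2}" for e
      using ends[of e] that V(2) unfolding V E incidence_def by auto
    have D: ?thesis if "edges G = {a, b, c}" "distinct [a, b, c]"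
      "{src G a, tgt G a} = {u}" "{src G b, tgt G b} = {v}" "{src G c, tgt G c} = {u, v}" for a b c
    proof -
      have "0 < len G a" "0 < len G b" "0 < len G c" using ends that(1) by auto
      then show ?thesis using dumbbell_isoI[OF V that g0]
        by (intro disjI2 disjI1 exI[of _ "vector [len G a, len G b, len G c]"]) (simp add: forall_3)
    qed
    have T: ?thesis if "{src G e0, tgt G e0} = {u, v}" "{src G e1, tgt G e1} = {u, v}" "{src G e2, tgt G e2} = {u, v}"
      using theta_isoI[OF V E that g0] pos
      by (intro disjI1 exI[of _ "vector [len G e0, len G e1, len G e2]"]) (simp add: forall_3)
    have p: "edges G = {e0, e2, e1}" "edges G = {e1, e0, e2}" "edges G = {e1, e2, e0}" "edges G = {e2, e0, e1}" "edges G = {e2, e1, e0}"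
      "distinct [e0, e2, e1]" "distinct [e1, e0, e2]" "distinct [e1, e2, e0]" "distinct [e2, e0, e1]" "distinct [e2, e1, e0]"
      using E by auto
    note ty = etype[OF insertI1] etype[OF insertI2[OF insertI1]] etype[OF insertI2[OF insertI2[OF singletonI]]]
    consider "{src G e0, tgt G e0} = {u, v}" "{src G e1, tgt G e1} = {u, v}" "{src G e2, tgt G e2} = {u, v}"
      | "{src G e0, tgt G e0} = {u}" "{src G e1, tgt G e1} = {v}" "{src G e2, tgt G e2} = {u, v}"
      | "{src G e0, tgt G e0} = {u}" "{src G e2, tgt G e2} = {v}" "{src G e1, tgt G e1} = {u, v}"
      | "{src G e1, tgt G e1} = {u}" "{src G e0, tgt G e0} = {v}" "{src G e2, tgt G e2} = {u, v}"
      | "{src G e1, tgt G e1} = {u}" "{src G e2, tgt G e2} = {v}" "{src G e0, tgt G e0} = {u, v}"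
      | "{src G e2, tgt G e2} = {u}" "{src G e0, tgt G e0} = {v}" "{src G e1, tgt G e1} = {u, v}"
      | "{src G e2, tgt G e2} = {u}" "{src G e1, tgt G e1} = {v}" "{src G e0, tgt G e0} = {u, v}"
      using ty sum by (elim disjE conjE) simp_all
    then show ?thesis
    proof cases
      case 1 then show ?thesis by (rule T)
    next
      case 2 then show ?thesis by (rule D[OF E])
    next
      case 3 then show ?thesis by (rule D[OF p(1,6)])
    next
      case 4 then show ?thesis by (rule D[OF p(2,7)])
    next
      case 5 then show ?thesis by (rule D[OF p(3,8)])
    next
      case 6 then show ?thesis by (rule D[OF p(4,9)])
    next
      case 7 then show ?thesis by (rule D[OF p(5,10)])
    qed
  qed
qed

text \<open>
  A positive vertex genus contributes a non-zero lattice vector of length \<open>0\<close>.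
\<close>

lemma pos_def_period_genus_zero:
  assumes "lattice_basis (jac_lattice G) b" "pos_def (period_matrix G b)" "v \<in> verts G"
  shows "genus G v = 0"
proof (rule ccontr)
  assume gv: "genus G v \<noteq> 0"
  define c :: "nat + nat \<times> nat \<Rightarrow> int" where "c = (\<lambda>z. if z = Inr (v, 0) then 1 else 0)"
  have "c \<in> jac_lattice G" using assms(3) gv by (auto simp: jac_lattice_def c_def)
  then obtain m :: "int^2" where m: "c = (\<lambda>x. \<Sum>i\<in>UNIV. m $ i * b i x)"
    using assms(1) unfolding lattice_basis_def by blast
  have "c (Inr (v, 0)) = 1" by (simp add: c_def)
  then have "m $ 1 \<noteq> 0 \<or> m $ 2 \<noteq> 0" unfolding m by (auto simp: sum_2)
  then have "real_of_int (m $ 1) \<noteq> 0 \<or> real_of_int (m $ 2) \<noteq> 0" by simp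
  from pos_def_imp_pos[OF assms(2) this]
  have "0 < (\<Sum>e\<in>edges G. len G e * (real_of_int (m$1 * b 1 (Inl e) + m$2 * b 2 (Inl e)))\<^sup>2)"
    by (simp add: period_matrix_def power2_eq_square sum_distrib_left sum_distrib_right sum.distrib algebra_simps)
  also have "\<dots> = (\<Sum>e\<in>edges G. len G e * (real_of_int (c (Inl e)))\<^sup>2)"
    unfolding m by (simp add: sum_2)
  also have "\<dots> = 0" by (simp add: c_def)
  finally show False by simp
qed

section \<open>The fibres of the Torelli map over positive definite classes\<close>

lemma mset_2_eq: "{#a, b#} = {#c, d#} \<Longrightarrow> (a = c \<and> b = d) \<or> (a = d \<and> b = c)"
  by (auto simp: add_eq_conv_ex)

lemma mset_3_eq:
  assumes "{#a, b, c#} = {#x, y, z#}"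
  shows "(a = x \<and> b = y \<and> c = z) \<or> (a = x \<and> b = z \<and> c = y) \<or> (a = y \<and> b = x \<and> c = z) \<or>
     (a = y \<and> b = z \<and> c = x) \<or> (a = z \<and> b = x \<and> c = y) \<or> (a = z \<and> b = y \<and> c = x)"
proof -
  have "a \<in># {#x, y, z#}" using assms by (metis union_single_eq_member)
  then consider "a = x" | "a = y" | "a = z" by auto
  then show ?thesis
  proof cases
    case 1
    then have "{#b, c#} = {#y, z#}" using assms by simp
    from mset_2_eq[OF this] show ?thesis using 1 by blast
  next
    case 2
    then have "{#b, c#} = {#x, z#}" using assms by (simp add: add_mset_commute)
    from mset_2_eq[OF this] show ?thesis using 2 by blast
  next
    case 3
    then have "{#b, c#} = {#x, y#}" using assms by (simp add: add_mset_commute)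
    from mset_2_eq[OF this] show ?thesis using 3 by blast
  qed
qed

lemma selling_swap_12: "gl2z_equiv (selling (vector [a, b, c])) (selling (vector [b, a, c]))"
  unfolding gl2z_equiv_iff
  by (rule exI[of _ 0], rule exI[of _ 1], rule exI[of _ 1], rule exI[of _ 0])
     (simp add: base_change_def mat2_eq_iff)

lemma selling_swap_23: "gl2z_equiv (selling (vector [a, b, c])) (selling (vector [a, c, b]))"
  unfolding gl2z_equiv_iff
  by (rule exI[of _ 1], rule exI[of _ 0], rule exI[of _ 1], rule exI[of _ "-1"])
     (simp add: base_change_def mat2_eq_iff)

lemma vec3_expand: "(x::real^3) = vector [x$1, x$2, x$3]"
  by (simp add: vec3_eq_iff)

lemma bouquet_curve_swap:
  assumes "0 < a" "0 < b"
  shows "curve_rel `` {bouquet_graph a b} = curve_rel `` {bouquet_graph b a}"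
proof (rule curve_class_eqI[OF bouquet_stable[OF assms]])
  have "metric_graph (bouquet_graph b a)" using bouquet_stable assms by (simp add: stable_genus2_def)
  from bouquet_isoI[OF _ _ _ this, of 0 1 0] show "graph_iso (bouquet_graph a b) (bouquet_graph b a)"
    by (simp add: bouquet_graph_def insert_commute)
qed

lemma one_zero_length:
  assumes x: "\<forall>i. 0 \<le> x $ i" and pd: "pos_def (selling x)" and z: "\<exists>i. x $ i = 0"
  obtains i j m where "i \<noteq> j" "i \<noteq> m" "j \<noteq> m" "{i, j, m} = UNIV" "0 < x $ i" "0 < x $ j" "x $ m = 0"
    "lengths x = {#x $ i, x $ j, 0#}" "gl2z_equiv (selling (vector [x $ i, x $ j, 0])) (selling x)"
proof -
  have U: "UNIV = {1, 2, 3::3}" using exhaust_3 by auto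
  consider "x $ 1 = 0" | "x $ 2 = 0" | "x $ 3 = 0" using z exhaust_3 by metis
  then show thesis
  proof cases
    case 1
    then have "0 < x $ 2" "0 < x $ 3" using pd unfolding pos_def_selling_iff[OF x] by auto
    moreover have "x = vector [0, x $ 2, x $ 3]" using 1 vec3_expand by metis
    then have "gl2z_equiv (selling (vector [x $ 2, x $ 3, 0])) (selling x)"
      using gl2z_equiv_trans[OF selling_swap_23 selling_swap_12] by metis
    ultimately show thesis using that[of 2 3 1] 1 U by (auto simp: lengths_def add_mset_commute)
  next
    case 2
    then have "0 < x $ 1" "0 < x $ 3" using pd unfolding pos_def_selling_iff[OF x] by auto
    moreover have "x = vector [x $ 1, 0, x $ 3]" using 2 vec3_expand by metis
    then have "gl2z_equiv (selling (vector [x $ 1, x $ 3, 0])) (selling x)"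
      using selling_swap_23 by metis
    ultimately show thesis using that[of 1 3 2] 2 U by (auto simp: lengths_def add_mset_commute)
  next
    case 3
    then have "0 < x $ 1" "0 < x $ 2" using pd unfolding pos_def_selling_iff[OF x] by auto
    moreover have "x = vector [x $ 1, x $ 2, 0]" using 3 vec3_expand by metis
    then have "gl2z_equiv (selling (vector [x $ 1, x $ 2, 0])) (selling x)"
      using gl2z_equiv_refl by metis
    ultimately show thesis using that[of 1 2 3] 3 U by (auto simp: lengths_def)
  qed
qed

text \<open>
  The contracted graph is a theta graph or a bouquet, since a positive definite form has at most one
  vanishing length.
\<close>

lemma theta_contract_stable:
  assumes x: "\<forall>i. 0 \<le> x $ i" and pd: "pos_def (selling x)"
  shows "contract (theta_graph x) \<in> stable_genus2"
proof (cases "\<exists>i. x $ i = 0")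
  case True
  obtain i j m where "i \<noteq> j" "i \<noteq> m" "j \<noteq> m" "0 < x $ i" "0 < x $ j" "x $ m = 0"
    using one_zero_length[OF x pd True] by metis
  then show ?thesis
    using graph_iso_stable_genus2[OF bouquet_stable theta_contract_bouquet[of i j m x]] by simp
next
  case False
  then have pos: "\<forall>i. 0 < x $ i" using x by (simp add: order_le_less)
  then have "zero_edges (theta_graph x) = {}"
    unfolding forall_3 by (auto simp: zero_edges_def theta_graph_def)
  then show ?thesis using graph_iso_stable_genus2[OF theta_stable[OF pos] contract_iso_self] by simp
qed

lemma torelli_theta:
  assumes x: "\<forall>i. 0 \<le> x $ i" and pd: "pos_def (selling x)"
  shows "torelli (theta_curve x) = ppav_rel `` {selling x}" "theta_curve x \<in> M2"
proof -
  show "theta_curve x \<in> M2"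
    unfolding theta_curve_def by (rule curve_class_in_M2[OF theta_contract_stable[OF assms]])
  show "torelli (theta_curve x) = ppav_rel `` {selling x}"
  proof (cases "\<exists>i. x $ i = 0")
    case True
    obtain i j m where ij: "i \<noteq> j" "i \<noteq> m" "j \<noteq> m" "0 < x $ i" "0 < x $ j" "x $ m = 0"
      and eq: "gl2z_equiv (selling (vector [x $ i, x $ j, 0])) (selling x)"
      using one_zero_length[OF x pd True] by metis
    have pd': "pos_def (selling (vector [x $ i, x $ j, 0]))"
      using gl2z_equiv_pos_def[OF gl2z_equiv_sym[OF eq] pd] .
    have "torelli (theta_curve x) = ppav_rel `` {selling (vector [x $ i, x $ j, 0])}"
      unfolding theta_curve_bouquet[OF ij] by (rule torelli_class[OF bouquet_stable[OF ij(4,5)] pd' bouquet_period])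
    also have "\<dots> = ppav_rel `` {selling x}" by (rule ppav_class_eqI[OF pd' eq])
    finally show ?thesis .
  next
    case False
    then have pos: "\<forall>i. 0 < x $ i" using x by (simp add: order_le_less)
    show ?thesis unfolding theta_curve_pos[OF pos] by (rule torelli_class[OF theta_stable[OF pos] pd theta_period])
  qed
qed

lemma torelli_dumbbell:
  assumes "0 < a" "0 < b" "0 \<le> t"
  shows "torelli (dumbbell_curve (vector [a, b, t])) = ppav_rel `` {selling (vector [a, b, 0])}"
    "dumbbell_curve (vector [a, b, t]) \<in> M2"
proof -
  have pd: "pos_def (selling (vector [a, b, 0]))" using assms by (simp add: pos_def_def)
  have "torelli (dumbbell_curve (vector [a, b, t])) = ppav_rel `` {selling (vector [a, b, 0])} \<and>
    dumbbell_curve (vector [a, b, t]) \<in> M2"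
  proof (cases "t = 0")
    case True
    show ?thesis unfolding True dumbbell_curve_bouquet[OF assms(1,2)]
      using torelli_class[OF bouquet_stable[OF assms(1,2)] pd bouquet_period]
        curve_class_in_M2[OF bouquet_stable[OF assms(1,2)]] by blast
  next
    case False
    then have pos: "\<forall>i. 0 < (vector [a, b, t] :: real^3) $ i" using assms by (simp add: forall_3)
    have per: "\<exists>b'. lattice_basis (jac_lattice H) b' \<and> period_matrix H b' = selling (vector [a, b, 0])"
      if "graph_iso (dumbbell_graph (vector [a, b, t])) H" for H
      using dumbbell_period[OF that] by simp
    show ?thesis unfolding dumbbell_curve_pos[OF pos]
      using torelli_class[OF dumbbell_stable[OF pos] pd per] curve_class_in_M2[OF dumbbell_stable[OF pos]] by blast
  qed
  then show "torelli (dumbbell_curve (vector [a, b, t])) = ppav_rel `` {selling (vector [a, b, 0])}"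
    "dumbbell_curve (vector [a, b, t]) \<in> M2" by blast+
qed

lemma dumbbell_curve_swap:
  assumes "0 < a" "0 < b" "0 \<le> t"
  shows "dumbbell_curve (vector [a, b, t]) = dumbbell_curve (vector [b, a, t])"
proof (cases "t = 0")
  case True
  then show ?thesis using dumbbell_curve_bouquet assms bouquet_curve_swap by metis
next
  case False
  then have pos: "\<forall>i. 0 < (vector [a, b, t] :: real^3) $ i" "\<forall>i. 0 < (vector [b, a, t] :: real^3) $ i"
    using assms by (simp_all add: forall_3)
  let ?G = "dumbbell_graph (vector [b, a, t])"
  have "graph_iso (dumbbell_graph (vector [len ?G 1, len ?G 0, len ?G 2])) ?G"
    by (rule dumbbell_isoI[of _ 1 0 1 0 2]) (auto simp: dumbbell_graph_def)
  then have "graph_iso (dumbbell_graph (vector [a, b, t])) ?G" by (simp add: dumbbell_graph_def)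
  then show ?thesis unfolding pos[THEN dumbbell_curve_pos]
    by (rule curve_class_eqI[OF dumbbell_stable[OF pos(1)]])
qed

text \<open>
  A permutation of the coordinates permutes the three edges of the theta graph. If a length is \<open>0\<close>,
  then both curves are bouquets with the same two loop lengths.
\<close>

lemma theta_curve_lengths_eq:
  assumes x: "\<forall>i. 0 \<le> x $ i" and y: "\<forall>i. 0 \<le> y $ i" 
    and pd: "pos_def (selling x)" "pos_def (selling y)" and l: "lengths x = lengths y"
  shows "theta_curve x = theta_curve y"
proof (cases "\<exists>i. x $ i = 0")
  case True
  then obtain n where "x $ n = 0" by blast
  then have "0 \<in># lengths x" using exhaust_3[of n] by (auto simp: lengths_def)
  then have True': "\<exists>i. y $ i = 0" unfolding l by (auto simp: lengths_def)
  obtain i j m where ij: "i \<noteq> j" "i \<noteq> m" "j \<noteq> m" "{i, j, m} = UNIV" "0 < x $ i" "0 < x $ j" "x $ m = 0"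
    "lengths x = {#x $ i, x $ j, 0#}" "gl2z_equiv (selling (vector [x $ i, x $ j, 0])) (selling x)"
    by (rule one_zero_length[OF x pd(1) True])
  obtain i' j' m' where ij': "i' \<noteq> j'" "i' \<noteq> m'" "j' \<noteq> m'" "{i', j', m'} = UNIV" "0 < y $ i'" "0 < y $ j'" "y $ m' = 0"
    "lengths y = {#y $ i', y $ j', 0#}" "gl2z_equiv (selling (vector [y $ i', y $ j', 0])) (selling y)"
    by (rule one_zero_length[OF y pd(2) True'])
  have "{#x $ i, x $ j#} + {#0#} = {#y $ i', y $ j'#} + {#0#}" using l unfolding ij(8) ij'(8)
    by (simp add: add_mset_commute)
  then have "{#x $ i, x $ j#} = {#y $ i', y $ j'#}" by (rule add_right_imp_eq)
  from mset_2_eq[OF this] show ?thesis unfolding theta_curve_bouquet[OF ij(1-3,5-7)] theta_curve_bouquet[OF ij'(1-3,5-7)]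
  proof (elim disjE conjE)
    assume "x $ i = y $ i'" "x $ j = y $ j'"
    then show "curve_rel `` {bouquet_graph (x $ i) (x $ j)} = curve_rel `` {bouquet_graph (y $ i') (y $ j')}"
      by (simp only:)
  next
    assume "x $ i = y $ j'" "x $ j = y $ i'"
    then show "curve_rel `` {bouquet_graph (x $ i) (x $ j)} = curve_rel `` {bouquet_graph (y $ i') (y $ j')}"
      using bouquet_curve_swap[OF ij(5,6)] by (simp only:)
  qed
next
  case False
  then have px: "\<forall>i. 0 < x $ i" using x by (simp add: order_le_less)
  have "0 \<notin># lengths x" using False by (auto simp: lengths_def)
  then have py: "\<forall>i. 0 < y $ i" unfolding l using y by (auto simp: lengths_def forall_3 order_le_less)
  let ?G = "theta_graph y"
  have iso: "graph_iso (theta_graph (vector [len ?G e0, len ?G e1, len ?G e2])) ?G"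
    if "distinct [e0, e1, e2]" "{e0, e1, e2} = {0, 1, 2}" for e0 e1 e2
    by (rule theta_isoI[of _ 0 1 e0 e1 e2]) (use that in \<open>auto simp: theta_graph_def\<close>)
  have len: "len ?G 0 = y $ 1" "len ?G 1 = y $ 2" "len ?G 2 = y $ 3" by (simp_all add: theta_graph_def)
  have "{#x$1, x$2, x$3#} = {#y$1, y$2, y$3#}" using l by (simp add: lengths_def)
  from mset_3_eq[OF this]
  have "\<exists>e0 e1 e2. distinct [e0, e1, e2] \<and> {e0, e1, e2} = {0, 1, 2} \<and> x = vector [len ?G e0, len ?G e1, len ?G e2]"
  proof (elim disjE conjE)
    assume "x$1 = y$1" "x$2 = y$2" "x$3 = y$3"
    then show ?thesis by (intro exI[of _ 0] exI[of _ 1] exI[of _ 2]) (auto simp: vec3_eq_iff len[simplified])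
  next
    assume "x$1 = y$1" "x$2 = y$3" "x$3 = y$2"
    then show ?thesis by (intro exI[of _ 0] exI[of _ 2] exI[of _ 1]) (auto simp: vec3_eq_iff len[simplified])
  next
    assume "x$1 = y$2" "x$2 = y$1" "x$3 = y$3"
    then show ?thesis by (intro exI[of _ 1] exI[of _ 0] exI[of _ 2]) (auto simp: vec3_eq_iff len[simplified])
  next
    assume "x$1 = y$2" "x$2 = y$3" "x$3 = y$1"
    then show ?thesis by (intro exI[of _ 1] exI[of _ 2] exI[of _ 0]) (auto simp: vec3_eq_iff len[simplified])
  next
    assume "x$1 = y$3" "x$2 = y$1" "x$3 = y$2"
    then show ?thesis by (intro exI[of _ 2] exI[of _ 0] exI[of _ 1]) (auto simp: vec3_eq_iff len[simplified])
  next
    assume "x$1 = y$3" "x$2 = y$2" "x$3 = y$1"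
    then show ?thesis by (intro exI[of _ 2] exI[of _ 1] exI[of _ 0]) (auto simp: vec3_eq_iff len[simplified])
  qed
  then have "graph_iso (theta_graph x) ?G" using iso by blast
  then show ?thesis unfolding theta_curve_pos[OF px] theta_curve_pos[OF py]
    by (rule curve_class_eqI[OF theta_stable[OF px]])
qed

text \<open>
  A representative of \<open>\<Gamma>\<close> has a period matrix equivalent to \<open>Q\<close>, hence positive definite, and so
  has no vertex genus. A bouquet is listed as a dumbbell with \<open>t = 0\<close>.
\<close>

lemma pos_def_torelli_cases:
  assumes "\<Gamma> \<in> M2" "torelli \<Gamma> = ppav_rel `` {Q}" "pos_def Q"
  shows "(\<exists>x. (\<forall>i. 0 < x $ i) \<and> \<Gamma> = theta_curve x \<and> gl2z_equiv Q (selling x)) \<or>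
    (\<exists>a b t. 0 < a \<and> 0 < b \<and> 0 \<le> t \<and> \<Gamma> = dumbbell_curve (vector [a, b, t]) \<and> gl2z_equiv Q (selling (vector [a, b, 0])))"
proof -
  obtain G0 where G0: "G0 \<in> stable_genus2" "\<Gamma> = curve_rel `` {G0}" using assms(1) unfolding M2_def by (auto elim: quotientE)
  have "Q \<in> torelli \<Gamma>" unfolding assms(2) ppav_rel_def
    using pos_def_psd_rational[OF assms(3)] gl2z_equiv_refl by simp
  then obtain G b where G: "G \<in> \<Gamma>" "lattice_basis (jac_lattice G) b" "gl2z_equiv (period_matrix G b) Q"
    unfolding torelli_def ppav_rel_def by blast
  have GG: "G \<in> stable_genus2" "(G0, G) \<in> curve_rel" using G(1) unfolding G0 by (auto simp: curve_rel_def)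
  have \<Gamma>: "\<Gamma> = curve_rel `` {G}" unfolding G0 by (rule equiv_class_eq[OF equiv_curve_rel GG(2)])
  have pd: "pos_def (period_matrix G b)" using gl2z_equiv_pos_def[OF gl2z_equiv_sym[OF G(3)] assms(3)] .
  have "\<forall>v\<in>verts G. genus G v = 0" using pos_def_period_genus_zero[OF G(2) pd] by blast
  from genus2_classification[OF GG(1) this]
  consider (theta) x where "\<forall>i. 0 < x $ i" "graph_iso (theta_graph x) G"
    | (dumbbell) x where "\<forall>i. 0 < x $ i" "graph_iso (dumbbell_graph x) G"
    | (bouquet) a c where "0 < a" "0 < c" "graph_iso (bouquet_graph a c) G" by blast
  then show ?thesis
  proof cases
    case theta
    have "\<Gamma> = theta_curve x" unfolding \<Gamma> theta_curve_pos[OF theta(1)]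
      by (rule curve_class_eqI[OF theta_stable[OF theta(1)] theta(2), symmetric])
    moreover obtain b' where "lattice_basis (jac_lattice G) b'" "period_matrix G b' = selling x"
      using theta_period[OF theta(2)] by blast
    then have "gl2z_equiv Q (selling x)"
      using lattice_basis_equiv[OF G(2)] G(3) gl2z_equiv_sym gl2z_equiv_trans by metis
    ultimately show ?thesis using theta(1) by blast
  next
    case dumbbell
    have x: "x = vector [x$1, x$2, x$3]" by (rule vec3_expand)
    have "\<Gamma> = dumbbell_curve x" unfolding \<Gamma> dumbbell_curve_pos[OF dumbbell(1)]
      by (rule curve_class_eqI[OF dumbbell_stable[OF dumbbell(1)] dumbbell(2), symmetric])
    moreover obtain b' where "lattice_basis (jac_lattice G) b'" "period_matrix G b' = selling (vector [x$1, x$2, 0])"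
      using dumbbell_period[OF dumbbell(2)] by blast
    then have "gl2z_equiv Q (selling (vector [x$1, x$2, 0]))"
      using lattice_basis_equiv[OF G(2)] G(3) gl2z_equiv_sym gl2z_equiv_trans by metis
    moreover have "0 < x$1" "0 < x$2" "0 \<le> x$3" using dumbbell(1) by (simp_all add: less_imp_le)
    ultimately show ?thesis using x by metis
  next
    case bouquet
    have "\<Gamma> = dumbbell_curve (vector [a, c, 0])" unfolding \<Gamma> dumbbell_curve_bouquet[OF bouquet(1,2)]
      by (rule curve_class_eqI[OF bouquet_stable[OF bouquet(1,2)] bouquet(3), symmetric])
    moreover obtain b' where "lattice_basis (jac_lattice G) b'" "period_matrix G b' = selling (vector [a, c, 0])"
      using bouquet_period[OF bouquet(3)] by blast
    then have "gl2z_equiv Q (selling (vector [a, c, 0]))"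
      using lattice_basis_equiv[OF G(2)] G(3) gl2z_equiv_sym gl2z_equiv_trans by metis
    ultimately show ?thesis using bouquet by blast
  qed
qed

text \<open>
  Both curves have the same multiset of positive edge lengths. On the theta side there are at least
  two of them, on the dumbbell side at most two.
\<close>

lemma bridgeless_dumbbell_eq_theta:
  assumes "0 \<le> a" "0 \<le> b" and x: "\<forall>i. 0 \<le> x $ i" and pd: "pos_def (selling x)"
    and eq: "dumbbell_curve (vector [a, b, 0]) = theta_curve x"
  shows "0 < a" "0 < b" "lengths x = {#a, b, 0#}"
proof -
  have "edge_lengths (contract (dumbbell_graph (vector [a, b, 0]))) = edge_lengths (contract (theta_graph x))"
    by (rule curve_eq_edge_lengths) (use eq theta_contract_stable[OF x pd] in \<open>simp_all add: theta_curve_def dumbbell_curve_def\<close>)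
  then have e: "filter_mset (\<lambda>l. l \<noteq> 0) {#a, b, 0#} = filter_mset (\<lambda>l. l \<noteq> 0) {#x$1, x$2, x$3#}"
    by (simp only: edge_lengths_contract edge_lengths_dumbbell edge_lengths_theta theta_sel dumbbell_sel finite.intros vector_3)
  have two: "(0 < x$1 \<and> 0 < x$2) \<or> (0 < x$1 \<and> 0 < x$3) \<or> (0 < x$2 \<and> 0 < x$3)"
    using pd unfolding pos_def_selling_iff[OF x] .
  have sz: "size (filter_mset (\<lambda>l. l \<noteq> 0) {#a, b, 0#}) = size (filter_mset (\<lambda>l. l \<noteq> 0) {#x$1, x$2, x$3#})"
    using e by simp
  have ab: "a \<noteq> 0" "b \<noteq> 0" using sz two by (auto split: if_splits)
  then show "0 < a" "0 < b" using assms(1,2) by auto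
  have "x$1 = 0 \<or> x$2 = 0 \<or> x$3 = 0" using sz ab by (auto split: if_splits)
  then show "lengths x = {#a, b, 0#}" using e two ab unfolding lengths_def
    by (auto simp: add_mset_commute)
qed

lemma bridgeless_dumbbell_eq_zero:
  assumes eq: "dumbbell_curve (vector [a, b, 0]) = theta_curve 0"
  shows "a = 0" "b = 0"
proof -
  have "contract (theta_graph 0) \<in> stable_genus2" by (rule single_vertex_stable[OF theta_contract_zero])
  then have "edge_lengths (contract (dumbbell_graph (vector [a, b, 0]))) = edge_lengths (contract (theta_graph 0))"
    using eq unfolding theta_curve_def dumbbell_curve_def by (rule curve_eq_edge_lengths[rotated])
  then have e: "filter_mset (\<lambda>l. l \<noteq> 0) {#a, b, 0#} = filter_mset (\<lambda>l. l \<noteq> 0) {#(0::real^3)$1, (0::real^3)$2, (0::real^3)$3#}"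
    by (simp only: edge_lengths_contract edge_lengths_dumbbell edge_lengths_theta theta_sel dumbbell_sel finite.intros vector_3)
  then show "a = 0" "b = 0" by (auto split: if_splits)
qed

section \<open>The reducing base change on a chamber\<close>

lemma linear_base_change: "linear (base_change p q r s)"
  by (rule linearI) (simp_all add: mat2_eq_iff base_change_def algebra_simps)

definition selling_coords :: "real^2^2 \<Rightarrow> real^3" where
  "selling_coords M = vector [M$1$1 + M$1$2, M$2$2 + M$1$2, - M$1$2]"

lemma selling_selling_coords: "M$1$2 = M$2$1 \<Longrightarrow> selling (selling_coords M) = M"
  by (simp add: mat2_eq_iff selling_coords_def)

lemma selling_coords_selling: "selling_coords (selling x) = x"
  by (simp add: vec3_eq_iff selling_coords_def)

lemma linear_selling_coords: "linear selling_coords"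
  by (rule linearI) (simp_all add: vec3_eq_iff selling_coords_def algebra_simps)

lemma inj_split_matrix:
  assumes "0 < d" shows "inj (split_matrix d k)"
proof (rule linear_injective_0[OF split_matrix_linear, THEN iffD2], intro allI impI)
  fix p assume a: "split_matrix d k p = 0"
  obtain x y where p: "p = (x, y)" by (cases p)
  have "split_matrix d k p $ 1 $ 1 = 0" "split_matrix d k p $ 2 $ 2 = 0" unfolding a by simp_all
  then have "x = 0" "y = 0" using assms unfolding p by auto
  then show "p = 0" by (simp add: p zero_prod_def)
qed

text \<open>
  Reduce the form at one point of the chamber and use the same base change everywhere. The
  coefficients are linear functions of the point. Where all are non-negative none can vanish, as the
  point would lie on a wall; so the chamber is the disjoint union of the open sets \<open>U\<close> (all
  coefficients positive) and \<open>V\<close> (one of them negative), and connectedness leaves only \<open>U\<close>.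
\<close>

lemma chamber_reduction:
  assumes "2 \<le> d" "coprime k d" and g: "(a, b) \<in> gaps (slope ` walls d k)"
  shows "\<exists>A. linear A \<and> inj A \<and> (\<forall>p. gl2z_equiv (split_matrix d k p) (selling (A p))) \<and>
     (\<forall>p\<in>sector a b. \<forall>i. 0 \<le> A p $ i) \<and> (\<forall>p\<in>open_sector a b. \<forall>i. 0 < A p $ i)"
proof -
  let ?T = "slope ` walls d k"
  note T = walls_slopes[OF assms(1,2)]
  have W: "wall_rays ?T = walls d k" unfolding wall_rays_def using T(3) by simp
  note gd = gapsD[OF T(1,2) g]
  have C: "open_sector a b \<subseteq> open_quadrant - walls d k"
    using open_sector_chamber[OF T(1,2) g] unfolding W .
  obtain p0 where p0: "p0 \<in> open_sector a b" using open_sector_nonempty[OF gd(1)] by blast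
  then have "p0 \<in> open_quadrant" using C by blast
  then have "pos_def (split_matrix d k p0)" using pos_def_split_matrix assms(1) by simp
  then obtain y where y: "\<forall>i. 0 \<le> y $ i" "gl2z_equiv (split_matrix d k p0) (selling y)"
    by (rule selling_reduction)
  then obtain p q r s where det: "\<bar>p * s - q * r\<bar> = 1" "selling y = base_change p q r s (split_matrix d k p0)"
    unfolding gl2z_equiv_iff by blast
  define B where "B = (\<lambda>z. base_change p q r s (split_matrix d k z))"
  define A where "A = (\<lambda>z. selling_coords (B z))"
  have linB: "linear B" unfolding B_def using linear_compose[OF split_matrix_linear linear_base_change] by (simp add: o_def)
  have linA: "linear A" unfolding A_def using linear_compose[OF linB linear_selling_coords] by (simp add: o_def)
  have sB: "selling (A z) = B z" for z
    unfolding A_def by (rule selling_selling_coords) (cases z, simp add: B_def base_change_def algebra_simps)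
  have equiv: "gl2z_equiv (split_matrix d k z) (selling (A z))" for z
    unfolding sB B_def gl2z_equiv_iff using det(1) by blast
  have "inj A"
  proof (rule linear_injective_0[OF linA, THEN iffD2], intro allI impI)
    fix z assume "A z = 0"
    then have "B z = 0" using sB linear_0[OF linear_selling] by metis
    then have "base_change s (- q) (- r) p (B z) = 0" using linear_0[OF linear_base_change] by simp
    moreover have e: "(real_of_int (p * s - q * r))\<^sup>2 = 1"
      using det(1) by (metis of_int_1 of_int_power power2_abs power_one)
    ultimately have "split_matrix d k z = 0" unfolding B_def base_change_adjugate e by simp
    then show "z = 0" using inj_split_matrix[of d k] assms(1) linear_0[OF split_matrix_linear]
      by (metis injD not_numeral_le_zero zero_less_iff_neq_zero)
  qed
  have cont: "continuous_on UNIV (\<lambda>z. A z $ i)" for i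
    by (intro continuous_intros linear_continuous_on linear_conv_bounded_linear[THEN iffD1, OF linA])
  define U where "U = {z. \<forall>i. 0 < A z $ i}"
  define V where "V = {z. \<exists>i. A z $ i < 0}"
  have "open U"
  proof -
    have "U = (\<Inter>i. {z. 0 < A z $ i})" unfolding U_def by auto
    then show ?thesis using cont by (auto intro!: open_INT open_Collect_less)
  qed
  have "open V"
  proof -
    have "V = (\<Union>i. {z. A z $ i < 0})" unfolding V_def by auto
    then show ?thesis using cont by (auto intro!: open_UN open_Collect_less)
  qed
  have cover: "open_sector a b \<subseteq> U \<union> V"
  proof
    fix z assume z: "z \<in> open_sector a b"
    then have "z \<in> open_quadrant" "z \<notin> walls d k" using C by blast+
    then have "\<not> ((\<forall>i. 0 \<le> A z $ i) \<and> (\<exists>i. A z $ i = 0))"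
      using wall_iff_boundary[of z d k] equiv[of z] by blast
    then show "z \<in> U \<union> V" unfolding U_def V_def by (auto simp: not_less order_le_less)
  qed
  have "A p0 = y" unfolding A_def B_def det(2)[symmetric] selling_coords_selling ..
  then have "p0 \<notin> V" using y(1) by (auto simp: V_def not_less)
  then have "p0 \<in> U" using cover p0 by blast
  have disj: "U \<inter> V \<inter> open_sector a b = {}" unfolding U_def V_def by (auto dest: order_less_asym)
  have "U \<inter> open_sector a b = {} \<or> V \<inter> open_sector a b = {}"
    using connectedD[OF convex_connected[OF convex_open_sector] \<open>open U\<close> \<open>open V\<close> disj cover] .
  then have sub: "open_sector a b \<subseteq> U" using \<open>p0 \<in> U\<close> p0 cover by blast
  then have pos: "\<forall>z\<in>open_sector a b. \<forall>i. 0 < A z $ i" unfolding U_def by blast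
  have "closed {z. \<forall>i. 0 \<le> A z $ i}"
  proof -
    have "{z. \<forall>i. 0 \<le> A z $ i} = (\<Inter>i. {z. 0 \<le> A z $ i})" by auto
    then show ?thesis using cont by (auto intro!: closed_INT closed_Collect_le)
  qed
  moreover have "open_sector a b \<subseteq> {z. \<forall>i. 0 \<le> A z $ i}" using pos by (auto intro: less_imp_le)
  ultimately have "sector a b \<subseteq> {z. \<forall>i. 0 \<le> A z $ i}"
    unfolding closure_open_sector[OF gd(1), symmetric] by (rule closure_minimal[rotated])
  then show ?thesis using linA \<open>inj A\<close> equiv pos by blast
qed

lemma card_split_indices:
  assumes "2 \<le> d" shows "card (split_indices d) = totient d"
proof -
  have "split_indices d = totatives d"
    using assms by (auto simp: split_indices_def totatives_def order_le_less)
  then show ?thesis by (simp add: totient_def)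
qed

lemma Delta_eq_sector_fan:
  assumes "2 \<le> d" "coprime k d"
  shows "Delta d k = sector_fan (slope ` walls d k)"
  unfolding Delta_def sector_fan_def wall_rays_def using walls_slopes(3)[OF assms] by simp


lemma theta_curve_eq_bridgeless_dumbbell:
  assumes "0 < a" "0 < b" "\<forall>i. 0 \<le> x $ i" "pos_def (selling x)" "lengths x = {#a, b, 0#}"
  shows "theta_curve x = dumbbell_curve (vector [a, b, 0])"
proof -
  let ?y = "vector [a, b, 0] :: real^3"
  have y: "\<forall>i. 0 \<le> ?y $ i" using assms by (simp add: forall_3)
  have "pos_def (selling ?y)" using assms by (simp add: pos_def_def)
  then have "theta_curve x = theta_curve ?y"
    by (rule theta_curve_lengths_eq[OF assms(3) y assms(4)]) (subst assms(5), simp add: lengths_def)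
  also have "\<dots> = dumbbell_curve ?y"
    using theta_curve_bouquet[of 1 2 3 ?y] dumbbell_curve_bouquet[OF assms(1,2)] assms(1,2) by simp
  finally show ?thesis .
qed

section \<open>Linear maps from the cones to the moduli space\<close>

text \<open>
  Edge lengths of theta graphs, depending linearly on \<open>(l', l)\<close>, whose Jacobians are the split ones.
\<close>

definition chart :: "nat \<Rightarrow> nat \<Rightarrow> (real \<times> real) set \<Rightarrow> (real \<times> real \<Rightarrow> real^3) \<Rightarrow> bool" where
  "chart d k s A \<longleftrightarrow> linear A \<and> inj A \<and> (\<forall>p. gl2z_equiv (split_matrix d k p) (selling (A p))) \<and>
     (\<forall>p\<in>s. \<forall>i. 0 \<le> A p $ i) \<and> (\<forall>p\<in>interior s. \<forall>i. 0 < A p $ i)"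

lemma chart_theta:
  assumes "chart d k s A" "0 < d" "p \<in> s" "p \<in> open_quadrant"
  shows "\<forall>i. 0 \<le> A p $ i" "pos_def (selling (A p))" "theta_curve (A p) \<in> M2"
    "torelli (theta_curve (A p)) = ppav_rel `` {split_matrix d k p}"
proof -
  show nn: "\<forall>i. 0 \<le> A p $ i" using assms by (simp add: chart_def)
  have eq: "gl2z_equiv (split_matrix d k p) (selling (A p))" using assms unfolding chart_def by blast
  have pd: "pos_def (split_matrix d k p)" by (rule pos_def_split_matrix[OF assms(4,2)])
  show pd': "pos_def (selling (A p))" by (rule gl2z_equiv_pos_def[OF eq pd])
  show "theta_curve (A p) \<in> M2" by (rule torelli_theta[OF nn pd'])
  show "torelli (theta_curve (A p)) = ppav_rel `` {split_matrix d k p}"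
    using torelli_theta(1)[OF nn pd'] ppav_class_eqI[OF pd eq] by simp
qed

lemma chart_lengths:
  assumes "chart d k s A" "0 < d" "p \<in> s" "p \<in> open_quadrant" "\<forall>i. 0 \<le> y $ i" "gl2z_equiv (split_matrix d k p) (selling y)"
  shows "lengths (A p) = lengths y"
proof (rule gl2z_equiv_selling_lengths_eq[OF chart_theta(1)[OF assms(1-4)] assms(5) _ chart_theta(2)[OF assms(1-4)]])
  have "gl2z_equiv (split_matrix d k p) (selling (A p))" using assms unfolding chart_def by blast
  then show "gl2z_equiv (selling (A p)) (selling y)" using gl2z_equiv_trans[OF gl2z_equiv_sym assms(6)] by blast
qed

text \<open>
  On a wall some reduced form has a vanishing coefficient, and the coefficients are unique up to
  order.
\<close>

lemma chart_wall:
  assumes "chart d k s A" "0 < d" "p \<in> s" "p \<in> walls d k"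
  shows "\<exists>i. A p $ i = 0"
proof -
  obtain y where y: "\<forall>i. 0 \<le> y $ i" "\<exists>i. y $ i = 0" "gl2z_equiv (split_matrix d k p) (selling y)" and p: "p \<in> open_quadrant"
    using assms(4) wall_iff_boundary by blast
  obtain n where "y $ n = 0" using y(2) by blast
  then have "0 \<in># lengths y" using exhaust_3[of n] by (auto simp: lengths_def)
  then have "0 \<in># lengths (A p)" using chart_lengths[OF assms(1-3) p y(1,3)] by simp
  then show ?thesis by (auto simp: lengths_def)
qed

lemma chart_bridgeless:
  assumes "chart d k s A" "0 < d" "p \<in> s" "p \<in> open_quadrant" "0 \<le> a" "0 \<le> b"
    "dumbbell_curve (vector [a, b, 0]) = theta_curve (A p)"
  shows "0 < a" "0 < b" "lengths (A p) = {#a, b, 0#}"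
  using bridgeless_dumbbell_eq_theta[OF assms(5,6) chart_theta(1,2)[OF assms(1-4)] assms(7)] by blast+

text \<open>
  Both charts give reduced forms of the same class, and such forms have the same lengths.
\<close>

lemma charts_agree:
  assumes "chart d k s A" "chart d k s' A'" "0 < d" "p \<in> s" "p \<in> s'" "p \<in> open_quadrant"
  shows "theta_curve (A p) = theta_curve (A' p)"
proof -
  have "gl2z_equiv (split_matrix d k p) (selling (A' p))" using assms(2) unfolding chart_def by blast
  from chart_lengths[OF assms(1,3,4,6) chart_theta(1)[OF assms(2,3,5,6)] this] show ?thesis
    by (rule theta_curve_lengths_eq[OF chart_theta(1)[OF assms(1,3,4,6)] chart_theta(1)[OF assms(2,3,5,6)]
      chart_theta(2)[OF assms(1,3,4,6)] chart_theta(2)[OF assms(2,3,5,6)]])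
qed

context
  fixes d k :: nat
  assumes d: "2 \<le> d" and k: "coprime k d"
begin

lemmas slopes = walls_slopes[OF d k]
lemmas Delta_eq = Delta_eq_sector_fan[OF d k]

lemma d_pos: "0 < d" using d by simp

lemma max_cones_Delta: "max_cones (Delta d k) = {sector a b | a b. (a, b) \<in> gaps (slope ` walls d k)}"
  unfolding Delta_eq by (rule max_cones_sector_fan[OF slopes(1,2)])

lemma inner_rays_Delta: "inner_rays (Delta d k) = ray ` slope ` walls d k"
  unfolding Delta_eq by (rule inner_rays_sector_fan[OF slopes(1,2)])

lemma chart_exists:
  assumes "s \<in> max_cones (Delta d k)" shows "\<exists>A. chart d k s A"
proof -
  obtain a b where ab: "s = sector a b" "(a, b) \<in> gaps (slope ` walls d k)" using assms unfolding max_cones_Delta by blast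
  show ?thesis using chamber_reduction[OF d k ab(2)] unfolding chart_def ab(1) interior_sector .
qed

lemma ray_in_walls:
  assumes "t \<in> slope ` walls d k" "p \<in> ray t" "p \<noteq> 0"
  shows "p \<in> walls d k"
proof -
  obtain x y where p: "p = (x, y)" by (cases p)
  have t: "0 < t" "t < 1" using slopes(2) assms(1) by auto
  have y: "y = t * (x + y)" "0 \<le> x + y" using assms(2) by (auto simp: p mem_ray)
  have "x + y \<noteq> 0"
  proof
    assume z: "x + y = 0"
    then have "y = 0" using y(1) by simp
    then show False using z assms(3) by (simp add: p zero_prod_def)
  qed
  then have pos: "0 < x + y" using y(2) by simp
  then have "slope p = t" using y(1) by (simp add: p slope_def field_simps)
  moreover from this have "p \<in> open_quadrant" using mem_open_quadrant_slope[OF slopes(1,2), of x y] pos t by (simp add: p)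
  ultimately show ?thesis using slopes(3) assms(1) by blast
qed

lemma wall_on_ray:
  assumes "p \<in> walls d k" shows "p \<in> ray (slope p)" "p \<noteq> 0"
proof -
  obtain x y where p: "p = (x, y)" by (cases p)
  have "0 < x" "0 < y" using assms by (auto simp: p wall_iff_boundary open_quadrant_def)
  then show "p \<in> ray (slope p)" "p \<noteq> 0" by (auto simp: p mem_ray slope_def zero_prod_def)
qed

text \<open>
  Different sectors meet in the origin or in a ray on a wall. Each coordinate axis, on which the form
  degenerates, belongs to one sector only.
\<close>

lemma neighbouring_cones_Int:
  assumes "s \<in> max_cones (Delta d k)" "s' \<in> max_cones (Delta d k)" "s \<noteq> s'" "p \<in> s" "p \<in> s'"
  shows "p = 0 \<or> p \<in> open_quadrant"
proof -
  obtain a b where ab: "s = sector a b" "(a, b) \<in> gaps (slope ` walls d k)" using assms(1) unfolding max_cones_Delta by blast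
  obtain a' b' where ab': "s' = sector a' b'" "(a', b') \<in> gaps (slope ` walls d k)" using assms(2) unfolding max_cones_Delta by blast
  note g = gapsD[OF slopes(1,2) ab(2)] and g' = gapsD[OF slopes(1,2) ab'(2)]
  have *: "p = 0 \<or> p \<in> walls d k" if "t \<in> slope ` walls d k" "p \<in> ray t" for t
    using ray_in_walls[OF that] by blast
  have "b \<le> a' \<or> b' \<le> a" using gaps_separated[OF slopes(1,2) ab(2) ab'(2)] assms(3) ab(1) ab'(1) by blast
  then have "p = 0 \<or> p \<in> walls d k"
  proof
    assume l: "b \<le> a'"
    have "p \<in> (if b = a' then ray b else {0})" using sector_Int[OF g(1) l g'(1)] assms(4,5) ab(1) ab'(1) by blast
    moreover have "b \<in> slope ` walls d k" if "b = a'" using g g' that by auto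
    ultimately show ?thesis using * by (auto split: if_splits)
  next
    assume l: "b' \<le> a"
    have "p \<in> (if b' = a then ray b' else {0})" using sector_Int[OF g'(1) l g(1)] assms(4,5) ab(1) ab'(1) by blast
    moreover have "b' \<in> slope ` walls d k" if "b' = a" using g g' that by auto
    ultimately show ?thesis using * by (auto split: if_splits)
  qed
  then show ?thesis using wall_iff_boundary by blast
qed

context
  fixes \<phi> :: "(real \<times> real) set \<Rightarrow> real \<times> real \<Rightarrow> real^3"
  assumes \<phi>: "\<And>s. s \<in> max_cones (Delta d k) \<Longrightarrow> chart d k s (\<phi> s)"
begin

lemma locus_from_theta:
  assumes "s \<in> max_cones (Delta d k)" "p \<in> s" "p \<in> open_quadrant"
  shows "theta_curve (\<phi> s p) \<in> L_locus d k"
  unfolding L_locus_def split_classes_def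
  using chart_theta(3,4)[OF \<phi>[OF assms(1)] d_pos assms(2,3)] assms(3) by blast

lemma locus_from_dumbbell:
  assumes "s \<in> max_cones (Delta d k)" "p \<in> s" "p \<in> open_quadrant" "0 \<le> a" "0 \<le> b" "0 \<le> t"
    "dumbbell_curve (vector [a, b, 0]) = theta_curve (\<phi> s p)"
  shows "dumbbell_curve (vector [a, b, t]) \<in> L_locus d k"
proof -
  note ab = chart_bridgeless(1,2)[OF \<phi>[OF assms(1)] d_pos assms(2-5,7)]
  have "torelli (dumbbell_curve (vector [a, b, t])) = torelli (dumbbell_curve (vector [a, b, 0]))"
    using torelli_dumbbell(1)[OF ab assms(6)] torelli_dumbbell(1)[OF ab order_refl] by simp
  also have "\<dots> = ppav_rel `` {split_matrix d k p}"
    unfolding assms(7) by (rule chart_theta(4)[OF \<phi>[OF assms(1)] d_pos assms(2,3)])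
  finally show ?thesis unfolding L_locus_def split_classes_def
    using torelli_dumbbell(2)[OF ab assms(6)] assms(3) by blast
qed

text \<open>
  The theta curves in the locus come from the cones by uniqueness of reduced coefficients. A dumbbell
  has a diagonal period matrix, so the corresponding point \<open>(l', l)\<close> lies on a wall, and the
  dumbbell arises by inserting a bridge into the bouquet at that point. Conversely, a bridge does not
  change the Jacobian.
\<close>

lemma L_locus_eq:
  "L_locus d k =
    (\<Union>s\<in>max_cones (Delta d k). theta_curve ` \<phi> s ` (s \<inter> open_quadrant)) \<union>
    (\<Union>s\<in>max_cones (Delta d k). \<Union>r\<in>{r \<in> inner_rays (Delta d k). r face_of s}.
       times_bridge (theta_curve ` \<phi> s ` (r - {0})))" (is "_ = ?T \<union> ?D")
proof
  show "?T \<union> ?D \<subseteq> L_locus d k"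
  proof
    fix \<Gamma> assume "\<Gamma> \<in> ?T \<union> ?D"
    then consider s p where "s \<in> max_cones (Delta d k)" "p \<in> s" "p \<in> open_quadrant" "\<Gamma> = theta_curve (\<phi> s p)"
      | s r where "s \<in> max_cones (Delta d k)" "r \<in> inner_rays (Delta d k)" "r face_of s"
          "\<Gamma> \<in> times_bridge (theta_curve ` \<phi> s ` (r - {0}))"
      by blast
    then show "\<Gamma> \<in> L_locus d k"
    proof cases
      case 1 then show ?thesis using locus_from_theta by simp
    next
      case 2
      then obtain a b t p where \<Gamma>: "\<Gamma> = dumbbell_curve (vector [a, b, t])" "0 \<le> a" "0 \<le> b" "0 \<le> t"
        and p: "p \<in> r" "p \<noteq> 0" "dumbbell_curve (vector [a, b, 0]) = theta_curve (\<phi> s p)"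
        unfolding times_bridge_def by blast
      obtain \<tau> where "\<tau> \<in> slope ` walls d k" "r = ray \<tau>" using 2(2) unfolding inner_rays_Delta by blast
      then have "p \<in> open_quadrant" using ray_in_walls p wall_iff_boundary by blast
      moreover have "p \<in> s" using p(1) 2(3) face_of_imp_subset by blast
      ultimately show ?thesis unfolding \<Gamma>(1) using locus_from_dumbbell 2(1) \<Gamma>(2-4) p(3) by blast
    qed
  qed
  show "L_locus d k \<subseteq> ?T \<union> ?D"
  proof
    fix \<Gamma> assume "\<Gamma> \<in> L_locus d k"
    then obtain p where \<Gamma>: "\<Gamma> \<in> M2" "torelli \<Gamma> = ppav_rel `` {split_matrix d k p}" and p: "p \<in> open_quadrant"
      unfolding L_locus_def split_classes_def by blast
    from pos_def_torelli_cases[OF \<Gamma> pos_def_split_matrix[OF p d_pos]]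
    consider (theta) x where "\<forall>i. 0 < x $ i" "\<Gamma> = theta_curve x" "gl2z_equiv (split_matrix d k p) (selling x)"
      | (dumbbell) a b t where "0 < a" "0 < b" "0 \<le> t" "\<Gamma> = dumbbell_curve (vector [a, b, t])"
          "gl2z_equiv (split_matrix d k p) (selling (vector [a, b, 0]))" by blast
    then show "\<Gamma> \<in> ?T \<union> ?D"
    proof cases
      case theta
      obtain a b where ab: "(a, b) \<in> gaps (slope ` walls d k)" "p \<in> sector a b"
        using open_quadrant_in_sectors[OF slopes(1,2) p] by blast
      let ?s = "sector a b"
      have s: "?s \<in> max_cones (Delta d k)" unfolding max_cones_Delta using ab(1) by blast
      have x: "\<forall>i. 0 \<le> x $ i" using theta(1) by (simp add: less_imp_le)
      have pd: "pos_def (selling x)" by (rule gl2z_equiv_pos_def[OF theta(3) pos_def_split_matrix[OF p d_pos]])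
      have "theta_curve (\<phi> ?s p) = theta_curve x"
        by (rule theta_curve_lengths_eq[OF chart_theta(1)[OF \<phi>[OF s] d_pos ab(2) p] x chart_theta(2)[OF \<phi>[OF s] d_pos ab(2) p] pd
           chart_lengths[OF \<phi>[OF s] d_pos ab(2) p x theta(3)]])
      then have "\<Gamma> = theta_curve (\<phi> ?s p)" using theta(2) by simp
      then have "\<Gamma> \<in> ?T" using s p ab(2) by blast
      then show ?thesis by blast
    next
      case dumbbell
      let ?y = "vector [a, b, 0] :: real^3"
      have y: "\<forall>i. 0 \<le> ?y $ i" using dumbbell(1,2) by (simp add: forall_3)
      have "?y $ 3 = 0" by simp
      then have w: "p \<in> walls d k" unfolding wall_iff_boundary using p y dumbbell(5) by blast
      then have \<tau>: "slope p \<in> slope ` walls d k" by blast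
      obtain a' b' where g: "(a', slope p) \<in> gaps (slope ` walls d k)" "(slope p, b') \<in> gaps (slope ` walls d k)"
        by (rule gaps_at_wall[OF slopes(1,2) \<tau>])
      let ?s = "sector a' (slope p)" and ?r = "ray (slope p)"
      have s: "?s \<in> max_cones (Delta d k)" unfolding max_cones_Delta using g(1) by blast
      have r: "?r \<in> inner_rays (Delta d k)" unfolding inner_rays_Delta using \<tau> by blast
      have face: "?r face_of ?s" using ray_face(2) gapsD(1)[OF slopes(1,2) g(1)] by blast
      have pr: "p \<in> ?r" "p \<noteq> 0" using wall_on_ray[OF w] by blast+
      have ps: "p \<in> ?s" using pr(1) face face_of_imp_subset by blast
      have "lengths (\<phi> ?s p) = {#a, b, 0#}"
        using chart_lengths[OF \<phi>[OF s] d_pos ps p y dumbbell(5)] by (simp add: lengths_def)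
      then have "theta_curve (\<phi> ?s p) = dumbbell_curve ?y"
        by (rule theta_curve_eq_bridgeless_dumbbell[OF dumbbell(1,2) chart_theta(1,2)[OF \<phi>[OF s] d_pos ps p]])
      then have "dumbbell_curve ?y \<in> theta_curve ` \<phi> ?s ` (?r - {0})" using pr by (metis DiffI image_eqI singletonD)
      then have "\<Gamma> \<in> times_bridge (theta_curve ` \<phi> ?s ` (?r - {0}))"
        unfolding times_bridge_def dumbbell(4) using dumbbell(1-3) less_imp_le by blast
      then have "\<Gamma> \<in> ?D" using s r face by blast
      then show ?thesis by blast
    qed
  qed
qed

lemma chart_theta_cone:
  assumes s: "s \<in> max_cones (Delta d k)"
  shows "linear_to_cell s (\<phi> s) \<and> (\<forall>p\<in>interior s. \<forall>i. 0 < \<phi> s p $ i) \<and>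
    convex_cone (\<phi> s ` s) \<and> aff_dim (\<phi> s ` interior s) = 2 \<and>
    theta_curve ` \<phi> s ` interior s \<subseteq> theta_part"
proof -
  note c = \<phi>[OF s, unfolded chart_def]
  obtain a b where ab: "s = sector a b" "(a, b) \<in> gaps (slope ` walls d k)" using s unfolding max_cones_Delta by blast
  have lt: "a < b" using gapsD(1)[OF slopes(1,2) ab(2)] .
  have "interior s \<noteq> {}" unfolding ab(1) interior_sector using open_sector_nonempty[OF lt] by blast
  then have "aff_dim (interior s) = 2" using aff_dim_open[of "interior s"] by simp
  then have "aff_dim (\<phi> s ` interior s) = 2" using c aff_dim_injective_linear_image by metis
  moreover have "convex_cone (\<phi> s ` s)" unfolding ab(1)
    using convex_cone_linear_image convex_cone_sector c[unfolded ab(1)] by blast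
  moreover have "theta_curve ` \<phi> s ` interior s \<subseteq> theta_part"
    unfolding theta_part_def by (intro image_mono) (use c less_imp_le in blast)
  ultimately show ?thesis using c unfolding linear_to_cell_def by blast
qed

text \<open>
  By linearity the edge that has length \<open>0\<close> at one point of the ray has length \<open>0\<close> on the whole
  ray, and the other two are positive away from the origin. At the origin all three lengths are
  \<open>0\<close>, and the dumbbells degenerate to a bridge between two vertices of genus \<open>1\<close>.
\<close>

lemma chart_ray_times_bridge:
  assumes s: "s \<in> max_cones (Delta d k)" and r: "r \<in> inner_rays (Delta d k)" "r face_of s"
  shows "\<exists>i j. i \<noteq> j \<and> (\<forall>p\<in>r - {0}. {m. \<phi> s p $ m \<noteq> 0} = {i, j}) \<and>
    (let \<psi> = (\<lambda>(p, t). vector [\<phi> s p $ i, \<phi> s p $ j, t]) in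
       linear_to_cell (r \<times> {0..}) \<psi> \<and>
       dumbbell_curve ` \<psi> ` (r \<times> {0..}) \<subseteq> dumbbell_part \<and>
       dumbbell_curve ` \<psi> ` (r \<times> {0..}) = times_bridge (theta_curve ` \<phi> s ` r))"
proof -
  obtain \<tau> where \<tau>: "\<tau> \<in> slope ` walls d k" "r = ray \<tau>" using r(1) unfolding inner_rays_Delta by blast
  have rs: "p \<in> s" if "p \<in> r" for p using that r(2) face_of_imp_subset by blast
  have rw: "p \<in> walls d k" "p \<in> open_quadrant" if "p \<in> r" "p \<noteq> 0" for p
    using ray_in_walls[OF \<tau>(1)] that wall_iff_boundary unfolding \<tau>(2) by blast+
  have lin: "linear (\<phi> s)" using \<phi>[OF s] by (simp add: chart_def)
  have nn: "\<forall>i. 0 \<le> \<phi> s p $ i" if "p \<in> r" for p using \<phi>[OF s] rs[OF that] by (simp add: chart_def)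
  \<comment> \<open>A generator of the ray; it decides which edge is contracted.\<close>
  define p1 where "p1 = (1 - \<tau>, \<tau>)"
  have p1: "p1 \<in> r" "p1 \<noteq> 0" unfolding \<tau>(2) p1_def by (auto simp: mem_ray zero_prod_def)
  obtain i j m where ij: "i \<noteq> j" "i \<noteq> m" "j \<noteq> m" "{i, j, m} = UNIV" "0 < \<phi> s p1 $ i" "0 < \<phi> s p1 $ j" "\<phi> s p1 $ m = 0"
    "lengths (\<phi> s p1) = {#\<phi> s p1 $ i, \<phi> s p1 $ j, 0#}" "gl2z_equiv (selling (vector [\<phi> s p1 $ i, \<phi> s p1 $ j, 0])) (selling (\<phi> s p1))"
    by (rule one_zero_length[OF nn[OF p1(1)] chart_theta(2)[OF \<phi>[OF s] d_pos rs[OF p1(1)] rw(2)[OF p1]]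
      chart_wall[OF \<phi>[OF s] d_pos rs[OF p1(1)] rw(1)[OF p1]]])
  have supp: "0 < \<phi> s p $ i" "0 < \<phi> s p $ j" "\<phi> s p $ m = 0" if p: "p \<in> r" "p \<noteq> 0" for p
  proof -
    obtain c where c: "0 \<le> c" "p = c *\<^sub>R p1" using p(1) unfolding \<tau>(2) ray_def p1_def by blast
    then have "0 < c" using p(2) by (cases "c = 0") auto
    then show "0 < \<phi> s p $ i" "0 < \<phi> s p $ j" "\<phi> s p $ m = 0" unfolding c(2) linear_cmul[OF lin] using ij by simp_all
  qed
  have lens: "lengths (\<phi> s p) = {#\<phi> s p $ i, \<phi> s p $ j, \<phi> s p $ m#}" for p
    using ij(1-3) exhaust_3[of i] exhaust_3[of j] exhaust_3[of m] by (auto simp: lengths_def add_mset_commute)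
  have dumb: "dumbbell_curve (vector [\<phi> s p $ i, \<phi> s p $ j, 0]) = theta_curve (\<phi> s p)" if p: "p \<in> r" for p
  proof (cases "p = 0")
    case True
    have "(vector [0, 0, 0] :: real^3) = 0" by (simp add: vec3_eq_iff)
    then show ?thesis unfolding True linear_0[OF lin] using theta_curve_zero by simp
  next
    case False
    show ?thesis unfolding theta_curve_bouquet[OF ij(1-3) supp[OF p False]]
      by (rule dumbbell_curve_bouquet[OF supp(1,2)[OF p False]])
  qed
  define \<psi> :: "(real \<times> real) \<times> real \<Rightarrow> real^3" where "\<psi> = (\<lambda>(p, t). vector [\<phi> s p $ i, \<phi> s p $ j, t])"
  have psi: "\<psi> q = vector [\<phi> s (fst q) $ i, \<phi> s (fst q) $ j, snd q]" for q
    by (simp add: \<psi>_def split_beta)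
  have linpsi: "linear \<psi>"
    by (rule linearI) (simp_all add: psi vec3_eq_iff linear_add[OF lin] linear_cmul[OF lin])
  have nnpsi: "\<forall>q\<in>r \<times> {0..}. \<forall>n. 0 \<le> \<psi> q $ n"
  proof
    fix q :: "(real \<times> real) \<times> real" assume "q \<in> r \<times> {0..}"
    then have q: "fst q \<in> r" "0 \<le> snd q" by auto
    have "0 \<le> \<phi> s (fst q) $ i" "0 \<le> \<phi> s (fst q) $ j" using nn[OF q(1)] by blast+
    then show "\<forall>n. 0 \<le> \<psi> q $ n" unfolding psi forall_3 using q(2) by simp
  qed
  have image: "dumbbell_curve ` \<psi> ` (r \<times> {0..}) = times_bridge (theta_curve ` \<phi> s ` r)"
  proof
    show "dumbbell_curve ` \<psi> ` (r \<times> {0..}) \<subseteq> times_bridge (theta_curve ` \<phi> s ` r)"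
    proof
      fix \<Gamma> assume "\<Gamma> \<in> dumbbell_curve ` \<psi> ` (r \<times> {0..})"
      then obtain q where q: "q \<in> r \<times> {0..}" "\<Gamma> = dumbbell_curve (\<psi> q)" by blast
      then have p: "fst q \<in> r" and t: "0 \<le> snd q" by auto
      have "theta_curve (\<phi> s (fst q)) \<in> theta_curve ` \<phi> s ` r" using imageI[OF imageI[OF p]] .
      then have "dumbbell_curve (vector [\<phi> s (fst q) $ i, \<phi> s (fst q) $ j, 0]) \<in> theta_curve ` \<phi> s ` r"
        unfolding dumb[OF p] .
      moreover have "0 \<le> \<phi> s (fst q) $ i" "0 \<le> \<phi> s (fst q) $ j" using nn[OF p] by blast+
      ultimately show "\<Gamma> \<in> times_bridge (theta_curve ` \<phi> s ` r)"
        unfolding times_bridge_def q(2) psi using t by blast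
    qed
    show "times_bridge (theta_curve ` \<phi> s ` r) \<subseteq> dumbbell_curve ` \<psi> ` (r \<times> {0..})"
    proof
      fix \<Gamma> assume "\<Gamma> \<in> times_bridge (theta_curve ` \<phi> s ` r)"
      then obtain a b t p where \<Gamma>: "\<Gamma> = dumbbell_curve (vector [a, b, t])" "0 \<le> a" "0 \<le> b" "0 \<le> t"
        and p: "p \<in> r" "dumbbell_curve (vector [a, b, 0]) = theta_curve (\<phi> s p)"
        unfolding times_bridge_def by blast
      have "\<Gamma> = dumbbell_curve (\<psi> (p, t))"
      proof (cases "p = 0")
        case True
        have "dumbbell_curve (vector [a, b, 0]) = theta_curve 0" using p(2) unfolding True linear_0[OF lin] .
        from bridgeless_dumbbell_eq_zero[OF this] show ?thesis
          unfolding \<Gamma>(1) psi True by (simp add: linear_0[OF lin])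
      next
        case False
        note q = chart_bridgeless[OF \<phi>[OF s] d_pos rs[OF p(1)] rw(2)[OF p(1) False] \<Gamma>(2,3) p(2)]
        have "{#a, b#} + {#0#} = {#\<phi> s p $ i, \<phi> s p $ j#} + {#0#}"
          using q(3) unfolding lens supp(3)[OF p(1) False] by (simp add: add_mset_commute)
        then have "{#a, b#} = {#\<phi> s p $ i, \<phi> s p $ j#}" by (rule add_right_imp_eq)
        from mset_2_eq[OF this] show ?thesis
          unfolding \<Gamma>(1) psi fst_conv snd_conv using dumbbell_curve_swap[OF q(1,2) \<Gamma>(4)] by auto
      qed
      then show "\<Gamma> \<in> dumbbell_curve ` \<psi> ` (r \<times> {0..})" using p(1) \<Gamma>(4) by blast
    qed
  qed
  have "\<forall>p\<in>r - {0}. {m. \<phi> s p $ m \<noteq> 0} = {i, j}"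
  proof
    fix p assume "p \<in> r - {0}"
    then have sp: "0 < \<phi> s p $ i" "0 < \<phi> s p $ j" "\<phi> s p $ m = 0" using supp by blast+
    have "n = i \<or> n = j \<or> n = m" for n using ij(4) by blast
    then show "{m. \<phi> s p $ m \<noteq> 0} = {i, j}" using sp by fastforce
  qed
  moreover have "linear_to_cell (r \<times> {0..}) \<psi>" unfolding linear_to_cell_def using linpsi nnpsi by blast
  moreover have "dumbbell_curve ` \<psi> ` (r \<times> {0..}) \<subseteq> dumbbell_part"
    unfolding dumbbell_part_def by (intro image_mono) (use nnpsi in blast)
  ultimately show ?thesis using ij(1) image unfolding Let_def \<psi>_def by blast
qed

lemma charts_agree_on_face:
  assumes s: "s \<in> max_cones (Delta d k)" and s': "s' \<in> max_cones (Delta d k)"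
    and F: "F face_of s" "F face_of s'" "p \<in> F"
  shows "theta_curve (\<phi> s p) = theta_curve (\<phi> s' p)"
proof (cases "s = s'")
  case False
  have p: "p \<in> s" "p \<in> s'" using F face_of_imp_subset by blast+
  from neighbouring_cones_Int[OF s s' False p] show ?thesis
  proof
    assume "p = 0"
    then show ?thesis using \<phi>[OF s] \<phi>[OF s'] linear_0 unfolding chart_def by metis
  next
    assume "p \<in> open_quadrant"
    then show ?thesis by (rule charts_agree[OF \<phi>[OF s] \<phi>[OF s'] d_pos p])
  qed
qed simp

end

end

section \<open>The decomposition of the split locus\<close>

theorem theorem1p7:
  fixes d :: nat
  assumes "2 \<le> d"
  shows "card (split_indices d) = totient d \<and>
    split_locus d = (\<Union>k\<in>split_indices d. L_locus d k) \<and>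
    (\<forall>k\<in>split_indices d.
       fan (Delta d k) \<and>
       \<Union>(Delta d k) = {0..} \<times> {0..} \<and>
       (\<forall>s\<in>max_cones (Delta d k). aff_dim s = 2) \<and>
       (\<exists>\<phi> :: (real \<times> real) set \<Rightarrow> real \<times> real \<Rightarrow> real^3.
          \<comment> \<open>correspondence with the locus \<open>L\<^sub>k\<close>\<close>
          (\<forall>s\<in>max_cones (Delta d k). \<forall>p\<in>s \<inter> open_quadrant.
             torelli (theta_curve (\<phi> s p)) = ppav_rel `` {split_matrix d k p}) \<and>
          L_locus d k =
            (\<Union>s\<in>max_cones (Delta d k). theta_curve ` \<phi> s ` (s \<inter> open_quadrant)) \<union>
            (\<Union>s\<in>max_cones (Delta d k). \<Union>r\<in>{r \<in> inner_rays (Delta d k). r face_of s}.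
               times_bridge (theta_curve ` \<phi> s ` (r - {0}))) \<and>
          \<comment> \<open>(a)\<close>
          (\<forall>s\<in>max_cones (Delta d k).
             linear_to_cell s (\<phi> s) \<and>
             (\<forall>p\<in>interior s. \<forall>i. 0 < \<phi> s p $ i) \<and>
             convex_cone (\<phi> s ` s) \<and> aff_dim (\<phi> s ` interior s) = 2 \<and>
             theta_curve ` \<phi> s ` interior s \<subseteq> theta_part) \<and>
          \<comment> \<open>(b)\<close>
          (\<forall>s\<in>max_cones (Delta d k). \<forall>r\<in>inner_rays (Delta d k). r face_of s \<longrightarrow>
             (\<exists>i j. i \<noteq> j \<and>
                (\<forall>p\<in>r - {0}. {m. \<phi> s p $ m \<noteq> 0} = {i, j}) \<and>
                (let \<psi> = (\<lambda>(p, t). vector [\<phi> s p $ i, \<phi> s p $ j, t]) in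
                   linear_to_cell (r \<times> {0..}) \<psi> \<and>
                   dumbbell_curve ` \<psi> ` (r \<times> {0..}) \<subseteq> dumbbell_part \<and>
                   dumbbell_curve ` \<psi> ` (r \<times> {0..}) =
                     times_bridge (theta_curve ` \<phi> s ` r)))) \<and>
          \<comment> \<open>(c)\<close>
          (\<forall>s\<in>max_cones (Delta d k). \<forall>s'\<in>max_cones (Delta d k).
             \<forall>F\<in>Delta d k. F face_of s \<and> F face_of s' \<longrightarrow>
               (\<forall>p\<in>F. theta_curve (\<phi> s p) = theta_curve (\<phi> s' p)))))"
proof -
  have coprime: "coprime k d" if "k \<in> split_indices d" for k using that by (simp add: split_indices_def)
  show ?thesis
  proof (intro conjI ballI, goal_cases)
    case 1
    show ?case by (rule card_split_indices[OF assms])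
  next
    case 2
    show ?case unfolding split_locus_def L_locus_def by blast
  next
    case (3 k)
    note k = coprime[OF 3]
    show ?case unfolding Delta_eq_sector_fan[OF assms k] by (rule fan_sector_fan[OF walls_slopes(1,2)[OF assms k]])
  next
    case (4 k)
    note k = coprime[OF 4]
    show ?case unfolding Delta_eq_sector_fan[OF assms k] by (rule Union_sector_fan[OF walls_slopes(1,2)[OF assms k]])
  next
    case (5 k s)
    note k = coprime[OF 5(1)]
    show ?case using 5(2) gapsD(1)[OF walls_slopes(1,2)[OF assms k]] aff_dim_sector
      unfolding max_cones_Delta[OF assms k] by blast
  next
    case (6 k)
    note k = coprime[OF 6]
    have "\<forall>s\<in>max_cones (Delta d k). \<exists>A. chart d k s A" using chart_exists[OF assms k] by blast
    from bchoice[OF this] obtain \<phi> where \<phi>: "\<And>s. s \<in> max_cones (Delta d k) \<Longrightarrow> chart d k s (\<phi> s)" by blast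
    show ?case
    proof (intro exI[of _ \<phi>] conjI, goal_cases)
      case 1
      show ?case using chart_theta(4)[OF \<phi> d_pos[OF assms k]] by blast
    next
      case 2
      show ?case by (rule L_locus_eq[OF assms k \<phi>])
    next
      case 3
      show ?case by (intro ballI) (rule chart_theta_cone[OF assms k \<phi>])
    next
      case 4
      show ?case by (intro ballI impI) (rule chart_ray_times_bridge[OF assms k \<phi>])
    next
      case 5
      show ?case
      proof (intro ballI impI)
        fix s s' F p
        assume "s \<in> max_cones (Delta d k)" "s' \<in> max_cones (Delta d k)" "F face_of s \<and> F face_of s'" "p \<in> F"
        then show "theta_curve (\<phi> s p) = theta_curve (\<phi> s' p)" using charts_agree_on_face[OF assms k \<phi>] by blast
      qed
    qed
  qed
qed

end
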